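(* Let $\mathbb{F}$ be an algebraically closed field of characteristic not equal to $2$, let $V$ be a vector space over $\mathbb{F}$ with $\dim_{\mathbb{F}} V=\aleph_0$, let $f:V\to\mathbb{F}$ be a nondegenerate quadratic form, and let $v_i$, $i\in\mathbb{N}$, be an orthonormal basis of $V$. Let $0=n_0<n_1<n_2<\cdots$ be an increasing sequence of even numbers. For $i\in\mathbb{N}$ let $V_i$ be the span of $v_{n_{i-1}+1},\ldots,v_{n_i}$, identify $\mathcal{C}\ell(V_i,f)$ with the subalgebra of $\mathcal{C}\ell(V,f)$ generated by $V_i$, and let $c_i=v_1v_2\cdots v_{n_i}\in\mathcal{C}\ell(V,f)$. Define the subalgebras of $\mathcal{C}\ell(V,f)$ $$A_1=\mathcal{C}\ell(V_1,f),\qquad A_i=\mathcal{C}\ell(V_i,f)_{\overline{0}}+c_i\,\mathcal{C}\ell(V_i,f)_{\overline{1}}\quad (i\geq 2).$$ Then $A_i\cong\mathcal{C}\ell(V_i,f)$ for each $i\in\mathbb{N}$; $[A_i,A_j]=(0)$ for all $i,j\in\mathbb{N}$ with $i\neq j$; and $$\mathcal{C}\ell(V,f)\cong\bigotimes_{i\in\mathbb{N}}A_i.$$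
   Context: $\mathbb{N}$ is the set of positive integers. A quadratic form on $V$ is a map $f:V\to\mathbb{F}$ with $f(\lambda v)=\lambda^2 f(v)$ such that $f(v,w)=f(v+w)-f(v)-f(w)$ is bilinear; it is nondegenerate if the bilinear form $f(v,w)$ is nondegenerate. The Clifford algebra $\mathcal{C}\ell(V,f)$ is the unital associative $\mathbb{F}$-algebra generated by $V$ with defining relations $v^2=f(v)\cdot 1$, $v\in V$. For a subspace $W\subseteq V$, $\mathcal{C}\ell(W,f)$ denotes the Clifford algebra of $W$ with the restriction of $f$. It is $\mathbb{Z}/2\mathbb{Z}$-graded: $\mathcal{C}\ell(W,f)_{\overline{0}}$ is the span of $1$ and all products of an even number of elements of $W$, and $\mathcal{C}\ell(W,f)_{\overline{1}}$ is the span of all products of an odd number of elements of $W$. A basis $v_i$, $i\in\mathbb{N}$, of $V$ is orthonormal if $v_iv_j+v_jv_i=2\delta_{ij}$ in $\mathcal{C}\ell(V,f)$ for all $i,j$ (equivalently $f(v_i)=1$ and $f(v_i,v_j)=0$ for $i\ne j$). $[a,b]=ab-ba$. The infinite tensor product $\bigotimes_{i\in\mathbb{N}}A_i$ of unital algebras is the direct limit of the finite tensor products $A_1\otimes\cdots\otimes A_n$ over $\mathbb{F}$ under the maps $a\mapsto a\otimes 1$. Isomorphisms are isomorphisms of unital $\mathbb{F}$-algebras. *)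

theory Defs
  imports
    "HOL-Library.Poly_Mapping"
    "HOL-Library.Countable_Set"
    "HOL-Computational_Algebra.Polynomial"
    "HOL-Algebra.QuotRing"
    "HOL-Algebra.Subrings"
    "HOL-Algebra.Module"
    "HOL-Algebra.Product_Groups"
begin

section \<open>Unital algebras over a field\<close>

text \<open>
  The scalars are a type \<open>'k\<close>; algebras are records \<open>('k, 'a) module\<close>, as in \<open>HOL-Algebra\<close>.
  The library locale \<open>algebra\<close> demands commutativity of the multiplication and is therefore not
  usable for Clifford algebras.
\<close>

definition alg_isomorphic :: "('k :: field, 'a) module \<Rightarrow> ('k, 'b) module \<Rightarrow> bool" where
  "alg_isomorphic A B \<longleftrightarrow>
     (\<exists>h\<in>ring_iso A B. \<forall>c. \<forall>x\<in>carrier A. h (c \<odot>\<^bsub>A\<^esub> x) = c \<odot>\<^bsub>B\<^esub> h x)"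

definition subalg :: "'a set \<Rightarrow> ('k :: field, 'a) module \<Rightarrow> bool" where
  "subalg H A \<longleftrightarrow> subring H A \<and> (\<forall>c. \<forall>x\<in>H. c \<odot>\<^bsub>A\<^esub> x \<in> H)"

definition alg_gen :: "('k :: field, 'a) module \<Rightarrow> 'a set \<Rightarrow> 'a set" where
  "alg_gen A S = \<Inter>{H. subalg H A \<and> S \<subseteq> H}"

inductive_set lin_span :: "('k :: field, 'a) module \<Rightarrow> 'a set \<Rightarrow> 'a set"
  for A :: "('k, 'a) module" and S :: "'a set" where
  zero: "\<zero>\<^bsub>A\<^esub> \<in> lin_span A S"
| step: "x \<in> S \<Longrightarrow> y \<in> lin_span A S \<Longrightarrow> c \<odot>\<^bsub>A\<^esub> x \<oplus>\<^bsub>A\<^esub> y \<in> lin_span A S"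

abbreviation alg_prod :: "('k :: field, 'a) module \<Rightarrow> 'a list \<Rightarrow> 'a" where
  "alg_prod A xs \<equiv> foldr (\<otimes>\<^bsub>A\<^esub>) xs \<one>\<^bsub>A\<^esub>"

text \<open>For an ideal \<open>I\<close> the union below is the single coset \<open>I +> c \<odot> x\<close>, for any \<open>x \<in> X\<close>.\<close>

definition quot_alg :: "('k :: field, 'a) module \<Rightarrow> 'a set \<Rightarrow> ('k, 'a set) module" where
  "quot_alg A I =
     \<lparr>carrier = carrier (A Quot I),
      monoid.mult = monoid.mult (A Quot I),
      one = one (A Quot I),
      zero = zero (A Quot I),
      add = add (A Quot I),
      smult = (\<lambda>c X. \<Union>x\<in>X. I +>\<^bsub>A\<^esub> (c \<odot>\<^bsub>A\<^esub> x))\<rparr>"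

definition monoid_algebra :: "('a, 'm) monoid_scheme \<Rightarrow> ('k :: field, 'a \<Rightarrow>\<^sub>0 'k) module" where
  "monoid_algebra G =
     \<lparr>carrier = {p. Poly_Mapping.keys p \<subseteq> carrier G},
      monoid.mult = (\<lambda>p q. \<Sum>a\<in>Poly_Mapping.keys p. \<Sum>b\<in>Poly_Mapping.keys q.
        Poly_Mapping.single (a \<otimes>\<^bsub>G\<^esub> b) (Poly_Mapping.lookup p a * Poly_Mapping.lookup q b)),
      one = Poly_Mapping.single \<one>\<^bsub>G\<^esub> 1,
      zero = 0,
      add = (+),
      smult = (\<lambda>c. Poly_Mapping.map ((*) c))\<rparr>"


section \<open>Quadratic forms and Clifford algebras\<close>

definition polar :: "('v :: ab_group_add \<Rightarrow> 'k :: field) \<Rightarrow> 'v \<Rightarrow> 'v \<Rightarrow> 'k" where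
  "polar f v w = f (v + w) - f v - f w"

definition quadratic_form ::
    "('k :: field \<Rightarrow> 'v :: ab_group_add \<Rightarrow> 'v) \<Rightarrow> ('v \<Rightarrow> 'k) \<Rightarrow> bool" where
  "quadratic_form scale f \<longleftrightarrow>
     (\<forall>c v. f (scale c v) = c\<^sup>2 * f v) \<and>
     (\<forall>v. Vector_Spaces.linear scale (*) (\<lambda>w. polar f v w)) \<and>
     (\<forall>w. Vector_Spaces.linear scale (*) (\<lambda>v. polar f v w))"

definition nondegenerate_form :: "('v :: ab_group_add \<Rightarrow> 'k :: field) \<Rightarrow> bool" where
  "nondegenerate_form f \<longleftrightarrow> (\<forall>v. (\<forall>w. polar f v w = 0) \<longrightarrow> v = 0)"

text \<open>
  The free algebra on the set \<open>W\<close> is the algebra of the monoid of words over \<open>W\<close>. Dividing out the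
  first two families of relations gives the tensor algebra of the vector space \<open>W\<close>.
\<close>

definition free_alg :: "'v set \<Rightarrow> ('k :: field, 'v list \<Rightarrow>\<^sub>0 'k) module" where
  "free_alg W = monoid_algebra \<lparr>carrier = lists W, monoid.mult = (@), one = []\<rparr>"

definition clifford_rels ::
    "('k :: field \<Rightarrow> 'v :: ab_group_add \<Rightarrow> 'v) \<Rightarrow> 'v set \<Rightarrow> ('v \<Rightarrow> 'k) \<Rightarrow> ('v list \<Rightarrow>\<^sub>0 'k) set" where
  "clifford_rels scale W f =
     {Poly_Mapping.single [v + w] 1 - Poly_Mapping.single [v] 1 - Poly_Mapping.single [w] 1
        | v w. v \<in> W \<and> w \<in> W} \<union>
     {Poly_Mapping.single [scale c v] 1 - Poly_Mapping.single [v] c | c v. v \<in> W} \<union>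
     {Poly_Mapping.single [v, v] 1 - Poly_Mapping.single [] (f v) | v. v \<in> W}"

definition clifford_ideal ::
    "('k :: field \<Rightarrow> 'v :: ab_group_add \<Rightarrow> 'v) \<Rightarrow> 'v set \<Rightarrow> ('v \<Rightarrow> 'k) \<Rightarrow> ('v list \<Rightarrow>\<^sub>0 'k) set" where
  "clifford_ideal scale W f = Idl\<^bsub>free_alg W\<^esub> (clifford_rels scale W f)"

definition clifford ::
    "('k :: field \<Rightarrow> 'v :: ab_group_add \<Rightarrow> 'v) \<Rightarrow> 'v set \<Rightarrow> ('v \<Rightarrow> 'k)
      \<Rightarrow> ('k, ('v list \<Rightarrow>\<^sub>0 'k) set) module" where
  "clifford scale W f = quot_alg (free_alg W) (clifford_ideal scale W f)"

definition clifford_gen ::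
    "('k :: field \<Rightarrow> 'v :: ab_group_add \<Rightarrow> 'v) \<Rightarrow> 'v set \<Rightarrow> ('v \<Rightarrow> 'k)
      \<Rightarrow> 'v \<Rightarrow> ('v list \<Rightarrow>\<^sub>0 'k) set" where
  "clifford_gen scale W f v =
     clifford_ideal scale W f +>\<^bsub>free_alg W\<^esub> Poly_Mapping.single [v] 1"

text \<open>
  The following live in the Clifford algebra of the whole space \<open>UNIV\<close>. For a subspace \<open>W\<close>, the
  subalgebra generated by \<open>W\<close> is the image of \<open>clifford scale W f\<close>; \<open>clifford_even\<close> and
  \<open>clifford_odd\<close> are its homogeneous components.
\<close>

definition clifford_even ::
    "('k :: field \<Rightarrow> 'v :: ab_group_add \<Rightarrow> 'v) \<Rightarrow> ('v \<Rightarrow> 'k) \<Rightarrow> 'v set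
      \<Rightarrow> ('v list \<Rightarrow>\<^sub>0 'k) set set" where
  "clifford_even scale f W =
     lin_span (clifford scale UNIV f)
       {alg_prod (clifford scale UNIV f) (map (clifford_gen scale UNIV f) ws)
          | ws. set ws \<subseteq> W \<and> even (length ws)}"

definition clifford_odd ::
    "('k :: field \<Rightarrow> 'v :: ab_group_add \<Rightarrow> 'v) \<Rightarrow> ('v \<Rightarrow> 'k) \<Rightarrow> 'v set
      \<Rightarrow> ('v list \<Rightarrow>\<^sub>0 'k) set set" where
  "clifford_odd scale f W =
     lin_span (clifford scale UNIV f)
       {alg_prod (clifford scale UNIV f) (map (clifford_gen scale UNIV f) ws)
          | ws. set ws \<subseteq> W \<and> odd (length ws)}"

text \<open>Families indexed by the positive integers are functions on \<open>nat\<close> used on \<open>{1..}\<close> only.\<close>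

definition is_basis :: "('k :: field \<Rightarrow> 'v :: ab_group_add \<Rightarrow> 'v) \<Rightarrow> (nat \<Rightarrow> 'v) \<Rightarrow> bool" where
  "is_basis scale v \<longleftrightarrow>
     inj_on v {1..} \<and> \<not> module.dependent scale (v ` {1..}) \<and> module.span scale (v ` {1..}) = UNIV"

definition orthonormal ::
    "('k :: field \<Rightarrow> 'v :: ab_group_add \<Rightarrow> 'v) \<Rightarrow> ('v \<Rightarrow> 'k) \<Rightarrow> (nat \<Rightarrow> 'v) \<Rightarrow> bool" where
  "orthonormal scale f v \<longleftrightarrow>
     (let Cl = clifford scale UNIV f; g = clifford_gen scale UNIV f in
      \<forall>i\<ge>1. \<forall>j\<ge>1. g (v i) \<otimes>\<^bsub>Cl\<^esub> g (v j) \<oplus>\<^bsub>Cl\<^esub> g (v j) \<otimes>\<^bsub>Cl\<^esub> g (v i)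
        = (if i = j then 2 else 0) \<odot>\<^bsub>Cl\<^esub> \<one>\<^bsub>Cl\<^esub>)"

definition block ::
    "('k :: field \<Rightarrow> 'v :: ab_group_add \<Rightarrow> 'v) \<Rightarrow> (nat \<Rightarrow> 'v) \<Rightarrow> (nat \<Rightarrow> nat) \<Rightarrow> nat \<Rightarrow> 'v set" where
  "block scale v n i = module.span scale (v ` {n (i - 1) + 1..n i})"

definition block_c ::
    "('k :: field \<Rightarrow> 'v :: ab_group_add \<Rightarrow> 'v) \<Rightarrow> ('v \<Rightarrow> 'k) \<Rightarrow> (nat \<Rightarrow> 'v) \<Rightarrow> (nat \<Rightarrow> nat)
      \<Rightarrow> nat \<Rightarrow> ('v list \<Rightarrow>\<^sub>0 'k) set" where
  "block_c scale f v n i =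
     alg_prod (clifford scale UNIV f) (map (\<lambda>j. clifford_gen scale UNIV f (v j)) [1..<n i + 1])"

definition block_alg ::
    "('k :: field \<Rightarrow> 'v :: ab_group_add \<Rightarrow> 'v) \<Rightarrow> ('v \<Rightarrow> 'k) \<Rightarrow> (nat \<Rightarrow> 'v) \<Rightarrow> (nat \<Rightarrow> nat)
      \<Rightarrow> nat \<Rightarrow> ('v list \<Rightarrow>\<^sub>0 'k) set set" where
  "block_alg scale f v n i =
     (let Cl = clifford scale UNIV f; W = block scale v n i in
      if i = 1 then alg_gen Cl (clifford_gen scale UNIV f ` W)
      else clifford_even scale f W <+>\<^bsub>Cl\<^esub>
             (block_c scale f v n i <#\<^bsub>Cl\<^esub> clifford_odd scale f W))"


section \<open>Tensor products\<close>

text \<open>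
  The algebra of the product monoid is the free vector space on the tuples, with componentwise
  multiplication of tuples. The span of the multilinearity relations is already a two-sided ideal:
  multiplying a relation by a tuple gives another relation. So the quotient by the ideal they
  generate is the usual tensor product of algebras.
\<close>

definition tensor_rels ::
    "'i set \<Rightarrow> ('i \<Rightarrow> ('k :: field, 'a) module) \<Rightarrow> (('i \<Rightarrow> 'a) \<Rightarrow>\<^sub>0 'k) set" where
  "tensor_rels I A =
     {Poly_Mapping.single (x(i := a \<oplus>\<^bsub>A i\<^esub> b)) 1
        - Poly_Mapping.single (x(i := a)) 1 - Poly_Mapping.single (x(i := b)) 1
        | x i a b. x \<in> (\<Pi>\<^sub>E i\<in>I. carrier (A i)) \<and> i \<in> I \<and> a \<in> carrier (A i) \<and> b \<in> carrier (A i)} \<union>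
     {Poly_Mapping.single (x(i := c \<odot>\<^bsub>A i\<^esub> a)) 1 - Poly_Mapping.single (x(i := a)) c
        | x i c a. x \<in> (\<Pi>\<^sub>E i\<in>I. carrier (A i)) \<and> i \<in> I \<and> a \<in> carrier (A i)}"

definition tensor_ideal ::
    "'i set \<Rightarrow> ('i \<Rightarrow> ('k :: field, 'a) module) \<Rightarrow> (('i \<Rightarrow> 'a) \<Rightarrow>\<^sub>0 'k) set" where
  "tensor_ideal I A = Idl\<^bsub>monoid_algebra (product_group I A)\<^esub> (tensor_rels I A)"

definition tensor ::
    "'i set \<Rightarrow> ('i \<Rightarrow> ('k :: field, 'a) module) \<Rightarrow> ('k, (('i \<Rightarrow> 'a) \<Rightarrow>\<^sub>0 'k) set) module" where
  "tensor I A = quot_alg (monoid_algebra (product_group I A)) (tensor_ideal I A)"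

text \<open>
  The map sending the class of \<open>x\<^sub>1 \<otimes> \<dots> \<otimes> x\<^sub>m\<close> to the class of
  \<open>x\<^sub>1 \<otimes> \<dots> \<otimes> x\<^sub>m \<otimes> 1 \<otimes> \<dots> \<otimes> 1\<close>, for \<open>m \<le> n\<close>. The union is over representatives, all
  of which give the same coset.
\<close>

definition tensor_emb ::
    "(nat \<Rightarrow> ('k :: field, 'a) module) \<Rightarrow> nat \<Rightarrow> nat
      \<Rightarrow> ((nat \<Rightarrow> 'a) \<Rightarrow>\<^sub>0 'k) set \<Rightarrow> ((nat \<Rightarrow> 'a) \<Rightarrow>\<^sub>0 'k) set" where
  "tensor_emb A m n X =
     (\<Union>p\<in>X. tensor_ideal {1..n} A +>\<^bsub>monoid_algebra (product_group {1..n} A)\<^esub>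
        (\<Sum>x\<in>Poly_Mapping.keys p.
           Poly_Mapping.single (\<lambda>i\<in>{1..n}. if i \<le> m then x i else \<one>\<^bsub>A i\<^esub>)
             (Poly_Mapping.lookup p x)))"

definition dirlim_rel ::
    "(nat \<Rightarrow> ('k :: field, 'a) module) \<Rightarrow> (nat \<Rightarrow> nat \<Rightarrow> 'a \<Rightarrow> 'a) \<Rightarrow> ((nat \<times> 'a) \<times> (nat \<times> 'a)) set" where
  "dirlim_rel T \<phi> =
     {((m, x), (n, y)). x \<in> carrier (T m) \<and> y \<in> carrier (T n) \<and>
        (\<exists>k\<ge>max m n. \<phi> m k x = \<phi> n k y)}"

definition dirlim ::
    "(nat \<Rightarrow> ('k :: field, 'a) module) \<Rightarrow> (nat \<Rightarrow> nat \<Rightarrow> 'a \<Rightarrow> 'a) \<Rightarrow> ('k, (nat \<times> 'a) set) module" where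
  "dirlim T \<phi> =
     (let r = dirlim_rel T \<phi> in
      \<lparr>carrier = (SIGMA m:UNIV. carrier (T m)) // r,
       monoid.mult = (\<lambda>X Y. \<Union>(m, x)\<in>X. \<Union>(n, y)\<in>Y.
         r `` {(max m n, \<phi> m (max m n) x \<otimes>\<^bsub>T (max m n)\<^esub> \<phi> n (max m n) y)}),
       one = r `` {(0, \<one>\<^bsub>T 0\<^esub>)},
       zero = r `` {(0, \<zero>\<^bsub>T 0\<^esub>)},
       add = (\<lambda>X Y. \<Union>(m, x)\<in>X. \<Union>(n, y)\<in>Y.
         r `` {(max m n, \<phi> m (max m n) x \<oplus>\<^bsub>T (max m n)\<^esub> \<phi> n (max m n) y)}),
       smult = (\<lambda>c X. \<Union>(m, x)\<in>X. r `` {(m, c \<odot>\<^bsub>T m\<^esub> x)})\<rparr>)"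

text \<open>
  The limit of \<open>A\<^sub>1 \<otimes> \<dots> \<otimes> A\<^sub>n\<close>. The system also contains the term \<open>n = 0\<close>, the ground field,
  which has no effect on the limit.
\<close>

definition inf_tensor ::
    "(nat \<Rightarrow> ('k :: field, 'a) module)
      \<Rightarrow> ('k, (nat \<times> ((nat \<Rightarrow> 'a) \<Rightarrow>\<^sub>0 'k) set) set) module" where
  "inf_tensor A = dirlim (\<lambda>n. tensor {1..n} A) (tensor_emb A)"

end

theory Submission
  imports Defs
begin

text \<open>
  Write $e_j$ for the image of $v_j$ in the Clifford algebra $C$ of $V$. The $e_j$ anticommute and
  square to one. Hence, up to a nonzero scalar, a product of $e_j$'s depends only on the set of
  indices that occur in it an odd number of times (\<open>word_proportional\<close>), and a product of two such
  products has the symmetric difference of their sets. Products with different sets are linearly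
  independent, because $C$ carries a linear form, the trace, with value $1$ at $1$ and value $0$ at
  every product whose set is not empty. This gives one injectivity criterion for all purposes,
  \<open>inj_on_if_basis_to_words\<close>: a homomorphism into $C$ is injective as soon as it sends a finite
  spanning family to multiples of products with pairwise different sets.

  The trace comes from Chevalley's representation: a vector $v$ acts on alternating forms as
  contraction with $v$ plus exterior multiplication by the linear form $f(v,\cdot)/2$, and the trace of
  $x$ is the degree zero part of $x$ applied to the constant form $1$. This works for every
  quadratic form, so it shows $1\neq 0$ in $C$ before anything is known about the $v_i$. Only then does
  orthonormality, a statement about $C$, give $f(v_i)=1$ and $f(v_i,v_j)=0$.

  Since $n_i$ is even, $c_i$ anticommutes with $e_j$ for $j\le n_i$ and commutes with the later ones,
  and $c_i^2$ is a nonzero scalar. Choose $\lambda$ with $\lambda^2c_i^2=-1$. Then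
  $w\mapsto\lambda c_iw$ satisfies the defining relations of the Clifford algebra of $V_i$, and the
  homomorphism it induces maps onto the even part plus $c_i$ times the odd part, that is, onto $A_i$
  (\<open>twisted_embedding\<close>, \<open>block_alg_eq\<close>). For $i=1$ this is the whole subalgebra generated by $V_1$,
  as $c_1$ is itself an even element of it. For $k\le n_{j-1}$, both $c_j$ and the elements of $V_j$
  anticommute with $e_k$, so $e_k$ commutes with $A_j$, and therefore $A_i$ does for $i<j$.

  Because the $A_i$ commute, multiplication is a homomorphism $A_1\otimes\cdots\otimes A_m\to C$. It is
  injective by the criterion above (\<open>mult_hom_inj\<close>) and compatible with $a\mapsto a\otimes 1$. The images
  exhaust $C$: the image for $m$ contains $c_i$ and $c_ie_j$ for $i\le m$ and $v_j\in V_i$, hence $e_j$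
  (\<open>onto_mult_image\<close>). A direct limit with compatible injections that jointly exhaust an algebra is that
  algebra (\<open>alg_isomorphic_dirlim\<close>).
\<close>

section \<open>Unital algebras, spans and homomorphisms\<close>

text \<open>
  An algebra over the field given by the type of the scalars. Every law is relative to the carrier,
  so subalgebras and quotients are instances as well.
\<close>

locale unital_algebra = ring A for A :: "('k :: field, 'a) module" (structure) +
  assumes smult_closed [simp]: "x \<in> carrier A \<Longrightarrow> c \<odot> x \<in> carrier A"
    and smult_add_right: "x \<in> carrier A \<Longrightarrow> y \<in> carrier A \<Longrightarrow> c \<odot> (x \<oplus> y) = c \<odot> x \<oplus> c \<odot> y"
    and smult_add_left: "x \<in> carrier A \<Longrightarrow> (c + d) \<odot> x = c \<odot> x \<oplus> d \<odot> x"
    and smult_smult [simp]: "x \<in> carrier A \<Longrightarrow> c \<odot> (d \<odot> x) = (c * d) \<odot> x"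
    and smult_one [simp]: "x \<in> carrier A \<Longrightarrow> 1 \<odot> x = x"
    and smult_mult_left [simp]: "x \<in> carrier A \<Longrightarrow> y \<in> carrier A \<Longrightarrow> (c \<odot> x) \<otimes> y = c \<odot> (x \<otimes> y)"
    and smult_mult_right [simp]: "x \<in> carrier A \<Longrightarrow> y \<in> carrier A \<Longrightarrow> x \<otimes> (c \<odot> y) = c \<odot> (x \<otimes> y)"
begin

lemma smult_zero_left [simp]:
  assumes "x \<in> carrier A" shows "0 \<odot> x = \<zero>"
proof -
  have "0 \<odot> x \<oplus> 0 \<odot> x = 0 \<odot> x"
    using smult_add_left[OF assms, of 0 0] by simp
  then show ?thesis
    using assms by (metis add.r_cancel_one' smult_closed)
qed

lemma smult_zero_right [simp]: "c \<odot> \<zero> = \<zero>"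
  using smult_smult[of \<zero> c 0] smult_zero_left[of \<zero>] by simp

lemma smult_minus_one: 
  assumes "x \<in> carrier A" shows "(-1) \<odot> x = \<ominus> x"
proof -
  have "(-1) \<odot> x \<oplus> x = 0 \<odot> x"
    using smult_add_left[OF assms, of "-1" 1] assms by simp
  then show ?thesis
    using assms by (simp add: minus_equality)
qed

lemma lin_span_closed: "S \<subseteq> carrier A \<Longrightarrow> x \<in> lin_span A S \<Longrightarrow> x \<in> carrier A"
  by (rotate_tac 1, induct rule: lin_span.induct) auto

lemma lin_span_base: "S \<subseteq> carrier A \<Longrightarrow> x \<in> S \<Longrightarrow> x \<in> lin_span A S"
  using lin_span.step[of x S \<zero> A 1] lin_span.zero[of A S] by (auto simp: subset_iff)

lemma lin_span_add:
  assumes "S \<subseteq> carrier A" "x \<in> lin_span A S" "y \<in> lin_span A S"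
  shows "x \<oplus> y \<in> lin_span A S"
  using assms(2)
proof induct
  case zero
  then show ?case using assms lin_span_closed by simp
next
  case (step x z c)
  have "c \<odot> x \<oplus> (z \<oplus> y) \<in> lin_span A S"
    using step by (intro lin_span.step)
  then show ?case
    using step assms lin_span_closed[OF assms(1)] by (simp add: a_assoc subset_iff)
qed

lemma lin_span_smult:
  assumes "S \<subseteq> carrier A" "x \<in> lin_span A S"
  shows "c \<odot> x \<in> lin_span A S"
  using assms(2)
proof induct
  case zero
  then show ?case by (simp add: lin_span.zero)
next
  case (step x z d)
  have "(c * d) \<odot> x \<oplus> c \<odot> z \<in> lin_span A S"
    using step by (intro lin_span.step)
  then show ?case
    using step assms lin_span_closed[OF assms(1)] by (simp add: subset_iff smult_add_right)
qed

lemma lin_span_subset: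
  assumes "T \<subseteq> carrier A" "S \<subseteq> lin_span A T"
  shows "lin_span A S \<subseteq> lin_span A T"
proof
  fix x assume "x \<in> lin_span A S"
  then show "x \<in> lin_span A T"
    by induct (use assms in \<open>auto simp: lin_span.zero subset_iff intro: lin_span_add lin_span_smult\<close>)
qed

lemma lin_span_mono: "T \<subseteq> carrier A \<Longrightarrow> S \<subseteq> T \<Longrightarrow> lin_span A S \<subseteq> lin_span A T"
  by (intro lin_span_subset) (auto intro: lin_span_base)

lemma lin_span_mult:
  assumes "S \<subseteq> carrier A" "T \<subseteq> carrier A" "U \<subseteq> carrier A"
    and "\<And>x y. x \<in> S \<Longrightarrow> y \<in> T \<Longrightarrow> x \<otimes> y \<in> lin_span A U"
    and "x \<in> lin_span A S" "y \<in> lin_span A T"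
  shows "x \<otimes> y \<in> lin_span A U"
  using assms(5)
proof induct
  case zero
  then show ?case using lin_span_closed[OF assms(2,6)] by (simp add: lin_span.zero)
next
  case (step x z c)
  have y: "y \<in> carrier A" and x: "x \<in> carrier A" and z: "z \<in> carrier A"
    using assms step lin_span_closed by blast+
  have "x \<otimes> y \<in> lin_span A U"
    using assms(6)
  proof induct
    case zero
    then show ?case using x by (simp add: lin_span.zero)
  next
    case (step y' z' d)
    then have "y' \<in> carrier A" "z' \<in> carrier A"
      using assms lin_span_closed by blast+
    then show ?case
      using x step assms \<open>x \<in> S\<close> by (simp add: r_distr lin_span_add lin_span_smult)
  qed
  then show ?case
    using step x y z assms by (simp add: l_distr lin_span_add lin_span_smult)
qed

lemma lin_span_commute:
  assumes "S \<subseteq> carrier A" "y \<in> carrier A" "\<And>x. x \<in> S \<Longrightarrow> x \<otimes> y = y \<otimes> x"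
    and "x \<in> lin_span A S"
  shows "x \<otimes> y = y \<otimes> x"
  using assms(4)
proof induct
  case (step x z c)
  then have "x \<in> carrier A" "z \<in> carrier A"
    using assms lin_span_closed by blast+
  then show ?case using step assms by (simp add: l_distr r_distr)
qed (use assms in simp)

text \<open>
  Splitting off one generator at a time replaces the expansion in a finite spanning family by an
  induction, without sums in the algebra.
\<close>

lemma lin_span_insert:
  assumes "S \<subseteq> carrier A" "b \<in> carrier A" "x \<in> lin_span A (insert b S)"
  shows "\<exists>c. \<exists>y\<in>lin_span A S. x = c \<odot> b \<oplus> y"
  using assms(3)
proof induct
  case zero
  show ?case
    using assms by (intro exI[of _ 0] bexI[of _ \<zero>]) (auto intro: lin_span.zero)
next
  case (step x z c)
  then obtain d y where y: "y \<in> lin_span A S" "z = d \<odot> b \<oplus> y" by blast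
  then have yc: "y \<in> carrier A" using assms lin_span_closed by blast
  show ?case
  proof (cases "x = b")
    case True
    then have "c \<odot> x \<oplus> z = (c + d) \<odot> b \<oplus> y"
      using y yc assms by (simp add: smult_add_left a_assoc)
    then show ?thesis using y by blast
  next
    case False
    with step have "x \<in> S" by simp
    then have "c \<odot> x \<oplus> z = d \<odot> b \<oplus> (c \<odot> x \<oplus> y)"
      using y yc assms by (simp add: a_lcomm subset_iff)
    then show ?thesis using \<open>x \<in> S\<close> y by (blast intro: lin_span.step)
  qed
qed

lemma alg_prod_closed [simp]: "set xs \<subseteq> carrier A \<Longrightarrow> alg_prod A xs \<in> carrier A"
  by (induct xs) auto

lemma alg_prod_append:
  "set xs \<subseteq> carrier A \<Longrightarrow> set ys \<subseteq> carrier A \<Longrightarrow> alg_prod A (xs @ ys) = alg_prod A xs \<otimes> alg_prod A ys"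
  by (induct xs) (auto simp: m_assoc simp del: foldr_append)

lemma alg_prod_commute:
  assumes "set xs \<subseteq> carrier A" "y \<in> carrier A" "\<And>x. x \<in> set xs \<Longrightarrow> x \<otimes> y = y \<otimes> x"
  shows "alg_prod A xs \<otimes> y = y \<otimes> alg_prod A xs"
  using assms
proof (induct xs)
  case (Cons x xs)
  then have "x \<otimes> alg_prod A xs \<otimes> y = x \<otimes> (y \<otimes> alg_prod A xs)"
    by (simp add: m_assoc)
  also have "\<dots> = y \<otimes> (x \<otimes> alg_prod A xs)"
    using Cons by (simp flip: m_assoc)
  finally show ?case by simp
qed auto

lemma unital_algebra_subalg:
  assumes "subalg H A" shows "unital_algebra (A\<lparr>carrier := H\<rparr>)"
proof -
  have H: "subring H A" "\<And>c x. x \<in> H \<Longrightarrow> c \<odot> x \<in> H"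
    using assms by (auto simp: subalg_def)
  have "H \<subseteq> carrier A" using subringE(1)[OF H(1)] .
  then show ?thesis
    by (intro unital_algebra.intro unital_algebra_axioms.intro subring_is_ring H)
      (auto simp: H smult_add_left smult_add_right subset_iff)
qed

end

definition alg_hom :: "('k :: field, 'a) module \<Rightarrow> ('k, 'b) module \<Rightarrow> ('a \<Rightarrow> 'b) set" where
  "alg_hom A B = {h \<in> ring_hom A B. \<forall>c. \<forall>x\<in>carrier A. h (c \<odot>\<^bsub>A\<^esub> x) = c \<odot>\<^bsub>B\<^esub> h x}"

lemma alg_hom_memI:
  assumes "\<And>x. x \<in> carrier A \<Longrightarrow> h x \<in> carrier B"
    and "\<And>x y. x \<in> carrier A \<Longrightarrow> y \<in> carrier A \<Longrightarrow> h (x \<otimes>\<^bsub>A\<^esub> y) = h x \<otimes>\<^bsub>B\<^esub> h y"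
    and "\<And>x y. x \<in> carrier A \<Longrightarrow> y \<in> carrier A \<Longrightarrow> h (x \<oplus>\<^bsub>A\<^esub> y) = h x \<oplus>\<^bsub>B\<^esub> h y"
    and "h \<one>\<^bsub>A\<^esub> = \<one>\<^bsub>B\<^esub>"
    and "\<And>c x. x \<in> carrier A \<Longrightarrow> h (c \<odot>\<^bsub>A\<^esub> x) = c \<odot>\<^bsub>B\<^esub> h x"
  shows "h \<in> alg_hom A B"
  using assms by (auto simp: alg_hom_def intro!: ring_hom_memI)

locale algebra_hom = A: unital_algebra A + B: unital_algebra B
  for A :: "('k :: field, 'a) module" and B :: "('k, 'b) module" +
  fixes h assumes hom: "h \<in> alg_hom A B"
begin

lemma closed [simp]: "x \<in> carrier A \<Longrightarrow> h x \<in> carrier B"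
  and mult [simp]: "x \<in> carrier A \<Longrightarrow> y \<in> carrier A \<Longrightarrow> h (x \<otimes>\<^bsub>A\<^esub> y) = h x \<otimes>\<^bsub>B\<^esub> h y"
  and add [simp]: "x \<in> carrier A \<Longrightarrow> y \<in> carrier A \<Longrightarrow> h (x \<oplus>\<^bsub>A\<^esub> y) = h x \<oplus>\<^bsub>B\<^esub> h y"
  and one [simp]: "h \<one>\<^bsub>A\<^esub> = \<one>\<^bsub>B\<^esub>"
  and smult [simp]: "x \<in> carrier A \<Longrightarrow> h (c \<odot>\<^bsub>A\<^esub> x) = c \<odot>\<^bsub>B\<^esub> h x"
  using hom by (auto simp: alg_hom_def ring_hom_def)

lemma hom_zero [simp]: "h \<zero>\<^bsub>A\<^esub> = \<zero>\<^bsub>B\<^esub>"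
  using smult[of "\<zero>\<^bsub>A\<^esub>" 0] by simp

lemma ring_hom_ring: "ring_hom_ring A B h"
  using hom by (intro ring_hom_ringI2) (auto simp: alg_hom_def A.ring_axioms B.ring_axioms)

lemma alg_prod: "set xs \<subseteq> carrier A \<Longrightarrow> h (alg_prod A xs) = alg_prod B (map h xs)"
  by (induct xs) auto

lemma image_lin_span:
  assumes "S \<subseteq> carrier A" shows "h ` lin_span A S = lin_span B (h ` S)"
proof (intro equalityI subsetI)
  fix y assume "y \<in> h ` lin_span A S"
  then obtain x where x: "x \<in> lin_span A S" "y = h x" by blast
  from x(1) have "h x \<in> lin_span B (h ` S)"
  proof induct
    case (step x z c)
    then have "x \<in> carrier A" "z \<in> carrier A"
      using assms A.lin_span_closed by blast+
    then show ?case using step by (auto intro: lin_span.step)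
  qed (simp add: lin_span.zero)
  then show "y \<in> lin_span B (h ` S)" using x by simp
next
  fix y assume "y \<in> lin_span B (h ` S)"
  then show "y \<in> h ` lin_span A S"
  proof induct
    case zero
    show ?case using lin_span.zero[of A S] by (force simp flip: hom_zero)
  next
    case (step y z c)
    then obtain x x' where x: "x \<in> S" "y = h x" "x' \<in> lin_span A S" "z = h x'" by blast
    then have "x \<in> carrier A" "x' \<in> carrier A"
      using assms A.lin_span_closed by blast+
    then have "c \<odot>\<^bsub>B\<^esub> y \<oplus>\<^bsub>B\<^esub> z = h (c \<odot>\<^bsub>A\<^esub> x \<oplus>\<^bsub>A\<^esub> x')"
      using x by simp
    then show ?case using x lin_span.step[of x S x' A c] by blast
  qed
qed

lemma image_subalg: "subalg (h ` carrier A) B"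
proof -
  have "subring (h ` carrier A) B"
    using ring_hom_ring by (simp add: ring_hom_ring.img_is_subring A.carrier_is_subring)
  moreover have "c \<odot>\<^bsub>B\<^esub> h x \<in> h ` carrier A" if "x \<in> carrier A" for c x
    using that by (intro image_eqI[of _ _ "c \<odot>\<^bsub>A\<^esub> x"]) simp_all
  ultimately show ?thesis by (auto simp: subalg_def)
qed

text \<open>
  Stated from the image to the source, the direction in which the block algebras are compared with
  the Clifford algebras of the blocks.
\<close>

lemma alg_isomorphic_image:
  assumes "inj_on h (carrier A)"
  shows "alg_isomorphic (B\<lparr>carrier := h ` carrier A\<rparr>) A"
proof -
  let ?C = "B\<lparr>carrier := h ` carrier A\<rparr>" and ?g = "inv_into (carrier A) h"
  have "h \<in> ring_iso A ?C"
    using assms by (auto simp: ring_iso_def bij_betw_def intro!: ring_hom_memI)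
  then have "?g \<in> ring_iso ?C A"
    using ring_iso_set_sym[OF A.ring_axioms] by simp
  moreover have "?g (c \<odot>\<^bsub>?C\<^esub> y) = c \<odot>\<^bsub>A\<^esub> ?g y" if "y \<in> carrier ?C" for c y
  proof -
    from that obtain x where "x \<in> carrier A" "y = h x" by auto
    then show ?thesis
      using assms by (simp flip: smult)
  qed
  ultimately show ?thesis by (auto simp: alg_isomorphic_def)
qed

end

section \<open>Monoid algebras\<close>

lemma monoid_algebra_sel [simp]:
  "carrier (monoid_algebra G) = {p. Poly_Mapping.keys p \<subseteq> carrier G}"
  "\<one>\<^bsub>monoid_algebra G\<^esub> = Poly_Mapping.single \<one>\<^bsub>G\<^esub> 1"
  "\<zero>\<^bsub>monoid_algebra G\<^esub> = 0"
  "p \<oplus>\<^bsub>monoid_algebra G\<^esub> q = p + q"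
  "c \<odot>\<^bsub>monoid_algebra G\<^esub> p = Poly_Mapping.map ((*) c) p"
  by (simp_all add: monoid_algebra_def)

lemma lookup_map_times [simp]:
  fixes c :: "'k :: field"
  shows "Poly_Mapping.lookup (Poly_Mapping.map ((*) c) p) x = c * Poly_Mapping.lookup p x"
  by (transfer fixing: c) (auto simp: when_def)

lemma map_times_simps [simp]:
  fixes c :: "'k :: field"
  shows "Poly_Mapping.map ((*) c) 0 = 0"
    and "Poly_Mapping.map ((*) c) (Poly_Mapping.single x d) = Poly_Mapping.single x (c * d)"
    and "Poly_Mapping.map ((*) c) (p + q) = Poly_Mapping.map ((*) c) p + Poly_Mapping.map ((*) c) q"
    and "Poly_Mapping.map ((*) 0) p = (0 :: 'a \<Rightarrow>\<^sub>0 'k)"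
  by (auto intro!: poly_mapping_eqI simp: lookup_add lookup_single when_def algebra_simps)

lemma keys_map_times_subset:
  fixes c :: "'k :: field"
  shows "Poly_Mapping.keys (Poly_Mapping.map ((*) c) p) \<subseteq> Poly_Mapping.keys p"
  by (auto simp: in_keys_iff)

lemma keys_add_subset:
  "Poly_Mapping.keys p \<subseteq> A \<Longrightarrow> Poly_Mapping.keys q \<subseteq> A \<Longrightarrow> Poly_Mapping.keys (p + q) \<subseteq> A"
  using keys_add[of p q] by blast

lemma keys_diff_subset:
  fixes p :: "'a \<Rightarrow>\<^sub>0 'k :: ab_group_add"
  shows "Poly_Mapping.keys p \<subseteq> A \<Longrightarrow> Poly_Mapping.keys q \<subseteq> A \<Longrightarrow> Poly_Mapping.keys (p - q) \<subseteq> A"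
  by (auto simp: in_keys_iff subset_iff lookup_minus) metis

text \<open>
  A polynomial mapping is the sum of its monomials, so additive statements can be checked on
  monomials.
\<close>

lemma poly_mapping_carrier_induct [consumes 1, case_names zero add]:
  fixes p :: "'a \<Rightarrow>\<^sub>0 'k :: comm_monoid_add"
  assumes "Poly_Mapping.keys p \<subseteq> X" "P 0"
    and step: "\<And>a c p. a \<in> X \<Longrightarrow> Poly_Mapping.keys p \<subseteq> X \<Longrightarrow> P p \<Longrightarrow> P (Poly_Mapping.single a c + p)"
  shows "P p"
proof -
  define s where "s K = (\<Sum>a\<in>K. Poly_Mapping.single a (Poly_Mapping.lookup p a))" for K
  have "Poly_Mapping.keys (s K) \<subseteq> X \<and> P (s K)" if "finite K" "K \<subseteq> X" for K
    using that
  proof (induct K)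
    case empty
    then show ?case using assms by (simp add: s_def)
  next
    case (insert a K)
    then have "s (insert a K) = Poly_Mapping.single a (Poly_Mapping.lookup p a) + s K"
      by (simp add: s_def)
    then show ?case
      using insert step[of a "s K"] by (simp add: keys_add_subset)
  qed
  moreover have "s (Poly_Mapping.keys p) = p"
    by (rule poly_mapping_eqI)
      (auto simp: s_def lookup_sum lookup_single when_def not_in_keys_iff_lookup_eq_zero)
  ultimately show ?thesis using assms(1) by (metis finite_keys)
qed

locale monoid_alg = monoid G for G :: "('a, 'm) monoid_scheme" (structure) +
  fixes R :: "('k :: field, 'a \<Rightarrow>\<^sub>0 'k) module"
  defines R_def: "R \<equiv> monoid_algebra G"
begin

text \<open>
  Summation over a common finite superset of the supports makes the product visibly bilinear;
  the supports themselves can shrink under addition.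
\<close>

lemma mult_superset:
  assumes "finite X" "finite Y" "Poly_Mapping.keys p \<subseteq> X" "Poly_Mapping.keys q \<subseteq> Y"
  shows "p \<otimes>\<^bsub>R\<^esub> q = (\<Sum>a\<in>X. \<Sum>b\<in>Y.
           Poly_Mapping.single (a \<otimes> b) (Poly_Mapping.lookup p a * Poly_Mapping.lookup q b))"
proof -
  have "(\<Sum>b\<in>Poly_Mapping.keys q. Poly_Mapping.single (a \<otimes> b) (c * Poly_Mapping.lookup q b))
      = (\<Sum>b\<in>Y. Poly_Mapping.single (a \<otimes> b) (c * Poly_Mapping.lookup q b))" for a c
    by (rule sum.mono_neutral_left) (use assms in \<open>auto simp: in_keys_iff\<close>)
  then show ?thesis
    unfolding R_def monoid_algebra_def
    by (auto intro!: sum.mono_neutral_left assms simp: in_keys_iff)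
qed

lemma mult_single [simp]:
  "Poly_Mapping.single a c \<otimes>\<^bsub>R\<^esub> Poly_Mapping.single b d = Poly_Mapping.single (a \<otimes> b) (c * d)"
  by (subst mult_superset[of "{a}" "{b}"]) auto

lemma mult_add_left: "(p + p') \<otimes>\<^bsub>R\<^esub> q = p \<otimes>\<^bsub>R\<^esub> q + p' \<otimes>\<^bsub>R\<^esub> q"
proof -
  let ?X = "Poly_Mapping.keys p \<union> Poly_Mapping.keys p'" and ?Y = "Poly_Mapping.keys q"
  note s = mult_superset[of ?X ?Y _ q]
  show ?thesis
    by (subst s; (auto simp: keys_add)?)+
      (simp add: lookup_add distrib_right single_add sum.distrib)
qed

lemma mult_add_right: "q \<otimes>\<^bsub>R\<^esub> (p + p') = q \<otimes>\<^bsub>R\<^esub> p + q \<otimes>\<^bsub>R\<^esub> p'"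
proof -
  let ?X = "Poly_Mapping.keys p \<union> Poly_Mapping.keys p'" and ?Y = "Poly_Mapping.keys q"
  note s = mult_superset[of ?Y ?X q]
  show ?thesis
    by (subst s; (auto simp: keys_add)?)+
      (simp add: lookup_add distrib_left single_add sum.distrib)
qed

lemma mult_zero [simp]: "0 \<otimes>\<^bsub>R\<^esub> q = 0" "q \<otimes>\<^bsub>R\<^esub> 0 = 0"
  using mult_superset[of "{}" "Poly_Mapping.keys q" 0 q] mult_superset[of "Poly_Mapping.keys q" "{}" q 0]
  by auto

lemma R_sel:
  "carrier R = {p. Poly_Mapping.keys p \<subseteq> carrier G}"
  "\<one>\<^bsub>R\<^esub> = Poly_Mapping.single \<one> 1"
  "\<zero>\<^bsub>R\<^esub> = 0"
  "p \<oplus>\<^bsub>R\<^esub> q = p + q"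
  "c \<odot>\<^bsub>R\<^esub> p = Poly_Mapping.map ((*) c) p"
  by (simp_all add: R_def)

lemma mult_map_times:
  "Poly_Mapping.map ((*) c) p \<otimes>\<^bsub>R\<^esub> q = Poly_Mapping.map ((*) c) (p \<otimes>\<^bsub>R\<^esub> q)"
  "p \<otimes>\<^bsub>R\<^esub> Poly_Mapping.map ((*) c) q = Poly_Mapping.map ((*) c) (p \<otimes>\<^bsub>R\<^esub> q)"
proof -
  have s: "Poly_Mapping.map ((*) c) (sum g X) = (\<Sum>x\<in>X. Poly_Mapping.map ((*) c) (g x))"
    for g :: "'z \<Rightarrow> 'a \<Rightarrow>\<^sub>0 'k" and X
    by (induct X rule: infinite_finite_induct) auto
  note m = mult_superset[of "Poly_Mapping.keys p" "Poly_Mapping.keys q"]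
  show "Poly_Mapping.map ((*) c) p \<otimes>\<^bsub>R\<^esub> q = Poly_Mapping.map ((*) c) (p \<otimes>\<^bsub>R\<^esub> q)"
    "p \<otimes>\<^bsub>R\<^esub> Poly_Mapping.map ((*) c) q = Poly_Mapping.map ((*) c) (p \<otimes>\<^bsub>R\<^esub> q)"
    by (subst m m; simp add: keys_map_times_subset s mult_ac)+
qed

lemma mult_keys:
  assumes "Poly_Mapping.keys p \<subseteq> carrier G" "Poly_Mapping.keys q \<subseteq> carrier G"
  shows "Poly_Mapping.keys (p \<otimes>\<^bsub>R\<^esub> q) \<subseteq> carrier G"
  using assms(1)
proof (induct rule: poly_mapping_carrier_induct)
  case (add a c p)
  from assms(2) have "Poly_Mapping.keys (Poly_Mapping.single a c \<otimes>\<^bsub>R\<^esub> q) \<subseteq> carrier G"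
    by (induct rule: poly_mapping_carrier_induct)
      (use add in \<open>simp_all add: mult_add_right keys_add_subset\<close>)
  then show ?case using add by (simp add: mult_add_left keys_add_subset)
qed simp

lemma mult_assoc:
  assumes "Poly_Mapping.keys p \<subseteq> carrier G" "Poly_Mapping.keys q \<subseteq> carrier G" "Poly_Mapping.keys r \<subseteq> carrier G"
  shows "p \<otimes>\<^bsub>R\<^esub> q \<otimes>\<^bsub>R\<^esub> r = p \<otimes>\<^bsub>R\<^esub> (q \<otimes>\<^bsub>R\<^esub> r)"
  using assms(1)
proof (induct rule: poly_mapping_carrier_induct)
  case (add a c p)
  have "Poly_Mapping.single a c \<otimes>\<^bsub>R\<^esub> q \<otimes>\<^bsub>R\<^esub> r = Poly_Mapping.single a c \<otimes>\<^bsub>R\<^esub> (q \<otimes>\<^bsub>R\<^esub> r)"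
    using assms(2)
  proof (induct rule: poly_mapping_carrier_induct)
    case q: (add b d q)
    have "Poly_Mapping.single a c \<otimes>\<^bsub>R\<^esub> Poly_Mapping.single b d \<otimes>\<^bsub>R\<^esub> r
        = Poly_Mapping.single a c \<otimes>\<^bsub>R\<^esub> (Poly_Mapping.single b d \<otimes>\<^bsub>R\<^esub> r)"
      using assms(3)
      by (induct rule: poly_mapping_carrier_induct)
        (use add q in \<open>auto simp: mult_add_right m_assoc mult_ac\<close>)
    then show ?case using q by (simp add: mult_add_right mult_add_left)
  qed simp
  then show ?case using add by (simp add: mult_add_left)
qed simp

lemma mult_one:
  assumes "Poly_Mapping.keys p \<subseteq> carrier G"
  shows "Poly_Mapping.single \<one> 1 \<otimes>\<^bsub>R\<^esub> p = p" "p \<otimes>\<^bsub>R\<^esub> Poly_Mapping.single \<one> 1 = p"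
  using assms
  by (induct rule: poly_mapping_carrier_induct) (auto simp: mult_add_right mult_add_left)

lemma unital_algebra: "unital_algebra R"
proof (intro unital_algebra.intro ringI abelian_groupI monoidI unital_algebra_axioms.intro)
  fix p assume "p \<in> carrier R"
  then show "\<exists>q\<in>carrier R. q \<oplus>\<^bsub>R\<^esub> p = \<zero>\<^bsub>R\<^esub>"
    by (intro bexI[of _ "- p"]) (auto simp: R_sel)
next
  fix p q assume "p \<in> carrier R" "q \<in> carrier R"
  then show "p \<oplus>\<^bsub>R\<^esub> q \<in> carrier R" "p \<otimes>\<^bsub>R\<^esub> q \<in> carrier R"
    by (simp_all add: R_sel keys_add_subset mult_keys)
next
  fix p c assume "p \<in> carrier R"
  then show "c \<odot>\<^bsub>R\<^esub> p \<in> carrier R"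
    using keys_map_times_subset[of c p] by (simp add: R_sel)
next
  fix p c d assume "p \<in> carrier R"
  show "(c + d) \<odot>\<^bsub>R\<^esub> p = c \<odot>\<^bsub>R\<^esub> p \<oplus>\<^bsub>R\<^esub> d \<odot>\<^bsub>R\<^esub> p"
    "c \<odot>\<^bsub>R\<^esub> (d \<odot>\<^bsub>R\<^esub> p) = (c * d) \<odot>\<^bsub>R\<^esub> p" "1 \<odot>\<^bsub>R\<^esub> p = p"
    by (rule poly_mapping_eqI; simp add: R_sel lookup_add algebra_simps)+
qed (simp_all add: R_sel mult_add_left mult_add_right mult_assoc mult_one mult_map_times add_ac)

end

definition monoid_algebra_lift ::
    "('k :: field, 'b) module \<Rightarrow> ('a \<Rightarrow> 'b) \<Rightarrow> ('a \<Rightarrow>\<^sub>0 'k) \<Rightarrow> 'b" where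
  "monoid_algebra_lift B \<phi> p =
     (\<Oplus>\<^bsub>B\<^esub>a\<in>Poly_Mapping.keys p. Poly_Mapping.lookup p a \<odot>\<^bsub>B\<^esub> \<phi> a)"

locale monoid_alg_lift = monoid_alg G R + B: unital_algebra B
  for G :: "('a, 'm) monoid_scheme" (structure) and R :: "('k :: field, 'a \<Rightarrow>\<^sub>0 'k) module"
    and B :: "('k, 'b) module" +
  fixes \<phi>
  assumes phi_closed: "a \<in> carrier G \<Longrightarrow> \<phi> a \<in> carrier B"
    and phi_one: "\<phi> \<one> = \<one>\<^bsub>B\<^esub>"
    and phi_mult: "a \<in> carrier G \<Longrightarrow> b \<in> carrier G \<Longrightarrow> \<phi> (a \<otimes> b) = \<phi> a \<otimes>\<^bsub>B\<^esub> \<phi> b"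
begin

abbreviation "lift \<equiv> monoid_algebra_lift B \<phi>"

text \<open>
  As for the product, a fixed index set is what makes additivity provable.
\<close>

lemma lift_superset:
  assumes "finite X" "Poly_Mapping.keys p \<subseteq> X" "X \<subseteq> carrier G"
  shows "lift p = (\<Oplus>\<^bsub>B\<^esub>a\<in>X. Poly_Mapping.lookup p a \<odot>\<^bsub>B\<^esub> \<phi> a)"
  unfolding monoid_algebra_lift_def
  by (rule B.add.finprod_mono_neutral_cong_left)
    (use assms phi_closed in \<open>auto simp: in_keys_iff subset_iff\<close>)

lemma lift_single [simp]:
  assumes "a \<in> carrier G" shows "lift (Poly_Mapping.single a c) = c \<odot>\<^bsub>B\<^esub> \<phi> a"
  using assms phi_closed by (subst lift_superset[of "{a}"]) auto

lemma lift_closed: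
  assumes "Poly_Mapping.keys p \<subseteq> carrier G" shows "lift p \<in> carrier B"
  unfolding monoid_algebra_lift_def using assms phi_closed by (intro B.finsum_closed) auto

lemma lift_add:
  assumes "Poly_Mapping.keys p \<subseteq> carrier G" "Poly_Mapping.keys q \<subseteq> carrier G"
  shows "lift (p + q) = lift p \<oplus>\<^bsub>B\<^esub> lift q"
proof -
  let ?X = "Poly_Mapping.keys p \<union> Poly_Mapping.keys q"
  have "(\<Oplus>\<^bsub>B\<^esub>a\<in>?X. Poly_Mapping.lookup (p + q) a \<odot>\<^bsub>B\<^esub> \<phi> a)
      = (\<Oplus>\<^bsub>B\<^esub>a\<in>?X. Poly_Mapping.lookup p a \<odot>\<^bsub>B\<^esub> \<phi> a \<oplus>\<^bsub>B\<^esub> Poly_Mapping.lookup q a \<odot>\<^bsub>B\<^esub> \<phi> a)"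
    by (rule B.finsum_cong') (use assms phi_closed in \<open>auto simp: lookup_add B.smult_add_left subset_iff\<close>)
  also have "\<dots> = (\<Oplus>\<^bsub>B\<^esub>a\<in>?X. Poly_Mapping.lookup p a \<odot>\<^bsub>B\<^esub> \<phi> a) \<oplus>\<^bsub>B\<^esub>
      (\<Oplus>\<^bsub>B\<^esub>a\<in>?X. Poly_Mapping.lookup q a \<odot>\<^bsub>B\<^esub> \<phi> a)"
    by (rule B.finsum_addf) (use assms phi_closed in \<open>auto simp: subset_iff\<close>)
  finally show ?thesis
    using assms keys_add[of p q] by (subst (1 2 3) lift_superset[of ?X]) auto
qed

lemma lift_zero [simp]: "lift 0 = \<zero>\<^bsub>B\<^esub>"
  by (simp add: monoid_algebra_lift_def)

lemma lift_smult:
  assumes "Poly_Mapping.keys p \<subseteq> carrier G"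
  shows "lift (Poly_Mapping.map ((*) c) p) = c \<odot>\<^bsub>B\<^esub> lift p"
  using assms
proof (induct rule: poly_mapping_carrier_induct)
  case (add a d p)
  then show ?case
    using keys_map_times_subset[of c p] phi_closed
    by (auto simp: lift_add lift_closed B.smult_add_right)
qed simp

lemma lift_mult:
  assumes "Poly_Mapping.keys p \<subseteq> carrier G" "Poly_Mapping.keys q \<subseteq> carrier G"
  shows "lift (p \<otimes>\<^bsub>R\<^esub> q) = lift p \<otimes>\<^bsub>B\<^esub> lift q"
  using assms(1)
proof (induct rule: poly_mapping_carrier_induct)
  case (add a c p)
  have "lift (Poly_Mapping.single a c \<otimes>\<^bsub>R\<^esub> q) = lift (Poly_Mapping.single a c) \<otimes>\<^bsub>B\<^esub> lift q"
    using assms(2)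
  proof (induct rule: poly_mapping_carrier_induct)
    case q: (add b d q)
    then show ?case
      using add phi_closed mult_keys[of "Poly_Mapping.single a c" q]
      by (simp add: mult_add_right lift_add lift_closed phi_mult B.r_distr mult_ac)
  qed (use add phi_closed in simp)
  then show ?case
    using add assms phi_closed mult_keys[of "Poly_Mapping.single a c" q] mult_keys[of p q]
    by (simp add: mult_add_left lift_add lift_closed B.l_distr)
qed (use assms lift_closed in simp)

text \<open>
  The universal property of the monoid algebra.
\<close>

lemma lift_hom: "lift \<in> alg_hom R B"
  by (rule alg_hom_memI)
    (auto simp: lift_closed lift_mult lift_add lift_smult phi_one R_sel)

end


section \<open>Quotients of algebras\<close>

text \<open>
  Intended for maps that are constant on the cosets, whose image is then a singleton.
\<close>

definition quot_lift :: "('a \<Rightarrow> 'b) \<Rightarrow> 'a set \<Rightarrow> 'b" where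
  "quot_lift h X = the_elem (h ` X)"

locale algebra_ideal = unital_algebra A + ideal I A
  for A :: "('k :: field, 'a) module" (structure) and I
begin

abbreviation "Q \<equiv> quot_alg A I"

lemma ideal_smult: "x \<in> I \<Longrightarrow> c \<odot> x \<in> I"
  using I_l_closed[of x "c \<odot> \<one>"] by (simp add: a_Hcarr)

lemma coset_smult:
  assumes "x \<in> carrier A" shows "c \<odot>\<^bsub>Q\<^esub> (I +> x) = I +> (c \<odot> x)"
proof -
  have "I +> (c \<odot> y) = I +> (c \<odot> x)" if "y \<in> I +> x" for y
  proof -
    from that obtain i where i: "i \<in> I" "y = i \<oplus> x"
      by (auto simp: a_r_coset_def')
    have c: "i \<in> carrier A" using a_Hcarr[OF i(1)] .
    then have "c \<odot> y = c \<odot> i \<oplus> c \<odot> x"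
      using assms i(2) by (simp add: smult_add_right)
    then have "c \<odot> y \<in> I +> (c \<odot> x)"
      using ideal_smult[OF i(1)] unfolding a_r_coset_def' by blast
    then show ?thesis
      using a_repr_independence'[OF _ smult_closed[OF assms]] by blast
  qed
  then have "(\<Union>y\<in>I +> x. I +> (c \<odot> y)) = I +> (c \<odot> x)"
    using a_rcos_self[OF assms] by blast
  then show ?thesis by (simp add: quot_alg_def)
qed

lemma quot_sel:
  "carrier Q = (\<lambda>x. I +> x) ` carrier A"
  "\<one>\<^bsub>Q\<^esub> = I +> \<one>"
  "\<zero>\<^bsub>Q\<^esub> = I +> \<zero>"
  using a_coset_join2[of \<zero> I]
  by (auto simp: quot_alg_def FactRing_def A_RCOSETS_def' is_additive_subgroup additive_subgroup.a_subgroup)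

lemma coset_mult:
  "x \<in> carrier A \<Longrightarrow> y \<in> carrier A \<Longrightarrow> (I +> x) \<otimes>\<^bsub>Q\<^esub> (I +> y) = I +> (x \<otimes> y)"
  by (simp add: quot_alg_def FactRing_def rcoset_mult_add)

lemma coset_add:
  "x \<in> carrier A \<Longrightarrow> y \<in> carrier A \<Longrightarrow> (I +> x) \<oplus>\<^bsub>Q\<^esub> (I +> y) = I +> (x \<oplus> y)"
  by (simp add: quot_alg_def FactRing_def a_rcos_sum)

lemma quot_closed [simp]: "x \<in> carrier A \<Longrightarrow> I +> x \<in> carrier Q"
  by (simp add: quot_sel)

lemma ring_Q: "ring Q"
proof (intro ringI abelian_groupI monoidI)
  fix X assume "X \<in> carrier Q"
  then obtain x where "x \<in> carrier A" "X = I +> x" by (auto simp: quot_sel)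
  then show "\<exists>Y\<in>carrier Q. Y \<oplus>\<^bsub>Q\<^esub> X = \<zero>\<^bsub>Q\<^esub>"
    by (intro bexI[of _ "I +> (\<ominus> x)"]) (simp_all add: coset_add quot_sel(3) l_neg)
next
  fix X Y assume "X \<in> carrier Q" "Y \<in> carrier Q"
  then obtain x y where "x \<in> carrier A" "X = I +> x" "y \<in> carrier A" "Y = I +> y"
    by (auto simp: quot_sel)
  then show "X \<oplus>\<^bsub>Q\<^esub> Y = Y \<oplus>\<^bsub>Q\<^esub> X"
    by (simp add: coset_add add.m_comm)
qed (auto simp: quot_sel coset_add coset_mult add.m_assoc m_assoc l_distr r_distr)

lemma unital_algebra_Q: "unital_algebra Q"
  by (intro unital_algebra.intro unital_algebra_axioms.intro ring_Q)
    (auto simp: quot_sel coset_smult coset_add coset_mult smult_add_left smult_add_right)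

lemma proj_hom: "algebra_hom A Q (\<lambda>x. I +> x)"
  by (intro algebra_hom.intro algebra_hom_axioms.intro unital_algebra_Q unital_algebra_axioms
      alg_hom_memI)
    (auto simp: quot_sel coset_smult coset_add coset_mult)

lemma quot_lift_coset:
  assumes "\<And>i. i \<in> I \<Longrightarrow> h (i \<oplus> x) = h x" and "x \<in> carrier A"
  shows "quot_lift h (I +> x) = h x"
proof -
  have "h y = h x" if "y \<in> I +> x" for y
    using that assms unfolding a_r_coset_def' by blast
  then have "h ` (I +> x) = {h x}"
    using a_rcos_self[OF assms(2)] by blast
  then show ?thesis by (simp add: quot_lift_def)
qed

lemma quot_lift_proj:
  assumes "algebra_hom A B h" "\<And>x. x \<in> I \<Longrightarrow> h x = \<zero>\<^bsub>B\<^esub>" "x \<in> carrier A"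
  shows "quot_lift h (I +> x) = h x"
proof (rule quot_lift_coset[OF _ assms(3)])
  interpret h: algebra_hom A B h by (rule assms)
  fix i assume i: "i \<in> I"
  have "h (i \<oplus> x) = h i \<oplus>\<^bsub>B\<^esub> h x"
    using a_Hcarr[OF i] assms(3) by (rule h.add)
  then show "h (i \<oplus> x) = h x"
    using assms(2)[OF i] h.closed[OF assms(3)] by simp
qed

text \<open>
  The universal property of the quotient.
\<close>

lemma quot_lift_hom:
  assumes "algebra_hom A B h" "\<And>x. x \<in> I \<Longrightarrow> h x = \<zero>\<^bsub>B\<^esub>"
  shows "algebra_hom Q B (quot_lift h)"
proof -
  interpret h: algebra_hom A B h by (rule assms)
  show ?thesis
    by (intro algebra_hom.intro algebra_hom_axioms.intro unital_algebra_Q h.B.unital_algebra_axioms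
        alg_hom_memI)
      (auto simp: quot_sel coset_smult coset_add coset_mult quot_lift_proj[OF assms])
qed

end

text \<open>
  The kernel is an ideal, so a homomorphism that respects the defining relations factors through
  the algebra they present.
\<close>

lemma (in algebra_hom) hom_kills_genideal:
  assumes "S \<subseteq> carrier A" "\<And>x. x \<in> S \<Longrightarrow> h x = \<zero>\<^bsub>B\<^esub>" "x \<in> Idl\<^bsub>A\<^esub> S"
  shows "h x = \<zero>\<^bsub>B\<^esub>"
proof -
  have "ideal (a_kernel A B h) A" by (rule ring_hom_ring.kernel_is_ideal[OF ring_hom_ring])
  moreover have "S \<subseteq> a_kernel A B h" using assms by (auto simp: a_kernel_def')
  ultimately have "Idl\<^bsub>A\<^esub> S \<subseteq> a_kernel A B h" by (rule A.genideal_minimal)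
  then show ?thesis using assms by (auto simp: a_kernel_def')
qed

lemma (in unital_algebra) algebra_ideal_genideal:
  assumes "S \<subseteq> carrier A" shows "algebra_ideal A (Idl S)"
  using genideal_ideal[OF assms] unital_algebra_axioms by (intro algebra_ideal.intro)

lemma (in algebra_ideal) coset_eq_zero: "x \<in> I \<Longrightarrow> I +> x = \<zero>\<^bsub>Q\<^esub>"
  using a_coset_join2[of x I] a_coset_join2[of \<zero> I] a_Hcarr[of x]
  by (simp add: quot_sel is_additive_subgroup additive_subgroup.a_subgroup)

text \<open>
  The defining relations are differences of polynomial mappings; this turns each of them into an
  equation between images.
\<close>

lemma (in monoid_alg) hom_diff_eq_zero_iff:
  assumes "algebra_hom R B h" "Poly_Mapping.keys p \<subseteq> carrier G" "Poly_Mapping.keys q \<subseteq> carrier G"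
  shows "h (p - q) = \<zero>\<^bsub>B\<^esub> \<longleftrightarrow> h p = h q"
proof -
  interpret h: algebra_hom R B h by (rule assms)
  have c: "p - q \<in> carrier R" "p \<in> carrier R" "q \<in> carrier R"
    using assms keys_diff_subset[OF assms(2,3)] by (simp_all add: R_sel)
  have "(p - q) \<oplus>\<^bsub>R\<^esub> q = p" by (simp add: R_sel)
  then have e: "h p = h (p - q) \<oplus>\<^bsub>B\<^esub> h q"
    using h.add[OF c(1,3)] by (simp only:)
  show ?thesis
  proof
    assume "h (p - q) = \<zero>\<^bsub>B\<^esub>" then show "h p = h q" using e c by simp
  next
    assume "h p = h q"
    then have "h (p - q) \<oplus>\<^bsub>B\<^esub> h q = \<zero>\<^bsub>B\<^esub> \<oplus>\<^bsub>B\<^esub> h q" using e c by simp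
    then show "h (p - q) = \<zero>\<^bsub>B\<^esub>"
      using h.B.add.right_cancel[of "h q" "h (p - q)" "\<zero>\<^bsub>B\<^esub>"] c by simp
  qed
qed

lemma lin_span_monoid_algebra:
  assumes "p \<in> carrier (monoid_algebra G)"
  shows "p \<in> lin_span (monoid_algebra G) {Poly_Mapping.single a 1 | a. a \<in> carrier G}"
proof -
  from assms have "Poly_Mapping.keys p \<subseteq> carrier G" by simp
  then show ?thesis
  proof (induct rule: poly_mapping_carrier_induct)
    case zero
    then show ?case using lin_span.zero[of "monoid_algebra G"] by simp
  next
    case (add a c p)
    let ?M = "monoid_algebra G"
    have "c \<odot>\<^bsub>?M\<^esub> Poly_Mapping.single a 1 \<oplus>\<^bsub>?M\<^esub> p \<in> lin_span ?M {Poly_Mapping.single a 1 | a. a \<in> carrier G}"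
      using add by (intro lin_span.step) blast+
    then show ?case by simp
  qed
qed

section \<open>Clifford algebras\<close>

abbreviation word_monoid :: "'v set \<Rightarrow> 'v list monoid" where
  "word_monoid W \<equiv> \<lparr>carrier = lists W, monoid.mult = (@), one = []\<rparr>"

lemma monoid_word_monoid: "monoid (word_monoid W)"
  by (intro monoidI) auto

text \<open>
  The subspace is a parameter because both the Clifford algebra of the whole space and those of the
  blocks are needed.
\<close>

locale clifford_space = vector_space scale
  for scale :: "'k :: field \<Rightarrow> 'v :: ab_group_add \<Rightarrow> 'v" +
  fixes f :: "'v \<Rightarrow> 'k" and W :: "'v set"
  assumes quadratic: "quadratic_form scale f" and subspace: "subspace W"
begin

abbreviation "Fr \<equiv> free_alg W :: ('k, 'v list \<Rightarrow>\<^sub>0 'k) module"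
abbreviation "Cl \<equiv> clifford scale W f"
abbreviation "gen \<equiv> clifford_gen scale W f"

sublocale free: monoid_alg "word_monoid W" Fr
  by (intro monoid_alg.intro monoid_word_monoid) (simp add: free_alg_def)

lemma single_closed [simp]: "set ws \<subseteq> W \<Longrightarrow> Poly_Mapping.single ws c \<in> carrier Fr"
  by (auto simp: free.R_sel)

lemma rels_closed: "clifford_rels scale W f \<subseteq> carrier Fr"
proof -
  have "Poly_Mapping.single ws c \<in> carrier Fr" if "set ws \<subseteq> W" for ws c
    using that by (auto simp: free.R_sel)
  moreover have "p - q \<in> carrier Fr" if "p \<in> carrier Fr" "q \<in> carrier Fr" for p q
    using that by (simp add: free.R_sel keys_diff_subset)
  ultimately show ?thesis
    using subspace by (auto simp: clifford_rels_def subspace_add subspace_scale)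
qed

lemma ideal: "algebra_ideal Fr (clifford_ideal scale W f)"
  unfolding clifford_ideal_def
  by (intro unital_algebra.algebra_ideal_genideal free.unital_algebra rels_closed)

lemma algebra: "unital_algebra Cl"
  unfolding clifford_def by (rule algebra_ideal.unital_algebra_Q[OF ideal])

sublocale unital_algebra Cl by (rule algebra)

abbreviation "proj \<equiv> \<lambda>x. clifford_ideal scale W f +>\<^bsub>Fr\<^esub> x"

lemma proj_hom: "algebra_hom Fr Cl proj"
  unfolding clifford_def by (rule algebra_ideal.proj_hom[OF ideal])

lemma proj_rel: 
  assumes "p - q \<in> clifford_rels scale W f" "p \<in> carrier Fr" "q \<in> carrier Fr"
  shows "proj p = proj q"
proof -
  have "p - q \<in> clifford_ideal scale W f"
    unfolding clifford_ideal_def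
    using ring.genideal_self[OF unital_algebra.axioms(1)[OF free.unital_algebra] rels_closed] assms(1)
    by blast
  then have "proj (p - q) = \<zero>\<^bsub>Cl\<^esub>"
    unfolding clifford_def by (rule algebra_ideal.coset_eq_zero[OF ideal])
  moreover have "Poly_Mapping.keys p \<subseteq> carrier (word_monoid W)" "Poly_Mapping.keys q \<subseteq> carrier (word_monoid W)"
    using assms(2,3) by (simp_all only: free.R_sel mem_Collect_eq)
  ultimately show ?thesis
    using free.hom_diff_eq_zero_iff[OF proj_hom, of p q] by blast
qed

lemma gen_closed [simp]: "v \<in> W \<Longrightarrow> gen v \<in> carrier Cl"
  using algebra_hom.closed[OF proj_hom, of "Poly_Mapping.single [v] 1"]
  by (simp add: clifford_gen_def free.R_sel)

lemma gens_closed [simp]: "set ws \<subseteq> W \<Longrightarrow> gen ` set ws \<subseteq> carrier Cl"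
  using gen_closed by blast

lemma proj_single:
  assumes "set ws \<subseteq> W"
  shows "proj (Poly_Mapping.single ws c) = c \<odot>\<^bsub>Cl\<^esub> alg_prod Cl (map gen ws)"
proof -
  interpret p: algebra_hom Fr Cl proj by (rule proj_hom)
  have "proj (Poly_Mapping.single ws 1) = alg_prod Cl (map gen ws)"
    using assms
  proof (induct ws)
    case Nil
    then show ?case using p.one by (simp add: free.R_sel)
  next
    case (Cons w ws)
    have "Poly_Mapping.single (w # ws) 1 = Poly_Mapping.single [w] 1 \<otimes>\<^bsub>Fr\<^esub> Poly_Mapping.single ws (1 :: 'k)"
      by simp
    then have "proj (Poly_Mapping.single (w # ws) 1) = gen w \<otimes>\<^bsub>Cl\<^esub> proj (Poly_Mapping.single ws 1)"
      unfolding clifford_gen_def using Cons by (simp del: free.mult_single)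
    then show ?case using Cons by simp
  qed
  moreover have "Poly_Mapping.single ws c = c \<odot>\<^bsub>Fr\<^esub> Poly_Mapping.single ws 1"
    by (simp add: free.R_sel)
  ultimately show ?thesis using p.smult[of "Poly_Mapping.single ws 1" c] assms by simp
qed

lemma gen_add: 
  assumes "v \<in> W" "w \<in> W" shows "gen (v + w) = gen v \<oplus>\<^bsub>Cl\<^esub> gen w"
proof -
  let ?s = "\<lambda>v. Poly_Mapping.single [v] (1 :: 'k)"
  have "?s (v + w) - (?s v + ?s w) \<in> clifford_rels scale W f"
    using assms by (auto simp: clifford_rels_def diff_diff_eq)
  moreover have "?s (v + w) \<in> carrier Fr"
    using assms subspace by (simp add: subspace_add)
  moreover have "?s v + ?s w \<in> carrier Fr"
    using assms by (simp add: free.R_sel keys_add_subset)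
  ultimately have "proj (?s (v + w)) = proj (?s v \<oplus>\<^bsub>Fr\<^esub> ?s w)"
    by (simp add: proj_rel free.R_sel(4))
  also have "\<dots> = proj (?s v) \<oplus>\<^bsub>Cl\<^esub> proj (?s w)"
    using algebra_hom.add[OF proj_hom] assms by simp
  finally show ?thesis by (simp add: clifford_gen_def)
qed

lemma gen_scale:
  assumes "v \<in> W" shows "gen (scale c v) = c \<odot>\<^bsub>Cl\<^esub> gen v"
proof -
  have "scale c v \<in> W" using assms subspace by (simp add: subspace_scale)
  moreover have "proj (Poly_Mapping.single [scale c v] 1) = proj (Poly_Mapping.single [v] c)"
    by (rule proj_rel)
      (use assms calculation in \<open>auto simp: clifford_rels_def simp del: free.R_sel\<close>)
  ultimately show ?thesis using assms by (simp add: proj_single)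
qed

lemma gen_square:
  assumes "v \<in> W" shows "gen v \<otimes>\<^bsub>Cl\<^esub> gen v = f v \<odot>\<^bsub>Cl\<^esub> \<one>\<^bsub>Cl\<^esub>"
proof -
  have "proj (Poly_Mapping.single [v, v] 1) = proj (Poly_Mapping.single [] (f v))"
    by (rule proj_rel)
      (use assms in \<open>auto simp: clifford_rels_def\<close>)
  then show ?thesis using assms by (simp add: proj_single)
qed

text \<open>
  Polarization: expand the square of the generator of a sum of two vectors.
\<close>

lemma gen_anticommutator:
  assumes "v \<in> W" "w \<in> W"
  shows "gen v \<otimes>\<^bsub>Cl\<^esub> gen w \<oplus>\<^bsub>Cl\<^esub> gen w \<otimes>\<^bsub>Cl\<^esub> gen v = polar f v w \<odot>\<^bsub>Cl\<^esub> \<one>\<^bsub>Cl\<^esub>"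
proof -
  let ?x = "gen v \<otimes>\<^bsub>Cl\<^esub> gen w \<oplus>\<^bsub>Cl\<^esub> gen w \<otimes>\<^bsub>Cl\<^esub> gen v" and ?s = "f v \<odot>\<^bsub>Cl\<^esub> \<one>\<^bsub>Cl\<^esub> \<oplus>\<^bsub>Cl\<^esub> f w \<odot>\<^bsub>Cl\<^esub> \<one>\<^bsub>Cl\<^esub>"
  have vw: "v + w \<in> W" using assms subspace by (simp add: subspace_add)
  have "gen (v + w) \<otimes>\<^bsub>Cl\<^esub> gen (v + w) = ?x \<oplus>\<^bsub>Cl\<^esub> ?s"
    using assms by (simp add: gen_add l_distr r_distr gen_square a_ac)
  moreover have "gen (v + w) \<otimes>\<^bsub>Cl\<^esub> gen (v + w) = polar f v w \<odot>\<^bsub>Cl\<^esub> \<one>\<^bsub>Cl\<^esub> \<oplus>\<^bsub>Cl\<^esub> ?s"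
    using gen_square[OF vw] by (simp add: polar_def flip: smult_add_left)
  ultimately show ?thesis
    using assms add.right_cancel[of ?s ?x "polar f v w \<odot>\<^bsub>Cl\<^esub> \<one>\<^bsub>Cl\<^esub>"] by simp
qed

lemma carrier_eq_lin_span: 
  "carrier Cl = lin_span Cl {alg_prod Cl (map gen ws) | ws. set ws \<subseteq> W}" (is "_ = lin_span Cl ?S")
proof
  interpret p: algebra_hom Fr Cl proj by (rule proj_hom)
  let ?T = "{Poly_Mapping.single a 1 | a. set a \<subseteq> W} :: ('v list \<Rightarrow>\<^sub>0 'k) set"
  have T: "?T \<subseteq> carrier Fr" by auto
  have "carrier Cl = proj ` carrier Fr"
    unfolding clifford_def by (rule algebra_ideal.quot_sel(1)[OF ideal])
  also have "carrier Fr \<subseteq> lin_span Fr ?T"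
    using lin_span_monoid_algebra[where G = "word_monoid W"]
    by (auto simp: free_alg_def lists_eq_set)
  then have "proj ` carrier Fr \<subseteq> proj ` lin_span Fr ?T" by (rule image_mono)
  also have "\<dots> = lin_span Cl (proj ` ?T)" by (rule p.image_lin_span[OF T])
  also have "proj ` ?T = ?S"
  proof -
    have "proj ` ?T = (\<lambda>ws. proj (Poly_Mapping.single ws 1)) ` {ws. set ws \<subseteq> W}" by blast
    also have "\<dots> = (\<lambda>ws. alg_prod Cl (map gen ws)) ` {ws. set ws \<subseteq> W}"
      by (rule image_cong) (simp_all add: proj_single)
    also have "\<dots> = ?S" by blast
    finally show ?thesis .
  qed
  finally show "carrier Cl \<subseteq> lin_span Cl ?S" .
  have "?S \<subseteq> carrier Cl" by auto
  then show "lin_span Cl ?S \<subseteq> carrier Cl"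
    using lin_span_closed by blast
qed

text \<open>
  The universal property of the Clifford algebra: a linear map with the right squares extends to
  an algebra homomorphism.
\<close>

lemma clifford_lift:
  assumes B: "unital_algebra B" and closed: "\<And>v. v \<in> W \<Longrightarrow> \<phi> v \<in> carrier B"
    and add: "\<And>v w. v \<in> W \<Longrightarrow> w \<in> W \<Longrightarrow> \<phi> (v + w) = \<phi> v \<oplus>\<^bsub>B\<^esub> \<phi> w"
    and scale: "\<And>c v. v \<in> W \<Longrightarrow> \<phi> (scale c v) = c \<odot>\<^bsub>B\<^esub> \<phi> v"
    and square: "\<And>v. v \<in> W \<Longrightarrow> \<phi> v \<otimes>\<^bsub>B\<^esub> \<phi> v = f v \<odot>\<^bsub>B\<^esub> \<one>\<^bsub>B\<^esub>"
  obtains h where "algebra_hom Cl B h" "\<And>v. v \<in> W \<Longrightarrow> h (gen v) = \<phi> v"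
proof -
  interpret B: unital_algebra B by (rule B)
  interpret L: monoid_alg_lift "word_monoid W" Fr B "\<lambda>ws. alg_prod B (map \<phi> ws)"
  proof unfold_locales
    fix a b assume "a \<in> carrier (word_monoid W)" "b \<in> carrier (word_monoid W)"
    then have "set (map \<phi> a) \<subseteq> carrier B" "set (map \<phi> b) \<subseteq> carrier B"
      using closed by auto
    then show "alg_prod B (map \<phi> (a \<otimes>\<^bsub>word_monoid W\<^esub> b)) = alg_prod B (map \<phi> a) \<otimes>\<^bsub>B\<^esub> alg_prod B (map \<phi> b)"
      using B.alg_prod_append[of "map \<phi> a" "map \<phi> b"] by (simp del: foldr_append)
  qed (use closed in \<open>auto intro!: B.alg_prod_closed\<close>)
  have L: "algebra_hom Fr B L.lift"
    by (intro algebra_hom.intro algebra_hom_axioms.intro free.unital_algebra B L.lift_hom)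
  have s: "L.lift (Poly_Mapping.single ws c) = c \<odot>\<^bsub>B\<^esub> alg_prod B (map \<phi> ws)" if "set ws \<subseteq> W" for ws c
    using that by (intro L.lift_single) auto
  have rel: "L.lift x = \<zero>\<^bsub>B\<^esub>" if "x \<in> clifford_rels scale W f" for x
  proof -
    from that consider
      (1) v w where "v \<in> W" "w \<in> W" "v + w \<in> W" "x = Poly_Mapping.single [v + w] 1 - (Poly_Mapping.single [v] 1 + Poly_Mapping.single [w] 1)"
      | (2) v c where "v \<in> W" "scale c v \<in> W" "x = Poly_Mapping.single [scale c v] 1 - Poly_Mapping.single [v] c"
      | (3) v where "v \<in> W" "x = Poly_Mapping.single [v, v] 1 - Poly_Mapping.single [] (f v)"
      using subspace unfolding clifford_rels_def
      by (auto simp: diff_diff_eq subspace_add subspace_scale)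
    then show ?thesis
    proof cases
      case 1
      have c: "Poly_Mapping.single [v] (1::'k) \<in> carrier Fr" "Poly_Mapping.single [w] (1::'k) \<in> carrier Fr"
        "Poly_Mapping.single [v + w] (1::'k) \<in> carrier Fr"
        using 1 by simp_all
      have k: "Poly_Mapping.keys (Poly_Mapping.single [v] (1::'k) + Poly_Mapping.single [w] 1) \<subseteq> lists W"
        using 1 by (simp add: keys_add_subset)
      have "L.lift (Poly_Mapping.single [v] 1 + Poly_Mapping.single [w] 1) = \<phi> v \<oplus>\<^bsub>B\<^esub> \<phi> w"
        using L.lift_add[of "Poly_Mapping.single [v] 1" "Poly_Mapping.single [w] 1"] 1 closed by (simp add: s)
      then show ?thesis
        unfolding 1(4) using 1 k closed add
        by (subst free.hom_diff_eq_zero_iff[OF L]) (auto simp: s)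
    next
      case 2
      then show ?thesis
        unfolding 2(3) using closed scale by (subst free.hom_diff_eq_zero_iff[OF L]) (auto simp: s)
    next
      case 3
      then show ?thesis
        unfolding 3(2) using closed square by (subst free.hom_diff_eq_zero_iff[OF L]) (auto simp: s)
    qed
  qed
  have kills: "L.lift x = \<zero>\<^bsub>B\<^esub>" if "x \<in> clifford_ideal scale W f" for x
    using algebra_hom.hom_kills_genideal[OF L rels_closed rel] that
    by (simp add: clifford_ideal_def)
  show thesis
  proof
    show "algebra_hom Cl B (quot_lift L.lift)"
      unfolding clifford_def by (rule algebra_ideal.quot_lift_hom[OF ideal L kills])
    show "quot_lift L.lift (gen v) = \<phi> v" if "v \<in> W" for v
      unfolding clifford_gen_def
      using algebra_ideal.quot_lift_proj[OF ideal L kills, of "Poly_Mapping.single [v] 1"] that closed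
      by (simp add: s)
  qed
qed

end

section \<open>A trace on the Clifford algebra\<close>

text \<open>
  Exterior multiplication by the linear form \<open>b\<close>. Forms are functions of the list of their
  arguments, of all degrees at once. The recursion says that the contraction with \<open>w\<close> of $b\wedge\omega$ is
  $b(w)\,\omega$ minus $b$ times the contraction of $\omega$, so that the relation
  between the two operations holds by definition.
\<close>

fun wedge :: "('v \<Rightarrow> 'k :: field) \<Rightarrow> ('v list \<Rightarrow> 'k) \<Rightarrow> 'v list \<Rightarrow> 'k" where
  "wedge b \<omega> [] = 0"
| "wedge b \<omega> (w # ws) = b w * \<omega> ws - wedge b (\<lambda>xs. \<omega> (w # xs)) ws"

lemma wedge_lincomb:
  "wedge b (\<lambda>xs. c * \<omega> xs + d * \<eta> xs) ws = c * wedge b \<omega> ws + d * wedge b \<eta> ws"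
  by (induct ws arbitrary: \<omega> \<eta>) (simp_all add: algebra_simps)

lemma wedge_zero [simp]: "wedge b (\<lambda>xs. 0) ws = 0"
  using wedge_lincomb[of b 0 "\<lambda>_. 0" 0 "\<lambda>_. 0" ws] by simp

lemma wedge_functional_lincomb:
  "wedge (\<lambda>w. c * b w + d * b' w) \<omega> ws = c * wedge b \<omega> ws + d * wedge b' \<omega> ws"
  by (induct ws arbitrary: \<omega>) (simp_all add: algebra_simps)

text \<open>
  Evaluating on \<open>w # ws\<close>, the two terms in which $b$ takes the argument \<open>w\<close> cancel, and what remains is
  the same statement for the contraction of $\omega$ with \<open>w\<close>.
\<close>

lemma wedge_wedge: "wedge b (wedge b \<omega>) ws = 0"
proof (induct ws arbitrary: \<omega>)
  case (Cons w ws)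
  have "wedge b (\<lambda>xs. wedge b \<omega> (w # xs)) ws
      = wedge b (\<lambda>xs. b w * \<omega> xs + (- 1) * wedge b (\<lambda>ys. \<omega> (w # ys)) xs) ws"
    by simp
  also have "\<dots> = b w * wedge b \<omega> ws + (- 1) * wedge b (wedge b (\<lambda>ys. \<omega> (w # ys))) ws"
    by (rule wedge_lincomb)
  finally have "wedge b (\<lambda>xs. wedge b \<omega> (w # xs)) ws = b w * wedge b \<omega> ws"
    using Cons by simp
  then show ?case by simp
qed simp

text \<open>
  For multilinear forms, vanishing at adjacent equal arguments is the same as being alternating, and
  it fits the recursion over the argument list.
\<close>

definition alternating :: "('k :: field \<Rightarrow> 'v :: ab_group_add \<Rightarrow> 'v) \<Rightarrow> ('v list \<Rightarrow> 'k) \<Rightarrow> bool" where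
  "alternating scale \<omega> \<longleftrightarrow>
     (\<forall>xs ys v w. \<omega> (xs @ (v + w) # ys) = \<omega> (xs @ v # ys) + \<omega> (xs @ w # ys)) \<and>
     (\<forall>xs ys c v. \<omega> (xs @ scale c v # ys) = c * \<omega> (xs @ v # ys)) \<and>
     (\<forall>xs ys v. \<omega> (xs @ v # v # ys) = 0)"

lemma alternating_Cons: "alternating scale \<omega> \<Longrightarrow> alternating scale (\<lambda>xs. \<omega> (u # xs))"
  unfolding alternating_def by (metis append_Cons)

lemma alternating_lincomb:
  "alternating scale \<omega> \<Longrightarrow> alternating scale \<eta> \<Longrightarrow> alternating scale (\<lambda>xs. c * \<omega> xs + d * \<eta> xs)"
  unfolding alternating_def by (simp add: algebra_simps)

lemma alternating_wedge:
  assumes "alternating scale \<omega>" "\<And>v w. b (v + w) = b v + b w" "\<And>c v. b (scale c v) = c * b v"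
  shows "alternating scale (wedge b \<omega>)"
proof -
  have "wedge b \<omega> (xs @ (v + w) # ys) = wedge b \<omega> (xs @ v # ys) + wedge b \<omega> (xs @ w # ys) \<and>
      wedge b \<omega> (xs @ scale c v # ys) = c * wedge b \<omega> (xs @ v # ys) \<and>
      wedge b \<omega> (xs @ v # v # ys) = 0" for xs ys v w c
    using assms(1)
  proof (induct xs arbitrary: \<omega>)
    case Nil
    have e: "\<omega> ((v + w) # zs) = \<omega> (v # zs) + \<omega> (w # zs)" "\<omega> (scale c v # zs) = c * \<omega> (v # zs)"
      "\<omega> (v # v # zs) = 0" for v w c zs
      using Nil unfolding alternating_def by (metis append_Nil)+
    show ?case
      using wedge_lincomb[of b 1 "\<lambda>xs. \<omega> (v # xs)" 1 "\<lambda>xs. \<omega> (w # xs)" ys]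
        wedge_lincomb[of b c "\<lambda>xs. \<omega> (v # xs)" 0 "\<lambda>xs. 0" ys]
      by (simp add: e assms algebra_simps)
  next
    case (Cons x xs)
    have "\<omega> (xs @ (v + w) # ys) = \<omega> (xs @ v # ys) + \<omega> (xs @ w # ys)"
      "\<omega> (xs @ scale c v # ys) = c * \<omega> (xs @ v # ys)" "\<omega> (xs @ v # v # ys) = 0"
      using Cons.prems unfolding alternating_def by blast+
    then show ?case
      using Cons.hyps[OF alternating_Cons[OF Cons.prems, of x]] by (simp add: algebra_simps)
  qed
  then show ?thesis by (simp add: alternating_def)
qed

context clifford_space
begin

text \<open>
  The operator by which \<open>v\<close> acts in Chevalley's representation; the first summand is the contraction
  with \<open>v\<close>.
\<close>

definition cliff_op :: "'v \<Rightarrow> ('v list \<Rightarrow> 'k) \<Rightarrow> 'v list \<Rightarrow> 'k" where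
  "cliff_op v \<omega> ws = \<omega> (v # ws) + wedge (\<lambda>w. polar f v w / 2) \<omega> ws"

lemma polar_linear:
  "polar f v (w + w') = polar f v w + polar f v w'" "polar f v (scale c w) = c * polar f v w"
  "polar f (w + w') v = polar f w v + polar f w' v" "polar f (scale c w) v = c * polar f w v"
  using quadratic unfolding quadratic_form_def
  by (auto simp: Vector_Spaces.linear_def module_hom_def module_hom_axioms_def)

lemma alternating_cliff_op:
  assumes "alternating scale \<omega>" shows "alternating scale (cliff_op v \<omega>)"
proof -
  have "alternating scale (wedge (\<lambda>w. polar f v w / 2) \<omega>)"
    by (rule alternating_wedge[OF assms]) (simp_all add: polar_linear add_divide_distrib)
  from alternating_lincomb[OF alternating_Cons[OF assms] this, of 1 v 1]
  show ?thesis by (simp add: cliff_op_def[abs_def])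
qed

lemma cliff_op_lincomb:
  "cliff_op v (\<lambda>xs. c * \<omega> xs + d * \<eta> xs) ws = c * cliff_op v \<omega> ws + d * cliff_op v \<eta> ws"
  by (simp add: cliff_op_def wedge_lincomb algebra_simps)

lemma cliff_op_add:
  assumes "alternating scale \<omega>"
  shows "cliff_op (v + w) \<omega> ws = cliff_op v \<omega> ws + cliff_op w \<omega> ws"
proof -
  have "\<omega> ((v + w) # ws) = \<omega> (v # ws) + \<omega> (w # ws)"
    using assms unfolding alternating_def by (metis append_Nil)
  moreover have "wedge (\<lambda>u. polar f (v + w) u / 2) \<omega> ws
      = wedge (\<lambda>u. polar f v u / 2) \<omega> ws + wedge (\<lambda>u. polar f w u / 2) \<omega> ws"
    using wedge_functional_lincomb[of 1 "\<lambda>u. polar f v u / 2" 1 "\<lambda>u. polar f w u / 2" \<omega> ws]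
    by (simp add: polar_linear add_divide_distrib)
  ultimately show ?thesis by (simp add: cliff_op_def)
qed

lemma cliff_op_scale:
  assumes "alternating scale \<omega>"
  shows "cliff_op (scale c v) \<omega> ws = c * cliff_op v \<omega> ws"
proof -
  have "\<omega> (scale c v # ws) = c * \<omega> (v # ws)"
    using assms unfolding alternating_def by (metis append_Nil)
  moreover have "wedge (\<lambda>u. polar f (scale c v) u / 2) \<omega> ws = c * wedge (\<lambda>u. polar f v u / 2) \<omega> ws"
    using wedge_functional_lincomb[of c "\<lambda>u. polar f v u / 2" 0 "\<lambda>u. 0" \<omega> ws]
    by (simp add: polar_linear)
  ultimately show ?thesis by (simp add: cliff_op_def algebra_simps)
qed

lemma polar_self: "polar f v v = 2 * f v"
proof -
  have "f (v + v) = 2\<^sup>2 * f v"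
    using quadratic scale_left_distrib[of 1 1 v] unfolding quadratic_form_def
    by (metis one_add_one scale_one)
  then show ?thesis by (simp add: polar_def)
qed

text \<open>
  Contraction squares to zero on alternating forms and exterior multiplication always does, so the
  square is their anticommutator, the scalar $f(v,v)/2=f(v)$.
\<close>

lemma cliff_op_square:
  assumes "alternating scale \<omega>" "(2 :: 'k) \<noteq> 0"
  shows "cliff_op v (cliff_op v \<omega>) ws = f v * \<omega> ws"
proof -
  let ?b = "\<lambda>w. polar f v w / 2"
  have b: "?b v = f v" using assms by (simp add: polar_self)
  have "\<omega> (v # v # ws) = 0"
    using assms unfolding alternating_def by (metis append_Nil)
  moreover have "wedge ?b (\<lambda>xs. \<omega> (v # xs) + wedge ?b \<omega> xs) ws = wedge ?b (\<lambda>xs. \<omega> (v # xs)) ws"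
    using wedge_lincomb[of ?b 1 "\<lambda>xs. \<omega> (v # xs)" 1 "wedge ?b \<omega>" ws] by (simp add: wedge_wedge)
  ultimately show ?thesis
    using b by (simp add: cliff_op_def cliff_op_def[abs_def])
qed

abbreviation cliff_word :: "'v list \<Rightarrow> ('v list \<Rightarrow> 'k) \<Rightarrow> 'v list \<Rightarrow> 'k" where
  "cliff_word vs \<equiv> foldr cliff_op vs"

lemma alternating_cliff_word: "alternating scale \<omega> \<Longrightarrow> alternating scale (cliff_word vs \<omega>)"
  by (induct vs) (simp_all add: alternating_cliff_op)

lemma cliff_word_lincomb:
  "cliff_word vs (\<lambda>xs. c * \<omega> xs + d * \<eta> xs) = (\<lambda>xs. c * cliff_word vs \<omega> xs + d * cliff_word vs \<eta> xs)"
  by (induct vs) (auto simp: cliff_op_lincomb)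

definition act :: "('v list \<Rightarrow>\<^sub>0 'k) \<Rightarrow> ('v list \<Rightarrow> 'k) \<Rightarrow> 'v list \<Rightarrow> 'k" where
  "act p \<omega> xs = (\<Sum>vs\<in>Poly_Mapping.keys p. Poly_Mapping.lookup p vs * cliff_word vs \<omega> xs)"

lemma act_superset:
  assumes "finite X" "Poly_Mapping.keys p \<subseteq> X"
  shows "act p \<omega> xs = (\<Sum>vs\<in>X. Poly_Mapping.lookup p vs * cliff_word vs \<omega> xs)"
  unfolding act_def by (rule sum.mono_neutral_left) (use assms in \<open>auto simp: in_keys_iff\<close>)

lemma act_single [simp]: "act (Poly_Mapping.single vs c) \<omega> xs = c * cliff_word vs \<omega> xs"
  by (subst act_superset[of "{vs}"]) auto

lemma act_add: "act (p + q) \<omega> xs = act p \<omega> xs + act q \<omega> xs"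
  by (subst (1 2 3) act_superset[of "Poly_Mapping.keys p \<union> Poly_Mapping.keys q"])
    (use keys_add[of p q] in \<open>auto simp: lookup_add distrib_right sum.distrib\<close>)

lemma act_zero [simp]: "act 0 \<omega> xs = 0"
  by (simp add: act_def)

lemma act_diff: "act (p - q) \<omega> xs = act p \<omega> xs - act q \<omega> xs"
  using act_add[of "p - q" q \<omega> xs] by simp

lemma act_zero_form:
  assumes "\<And>ys. \<eta> ys = 0" shows "act p \<eta> xs = 0"
proof -
  have "\<eta> = (\<lambda>_. 0)" using assms by auto
  then show ?thesis
    using cliff_word_lincomb[of _ 0 "\<lambda>_. 0" 0 "\<lambda>_. 0"] by (simp add: act_def)
qed

lemma alternating_act:
  assumes "alternating scale \<omega>" shows "alternating scale (act p \<omega>)"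
proof -
  have "Poly_Mapping.keys p \<subseteq> UNIV" by simp
  then show ?thesis
  proof (induct rule: poly_mapping_carrier_induct)
    case (add a c p)
    then show ?case
      using alternating_lincomb[OF alternating_cliff_word[OF assms, of a] add(3), of c 1]
      by (simp add: act_add fun_eq_iff alternating_def)
  qed (simp add: alternating_def)
qed

lemma act_mult: "act (p \<otimes>\<^bsub>Fr\<^esub> q) \<omega> xs = act p (act q \<omega>) xs"
proof -
  have *: "Poly_Mapping.keys p \<subseteq> UNIV" for p :: "'v list \<Rightarrow>\<^sub>0 'k" by simp
  show ?thesis
    using *[of p]
  proof (induct rule: poly_mapping_carrier_induct)
    case (add a c p)
    have "act (Poly_Mapping.single a c \<otimes>\<^bsub>Fr\<^esub> q) \<omega> xs = c * cliff_word a (act q \<omega>) xs"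
      using *[of q]
    proof (induct rule: poly_mapping_carrier_induct)
      case zero
      then show ?case
        using cliff_word_lincomb[of a 0 "\<lambda>_. 0" 0 "\<lambda>_. 0"] by (simp add: act_def[abs_def])
    next
      case q: (add b d q)
      have "act (Poly_Mapping.single b d + q) \<omega> = (\<lambda>xs. d * cliff_word b \<omega> xs + 1 * act q \<omega> xs)"
        by (simp add: fun_eq_iff act_add)
      then have "cliff_word a (act (Poly_Mapping.single b d + q) \<omega>) xs
          = d * cliff_word a (cliff_word b \<omega>) xs + cliff_word a (act q \<omega>) xs"
        using cliff_word_lincomb[of a d "cliff_word b \<omega>" 1 "act q \<omega>"] by simp
      then show ?case
        using q by (simp add: free.mult_add_right act_add[of _ _ _ xs] algebra_simps)
    qed
    then show ?case using add by (simp add: free.mult_add_left act_add)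
  qed simp
qed

text \<open>
  The elements acting by zero on alternating forms form a two-sided ideal, for a right multiple
  because the action preserves alternating forms. This ideal contains the defining relations.
\<close>

lemma clifford_ideal_acts_by_zero:
  assumes "(2 :: 'k) \<noteq> 0" "p \<in> clifford_ideal scale W f" "alternating scale \<omega>"
  shows "act p \<omega> xs = 0"
proof -
  interpret F: unital_algebra Fr by (rule free.unital_algebra)
  define N where "N = {p \<in> carrier Fr. \<forall>\<omega> xs. alternating scale \<omega> \<longrightarrow> act p \<omega> xs = 0}"
  have "ideal N Fr"
  proof (rule idealI[OF F.ring_axioms])
    show "subgroup N (add_monoid Fr)"
    proof (rule subgroup.intro)
      fix p assume p: "p \<in> N"
      then have "inv\<^bsub>add_monoid Fr\<^esub> p = (-1) \<odot>\<^bsub>Fr\<^esub> p"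
        by (simp add: N_def F.smult_minus_one a_inv_def)
      also have "\<dots> = - p"
        by (auto intro!: poly_mapping_eqI simp: free.R_sel)
      finally show "inv\<^bsub>add_monoid Fr\<^esub> p \<in> N"
        using p act_diff[of 0 p] by (simp add: N_def free.R_sel)
    qed (auto simp: N_def act_add free.R_sel(3,4) intro: F.a_closed[unfolded free.R_sel(4)] F.zero_closed[unfolded free.R_sel(3)])
  next
    fix a p assume a: "a \<in> N" "p \<in> carrier Fr"
    then show "p \<otimes>\<^bsub>Fr\<^esub> a \<in> N"
      using F.m_closed[of p a] by (auto simp: N_def act_mult simp del: free.R_sel intro: act_zero_form)
    show "a \<otimes>\<^bsub>Fr\<^esub> p \<in> N"
      using a F.m_closed[of a p] by (auto simp: N_def act_mult alternating_act simp del: free.R_sel)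
  qed
  moreover have "clifford_rels scale W f \<subseteq> N"
    using rels_closed
    by (auto simp: N_def clifford_rels_def act_diff cliff_op_add cliff_op_scale cliff_op_square assms(1) simp del: free.R_sel)
  ultimately have "clifford_ideal scale W f \<subseteq> N"
    unfolding clifford_ideal_def by (rule F.genideal_minimal)
  then show ?thesis using assms by (auto simp: N_def)
qed

text \<open>
  The degree zero part of the action on the constant form. The value does not depend on the
  representative by \<open>clifford_ideal_acts_by_zero\<close>.
\<close>

definition trace :: "('v list \<Rightarrow>\<^sub>0 'k) set \<Rightarrow> 'k" where
  "trace X = quot_lift (\<lambda>p. act p (\<lambda>xs. if xs = [] then 1 else 0) []) X"

context
  assumes two: "(2 :: 'k) \<noteq> 0"
begin

lemma alternating_vacuum: "alternating scale (\<lambda>xs. if xs = [] then 1 else 0)"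
  by (simp add: alternating_def)

lemma trace_proj:
  assumes "p \<in> carrier Fr"
  shows "trace (proj p) = act p (\<lambda>xs. if xs = [] then 1 else 0) []"
  unfolding trace_def
  by (rule algebra_ideal.quot_lift_coset[OF ideal _ assms])
    (simp add: free.R_sel(4) act_add clifford_ideal_acts_by_zero[OF two _ alternating_vacuum])

lemma carrier_proj: "X \<in> carrier Cl \<Longrightarrow> \<exists>p\<in>carrier Fr. X = proj p"
  using algebra_ideal.quot_sel(1)[OF ideal] unfolding clifford_def by blast

lemma trace_add:
  assumes "X \<in> carrier Cl" "Y \<in> carrier Cl"
  shows "trace (X \<oplus>\<^bsub>Cl\<^esub> Y) = trace X + trace Y"
proof -
  interpret p: algebra_hom Fr Cl proj by (rule proj_hom)
  obtain x y where xy: "x \<in> carrier Fr" "X = proj x" "y \<in> carrier Fr" "Y = proj y"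
    using assms carrier_proj by metis
  then have "X \<oplus>\<^bsub>Cl\<^esub> Y = proj (x \<oplus>\<^bsub>Fr\<^esub> y)"
    using p.add[of x y] by simp
  then show ?thesis
    using xy p.A.a_closed[of x y] by (simp only: trace_proj free.R_sel(4) act_add)
qed

lemma trace_smult:
  assumes "X \<in> carrier Cl"
  shows "trace (c \<odot>\<^bsub>Cl\<^esub> X) = c * trace X"
proof -
  interpret p: algebra_hom Fr Cl proj by (rule proj_hom)
  obtain x where x: "x \<in> carrier Fr" "X = proj x"
    using assms carrier_proj by metis
  then have "c \<odot>\<^bsub>Cl\<^esub> X = proj (c \<odot>\<^bsub>Fr\<^esub> x)"
    using p.smult[of x c] by simp
  moreover have "act (c \<odot>\<^bsub>Fr\<^esub> x) \<omega> xs = c * act x \<omega> xs" for \<omega> xs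
    using keys_map_times_subset[of c x]
    by (subst (1 2) act_superset[of "Poly_Mapping.keys x"])
      (auto simp: free.R_sel(5) sum_distrib_left mult_ac)
  ultimately show ?thesis
    using x p.A.smult_closed[of x c] by (simp only: trace_proj)
qed

lemma trace_word:
  assumes "set ws \<subseteq> W"
  shows "trace (alg_prod Cl (map gen ws)) = cliff_word ws (\<lambda>xs. if xs = [] then 1 else 0) []"
proof -
  have "alg_prod Cl (map gen ws) = proj (Poly_Mapping.single ws 1)"
    using assms by (simp add: proj_single)
  then show ?thesis using assms by (simp only: trace_proj single_closed) simp
qed

lemma trace_one: "trace \<one>\<^bsub>Cl\<^esub> = 1"
  using trace_word[of "[]"] by simp

text \<open>
  Contraction with \<open>v\<close> anticommutes with the action of every vector orthogonal to \<open>v\<close> and kills the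
  constant form, so it kills the form obtained from the tail \<open>ws\<close>. In degree zero the
  action of \<open>v\<close> is just this contraction.
\<close>

lemma trace_orthogonal_word:
  assumes "set (v # ws) \<subseteq> W" "\<And>w. w \<in> set ws \<Longrightarrow> polar f w v = 0"
  shows "trace (alg_prod Cl (map gen (v # ws))) = 0"
proof -
  let ?\<omega> = "\<lambda>xs. if xs = [] then (1 :: 'k) else 0"
  have *: "cliff_word ws ?\<omega> (v # ys) = 0" for ys
    using assms(2)
  proof (induct ws arbitrary: ys)
    case (Cons w ws)
    \<comment> \<open>Alternation lets \<open>v\<close> move past \<open>w\<close> with a sign, to where the induction hypothesis applies.\<close>
    define \<eta> where "\<eta> = cliff_word ws ?\<omega>"
    have alt: "alternating scale \<eta>"
      unfolding \<eta>_def by (intro alternating_cliff_word alternating_vacuum)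
    have add: "\<eta> (xs @ (a + b) # ys) = \<eta> (xs @ a # ys) + \<eta> (xs @ b # ys)"
      and square: "\<eta> (xs @ a # a # ys) = 0" for xs ys a b
      using alt unfolding alternating_def by blast+
    have "\<eta> (v # w # ys) + \<eta> (w # v # ys) = 0"
      using square[of "[]" "v + w" ys] square[of "[]" v ys] square[of "[]" w ys]
        add[of "[]" v w "(v + w) # ys"] add[of "[v]" v w ys] add[of "[w]" v w ys]
      by simp
    moreover have "\<eta> (v # zs) = 0" for zs
      using Cons by (simp add: \<eta>_def)
    ultimately have "\<eta> (w # v # ys) = 0" "(\<lambda>zs. \<eta> (v # zs)) = (\<lambda>_. 0)"
      by auto
    then have "cliff_op w \<eta> (v # ys) = 0"
      using Cons.prems by (simp add: cliff_op_def)
    then show ?case by (simp add: \<eta>_def)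
  qed simp
  have "trace (alg_prod Cl (map gen (v # ws))) = cliff_op v (cliff_word ws ?\<omega>) []"
    using trace_word[OF assms(1)] by simp
  also have "\<dots> = cliff_word ws ?\<omega> [v]"
    unfolding cliff_op_def[of v] by simp
  also have "\<dots> = 0" by (rule *)
  finally show ?thesis .
qed

end

end

section \<open>Words in anticommuting square roots of one\<close>

definition odd_letters :: "'i list \<Rightarrow> 'i set" where
  "odd_letters us = {j. odd (count_list us j)}"

lemma odd_letters_simps [simp]:
  "odd_letters [] = {}"
  "odd_letters (us @ vs) = sym_diff (odd_letters us) (odd_letters vs)"
  "odd_letters (rev us) = odd_letters us"
  "odd_letters (u # us) = sym_diff {u} (odd_letters us)"
  by (auto simp: odd_letters_def)

lemma odd_letters_subset: "odd_letters us \<subseteq> set us"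
  by (auto simp: odd_letters_def) (metis count_notin even_zero)

lemma finite_odd_letters [simp]: "finite (odd_letters us)"
  using finite_subset[OF odd_letters_subset finite_set] .

lemma odd_letters_distinct:
  assumes "distinct us" shows "odd_letters us = set us"
proof -
  have "count_list us j = (if j \<in> set us then 1 else 0)" for j
    using assms by (induct us) auto
  then show ?thesis by (auto simp: odd_letters_def split: if_splits)
qed

lemma even_card_odd_letters: "even (card (odd_letters us)) \<longleftrightarrow> even (length us)"
proof -
  have "odd_letters us = {j \<in> set us. odd (count_list us j)}"
    using odd_letters_subset[of us] by (auto simp: odd_letters_def)
  then show ?thesis
    using even_sum_iff[of "set us" "count_list us"] sum_count_set[of us "set us"] by simp
qed

text \<open>
  Reordering a word changes its sign, and the exact sign matters only
  for commutation relations; elsewhere this relation avoids it.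
\<close>

definition proportional :: "('k :: field, 'a) module \<Rightarrow> 'a \<Rightarrow> 'a \<Rightarrow> bool" where
  "proportional A x y \<longleftrightarrow> (\<exists>s. s \<noteq> 0 \<and> x = s \<odot>\<^bsub>A\<^esub> y)"

context unital_algebra
begin

lemma proportional_refl: "x \<in> carrier A \<Longrightarrow> proportional A x x"
  unfolding proportional_def by (intro exI[of _ 1]) simp

lemma proportional_smult: "c \<noteq> 0 \<Longrightarrow> proportional A (c \<odot> x) x"
  by (auto simp: proportional_def)

lemma proportional_sym:
  assumes "y \<in> carrier A" "proportional A x y" shows "proportional A y x"
proof -
  obtain s where "s \<noteq> 0" "x = s \<odot> y" using assms by (auto simp: proportional_def)
  then show ?thesis
    using assms unfolding proportional_def by (intro exI[of _ "inverse s"]) simp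
qed

lemma proportional_trans:
  assumes "z \<in> carrier A" "proportional A x y" "proportional A y z" shows "proportional A x z"
proof -
  obtain s t where "s \<noteq> 0" "x = s \<odot> y" "t \<noteq> 0" "y = t \<odot> z"
    using assms by (auto simp: proportional_def)
  then show ?thesis
    using assms unfolding proportional_def by (intro exI[of _ "s * t"]) simp
qed

lemma proportional_mult:
  assumes "y \<in> carrier A" "y' \<in> carrier A" "proportional A x y" "proportional A x' y'"
  shows "proportional A (x \<otimes> x') (y \<otimes> y')"
proof -
  obtain s t where "s \<noteq> 0" "x = s \<odot> y" "t \<noteq> 0" "x' = t \<odot> y'"
    using assms by (auto simp: proportional_def)
  then show ?thesis
    using assms unfolding proportional_def by (intro exI[of _ "t * s"]) simp
qed

lemma proportional_lin_span:
  assumes "S \<subseteq> carrier A" "y \<in> lin_span A S" "proportional A x y" shows "x \<in> lin_span A S"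
  using assms lin_span_smult by (auto simp: proportional_def)

end

text \<open>
  The index set is a parameter: it is finite for the Clifford algebra of a block and consists of
  all positive integers for the whole space.
\<close>

locale anticommuting = unital_algebra A
  for A :: "('k :: field, 'a) module" (structure) +
  fixes e :: "'i \<Rightarrow> 'a" and N :: "'i set"
  assumes e_closed [simp]: "j \<in> N \<Longrightarrow> e j \<in> carrier A"
    and e_square: "j \<in> N \<Longrightarrow> e j \<otimes> e j = \<one>"
    and e_anticommute: "i \<in> N \<Longrightarrow> j \<in> N \<Longrightarrow> i \<noteq> j \<Longrightarrow> e i \<otimes> e j = (-1) \<odot> (e j \<otimes> e i)"
begin

definition word :: "'i list \<Rightarrow> 'a" where
  "word us = alg_prod A (map e us)"

lemma word_closed [simp]: "set us \<subseteq> N \<Longrightarrow> word us \<in> carrier A"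
  unfolding word_def by (rule alg_prod_closed) auto

lemma word_simps [simp]: "word [] = \<one>" "word (u # us) = e u \<otimes> word us"
  by (simp_all add: word_def)

lemma word_append: "set us \<subseteq> N \<Longrightarrow> set vs \<subseteq> N \<Longrightarrow> word (us @ vs) = word us \<otimes> word vs"
  by (induct us) (simp_all add: m_assoc)

text \<open>
  Passing \<open>e j\<close> through a letter different from \<open>j\<close> costs a sign, passing it through \<open>e j\<close> costs nothing.
\<close>

lemma e_word:
  assumes "j \<in> N" "set us \<subseteq> N"
  shows "e j \<otimes> word us = (-1) ^ length (filter (\<lambda>i. i \<noteq> j) us) \<odot> (word us \<otimes> e j)"
  using assms(2)
proof (induct us)
  case (Cons u us)
  let ?k = "length (filter (\<lambda>i. i \<noteq> j) us)"
  have u: "u \<in> N" "set us \<subseteq> N" using Cons by auto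
  have "e u \<otimes> (e j \<otimes> word us) = (-1) ^ ?k \<odot> (e u \<otimes> word us \<otimes> e j)"
    using Cons u assms by (simp add: m_assoc)
  moreover have "e j \<otimes> (e u \<otimes> word us) = (if u = j then 1 else -1) \<odot> (e u \<otimes> (e j \<otimes> word us))"
  proof (cases "u = j")
    case False
    have "e j \<otimes> (e u \<otimes> word us) = (e j \<otimes> e u) \<otimes> word us"
      using u assms by (simp add: m_assoc)
    also have "\<dots> = ((-1) \<odot> (e u \<otimes> e j)) \<otimes> word us"
      using e_anticommute[of j u] False u assms by simp
    finally show ?thesis using False u assms by (simp add: m_assoc)
  qed (use u assms in simp)
  ultimately show ?case
    using u assms by simp
qed (use assms in simp)

lemma word_rev: "set us \<subseteq> N \<Longrightarrow> word us \<otimes> word (rev us) = \<one>"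
proof (induct us)
  case (Cons u us)
  then have u: "u \<in> N" "set us \<subseteq> N" by auto
  then have "word (u # us) \<otimes> word (rev (u # us)) = e u \<otimes> (word us \<otimes> word (rev us)) \<otimes> e u"
    by (simp add: word_append m_assoc)
  then show ?case using Cons u by (simp add: e_square)
qed simp

text \<open>
  The first letter occurs again later. Moved next to that occurrence, up to sign, it cancels with
  it, which leaves a shorter word of the same kind.
\<close>

lemma word_proportional_one:
  assumes "set us \<subseteq> N" "odd_letters us = {}"
  shows "proportional A (word us) \<one>"
  using assms
proof (induct "length us" arbitrary: us rule: less_induct)
  case less
  show ?case
  proof (cases us)
    case Nil
    then show ?thesis by (simp add: proportional_refl)
  next
    case (Cons j vs)
    have "odd (count_list vs j)"
      using less(3) Cons by (auto simp: odd_letters_def split: if_splits)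
    then have "j \<in> set vs" by (metis count_notin even_zero)
    then obtain a b where ab: "vs = a @ j # b" by (meson split_list)
    have N: "j \<in> N" "set a \<subseteq> N" "set b \<subseteq> N" using less Cons ab by auto
    have "odd_letters (a @ b) = {}"
      using less(3) Cons ab unfolding odd_letters_def by (auto split: if_splits)
    then have p: "proportional A (word (a @ b)) \<one>"
      using less Cons ab by simp
    have "word us = (e j \<otimes> word a) \<otimes> (e j \<otimes> word b)"
      using Cons ab N by (simp add: word_append m_assoc)
    also have "\<dots> = (-1) ^ length (filter (\<lambda>i. i \<noteq> j) a) \<odot> (word a \<otimes> (e j \<otimes> e j) \<otimes> word b)"
      using N by (simp add: e_word m_assoc mult.commute)
    also have "\<dots> = (-1) ^ length (filter (\<lambda>i. i \<noteq> j) a) \<odot> word (a @ b)"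
      using N by (simp add: e_square word_append)
    finally have "proportional A (word us) (word (a @ b))"
      by (simp add: proportional_smult)
    then show ?thesis using p proportional_trans by blast
  qed
qed

text \<open>
  The word \<open>us @ rev vs\<close> has no letter of odd multiplicity, and \<open>rev vs\<close> is inverse to \<open>vs\<close>.
\<close>

lemma word_proportional:
  assumes "set us \<subseteq> N" "set vs \<subseteq> N" "odd_letters us = odd_letters vs"
  shows "proportional A (word us) (word vs)"
proof -
  have "proportional A (word (us @ rev vs) \<otimes> word vs) (\<one> \<otimes> word vs)"
    using assms by (intro proportional_mult word_proportional_one proportional_refl) auto
  moreover have "word (us @ rev vs) \<otimes> word vs = word us \<otimes> (word (rev vs) \<otimes> word (rev (rev vs)))"
    using assms by (simp add: word_append m_assoc)
  ultimately show ?thesis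
    using assms word_rev[of "rev vs"] by simp
qed

end

locale traced_anticommuting = anticommuting A e N
  for A :: "('k :: field, 'a) module" (structure) and e :: "'i :: linorder \<Rightarrow> 'a" and N +
  fixes \<tau> :: "'a \<Rightarrow> 'k"
  assumes trace_add: "x \<in> carrier A \<Longrightarrow> y \<in> carrier A \<Longrightarrow> \<tau> (x \<oplus> y) = \<tau> x + \<tau> y"
    and trace_smult: "x \<in> carrier A \<Longrightarrow> \<tau> (c \<odot> x) = c * \<tau> x"
    and trace_one: "\<tau> \<one> = 1"
    and trace_distinct: "us \<noteq> [] \<Longrightarrow> distinct us \<Longrightarrow> set us \<subseteq> N \<Longrightarrow> \<tau> (word us) = 0"
begin

lemma trace_word_eq_zero_iff:
  assumes "set us \<subseteq> N" shows "\<tau> (word us) = 0 \<longleftrightarrow> odd_letters us \<noteq> {}"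
proof (cases "odd_letters us = {}")
  case True
  then obtain s where "s \<noteq> 0" "word us = s \<odot> \<one>"
    using word_proportional_one[OF assms] by (auto simp: proportional_def)
  then show ?thesis using True by (simp add: trace_smult trace_one)
next
  case False
  define vs where "vs = sorted_list_of_set (odd_letters us)"
  have vs: "set vs = odd_letters us" "distinct vs" "vs \<noteq> []" "set vs \<subseteq> N"
    using False odd_letters_subset[of us] assms by (auto simp: vs_def)
  have "odd_letters us = odd_letters vs" using vs by (simp add: odd_letters_distinct)
  then obtain s where "word us = s \<odot> word vs"
    using word_proportional[OF assms vs(4)] by (auto simp: proportional_def)
  then show ?thesis using False vs by (simp add: trace_smult trace_distinct)
qed

text \<open>
  Reversed words are, up to scalars, a dual basis for the trace pairing.
\<close>

lemma trace_pairing_eq_zero_iff: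
  assumes "set us \<subseteq> N" "set vs \<subseteq> N"
  shows "\<tau> (word (rev us) \<otimes> word vs) = 0 \<longleftrightarrow> odd_letters us \<noteq> odd_letters vs"
  using trace_word_eq_zero_iff[of "rev us @ vs"] assms by (auto simp: word_append)

text \<open>
  Pairing with the reversed word of one member of the family kills the images of all the others,
  so the coefficients of an element of the kernel vanish one after the other.
\<close>

lemma inj_on_if_basis_to_words:
  assumes hom: "algebra_hom T A h" and fin: "finite X"
    and b: "b ` X \<subseteq> carrier T" and span: "carrier T \<subseteq> lin_span T (b ` X)"
    and \<beta>: "\<And>x. x \<in> X \<Longrightarrow> set (\<beta> x) \<subseteq> N" "\<And>x. x \<in> X \<Longrightarrow> proportional A (h (b x)) (word (\<beta> x))"
    and inj: "inj_on (\<lambda>x. odd_letters (\<beta> x)) X"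
  shows "inj_on h (carrier T)"
proof -
  interpret h: algebra_hom T A h by (rule hom)
  have key: "z = \<zero>\<^bsub>T\<^esub>" if "finite Y" "Y \<subseteq> X" "z \<in> lin_span T (b ` Y)" "h z = \<zero>" for Y z
    using that
  proof (induct Y arbitrary: z)
    case empty
    from empty(2) show ?case
      by (induct rule: lin_span.induct) auto
  next
    case (insert y Y)
    then have bY: "b ` Y \<subseteq> carrier T" and yT: "b y \<in> carrier T" using b by auto
    obtain c z' where z': "z' \<in> lin_span T (b ` Y)" "z = c \<odot>\<^bsub>T\<^esub> b y \<oplus>\<^bsub>T\<^esub> z'"
      using h.A.lin_span_insert[OF bY yT] insert(5) unfolding image_insert by blast
    \<comment> \<open>The coordinate functional of \<open>b y\<close>, up to a scalar.\<close>
    define t where "t x = \<tau> (word (rev (\<beta> y)) \<otimes> h x)" for x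
    have yN: "set (\<beta> y) \<subseteq> N" using insert \<beta> by simp
    have t_add: "t (c \<odot>\<^bsub>T\<^esub> x \<oplus>\<^bsub>T\<^esub> x') = c * t x + t x'" if "x \<in> carrier T" "x' \<in> carrier T" for c x x'
      using that yN by (simp add: t_def r_distr trace_add trace_smult)
    have t_b: "t (b x) = 0 \<longleftrightarrow> x \<noteq> y" if x: "x \<in> X" for x
    proof -
      obtain s where "s \<noteq> 0" "h (b x) = s \<odot> word (\<beta> x)"
        using \<beta>(2)[OF x] by (auto simp: proportional_def)
      then have "t (b x) = 0 \<longleftrightarrow> \<tau> (word (rev (\<beta> y)) \<otimes> word (\<beta> x)) = 0"
        using yN \<beta>(1)[OF x] by (simp add: t_def trace_smult)
      then show ?thesis
        using trace_pairing_eq_zero_iff[OF yN \<beta>(1)[OF x]] inj x insert(4) by (auto simp: inj_on_def)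
    qed
    have "t z' = 0" using z'(1)
    proof induct
      case zero
      have "t \<zero>\<^bsub>T\<^esub> = 0 * t \<zero>\<^bsub>T\<^esub>"
        using yN trace_smult[of \<zero> 0] by (simp add: t_def)
      then show ?case by simp
    next
      case (step x x' d)
      then have "x \<in> carrier T" "x' \<in> carrier T" using bY h.A.lin_span_closed by blast+
      moreover obtain w where "w \<in> Y" "x = b w" using step by blast
      ultimately show ?case using step t_add t_b[of w] insert by auto
    qed
    moreover have z'c: "z' \<in> carrier T" using z' bY h.A.lin_span_closed by blast
    moreover have "t z = 0"
      using insert(6) yN trace_smult[of \<zero> 0] by (simp add: t_def)
    ultimately have "c * t (b y) = 0" using t_add[OF yT z'c, of c] z'(2) by simp
    then have "c = 0" using t_b[of y] insert by simp
    then have "z = z'" using z' z'c yT by simp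
    then show ?case using insert z'(1) by blast
  qed
  have "a_kernel T A h = {\<zero>\<^bsub>T\<^esub>}"
    using key[OF fin] span by (auto simp: a_kernel_def')
  then show ?thesis
    using ring_hom_ring.trivial_ker_imp_inj[OF h.ring_hom_ring] by blast
qed

end

section \<open>Orthonormal bases and the twisted block algebras\<close>

context clifford_space
begin

lemma gen_lin_span:
  assumes "b ` J \<subseteq> W" "w \<in> span (b ` J)"
  shows "gen w \<in> lin_span Cl ((\<lambda>j. gen (b j)) ` J)"
proof -
  have "w \<in> W \<and> gen w \<in> lin_span Cl ((\<lambda>j. gen (b j)) ` J)"
    using assms(2)
  proof (induct rule: span_induct_alt)
    case base
    have "gen (scale 0 0) = \<zero>\<^bsub>Cl\<^esub>"
      using subspace by (subst gen_scale) (simp_all add: subspace_0)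
    then show ?case
      using subspace by (simp add: subspace_0 lin_span.zero)
  next
    case (step c x y)
    then obtain j where "j \<in> J" "x = b j" "x \<in> W" using assms by blast
    then show ?case
      using step subspace by (auto simp: gen_add gen_scale subspace_add subspace_scale intro: lin_span.step)
  qed
  then show ?thesis by simp
qed

text \<open>
  Expanding every factor in the basis preserves the number of factors, hence also the
  decomposition into even and odd parts.
\<close>

lemma gen_prod_lin_span:
  assumes "b ` J \<subseteq> W" "set ws \<subseteq> span (b ` J)"
  shows "alg_prod Cl (map gen ws) \<in>
    lin_span Cl {alg_prod Cl (map (\<lambda>j. gen (b j)) us) | us. set us \<subseteq> J \<and> length us = length ws}"
  using assms(2)
proof (induct ws)
  case Nil
  show ?case
    by (rule lin_span_base) auto
next
  case (Cons w ws)
  let ?S = "\<lambda>l. {alg_prod Cl (map (\<lambda>j. gen (b j)) us) | us. set us \<subseteq> J \<and> length us = l}"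
  have closed: "?S l \<subseteq> carrier Cl" for l
    using assms(1) by (auto intro!: alg_prod_closed gen_closed simp: image_subset_iff subset_iff)
  have "gen w \<otimes>\<^bsub>Cl\<^esub> alg_prod Cl (map gen ws) \<in> lin_span Cl (?S (Suc (length ws)))"
  proof (rule lin_span_mult[of "(\<lambda>j. gen (b j)) ` J" "?S (length ws)"])
    fix x y assume "x \<in> (\<lambda>j. gen (b j)) ` J" "y \<in> ?S (length ws)"
    then obtain j us where "j \<in> J" "x = gen (b j)" "set us \<subseteq> J" "length us = length ws"
      "y = alg_prod Cl (map (\<lambda>j. gen (b j)) us)" by blast
    then have "x \<otimes>\<^bsub>Cl\<^esub> y \<in> ?S (Suc (length ws))"
      by (intro CollectI exI[of _ "j # us"]) simp
    then show "x \<otimes>\<^bsub>Cl\<^esub> y \<in> lin_span Cl (?S (Suc (length ws)))"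
      by (rule lin_span_base[OF closed])
  qed (use closed assms Cons gen_lin_span[OF assms(1)] in auto)
  then show ?case by simp
qed

lemma anticommuting_gen:
  assumes "b ` J \<subseteq> W" "\<And>j. j \<in> J \<Longrightarrow> f (b j) = 1"
    and "\<And>i j. i \<in> J \<Longrightarrow> j \<in> J \<Longrightarrow> i \<noteq> j \<Longrightarrow> polar f (b i) (b j) = 0"
  shows "anticommuting Cl (\<lambda>j. gen (b j)) J"
proof unfold_locales
  show "gen (b j) \<in> carrier Cl" if "j \<in> J" for j
    using that assms by auto
  show "gen (b j) \<otimes>\<^bsub>Cl\<^esub> gen (b j) = \<one>\<^bsub>Cl\<^esub>" if "j \<in> J" for j
    using that assms by (auto simp: gen_square)
  fix i j assume ij: "i \<in> J" "j \<in> J" "i \<noteq> j"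
  then have W: "b i \<in> W" "b j \<in> W" using assms by auto
  let ?x = "gen (b i) \<otimes>\<^bsub>Cl\<^esub> gen (b j)" and ?y = "gen (b j) \<otimes>\<^bsub>Cl\<^esub> gen (b i)"
  have "?x \<oplus>\<^bsub>Cl\<^esub> ?y = \<zero>\<^bsub>Cl\<^esub>"
    using gen_anticommutator[OF W] assms(3)[OF ij] by simp
  then show "?x = (-1) \<odot>\<^bsub>Cl\<^esub> ?y"
    using W by (metis gen_closed m_closed minus_equality smult_minus_one)
qed

end

text \<open>
  The situation of the theorem after orthonormality has been translated into values of $f$.
\<close>

locale orthonormal_clifford = full?: clifford_space scale f UNIV
  for scale :: "'k :: alg_closed_field \<Rightarrow> 'v :: ab_group_add \<Rightarrow> 'v" and f :: "'v \<Rightarrow> 'k" +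
  fixes v :: "nat \<Rightarrow> 'v" and n :: "nat \<Rightarrow> nat"
  assumes two: "(2 :: 'k) \<noteq> 0"
    and basis: "full.span (v ` {1..}) = UNIV"
    and f_v: "i \<ge> 1 \<Longrightarrow> f (v i) = 1"
    and polar_v: "i \<ge> 1 \<Longrightarrow> j \<ge> 1 \<Longrightarrow> i \<noteq> j \<Longrightarrow> polar f (v i) (v j) = 0"
    and n_zero: "n 0 = 0" and n_mono: "strict_mono n" and n_even: "even (n i)"
begin

abbreviation "C \<equiv> clifford scale UNIV f"
abbreviation "g \<equiv> clifford_gen scale UNIV f"
abbreviation "e \<equiv> \<lambda>j. g (v j)"

sublocale anticommuting C e "{1..}"
  by (rule full.anticommuting_gen) (auto simp: f_v polar_v)

sublocale traced_anticommuting C e "{1..}" full.trace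
proof unfold_locales
  fix us :: "nat list" assume us: "us \<noteq> []" "distinct us" "set us \<subseteq> {1..}"
  then obtain j js where "us = j # js" by (cases us) auto
  then show "full.trace (word us) = 0"
    using full.trace_orthogonal_word[OF two, of "v j" "map v js"] us polar_v
    by (auto simp: word_def comp_def subset_iff simp del: foldr.simps)
qed (simp_all add: full.trace_add full.trace_smult full.trace_one two)

text \<open>
  The indices of the basis vectors of $V_i$.
\<close>

definition block_indices :: "nat \<Rightarrow> nat set" where "block_indices i = {n (i - 1) + 1..n i}"

text \<open>
  The letters of $c_i$.
\<close>

definition initial_word :: "nat \<Rightarrow> nat list" where "initial_word i = [1..<n i + 1]"

lemma initial_word_simps [simp]: "set (initial_word i) = {1..n i}" "distinct (initial_word i)" "length (initial_word i) = n i"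
  by (auto simp: initial_word_def simp del: upt_Suc)

text \<open>
  The letters of the basis element of $A_i$ attached to a subset of the indices of $V_i$.
\<close>

definition block_word :: "nat \<Rightarrow> nat set \<Rightarrow> nat list" where
  "block_word i S = (if odd (card S) then initial_word i else []) @ sorted_list_of_set S"

text \<open>
  The algebra $A_i$, described by a basis. This description is uniform in $i$; that it agrees with
  the definition of $A_i$, also for $i=1$, is \<open>block_alg_eq\<close>.
\<close>

definition twisted :: "nat \<Rightarrow> ('v list \<Rightarrow>\<^sub>0 'k) set set" where
  "twisted i = lin_span C {word (block_word i S) | S. S \<subseteq> block_indices i}"

lemma finite_block_indices [simp]: "finite (block_indices i)" and block_indices_pos: "block_indices i \<subseteq> {1..}" and block_indices_le: "block_indices i \<subseteq> {1..n i}"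
  by (auto simp: block_indices_def)

lemma subset_block_indices_props: 
  assumes "S \<subseteq> block_indices i" 
  shows "finite S" "S \<subseteq> {1..}" "set (sorted_list_of_set S) = S" "set (block_word i S) \<subseteq> {1..}"
proof -
  show "finite S" using assms finite_subset finite_block_indices by blast
  then show "set (sorted_list_of_set S) = S" by simp
  show "S \<subseteq> {1..}" using assms block_indices_pos by blast
  then show "set (block_word i S) \<subseteq> {1..}" using \<open>finite S\<close> by (auto simp: block_word_def)
qed

lemma odd_letters_initial_word: "odd_letters (initial_word i) = {1..n i}"
  by (subst odd_letters_distinct) auto

lemma odd_letters_sorted: "S \<subseteq> block_indices i \<Longrightarrow> odd_letters (sorted_list_of_set S) = S"
  by (subst odd_letters_distinct) (auto simp: subset_block_indices_props)

lemma odd_letters_block_word: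
  "S \<subseteq> block_indices i \<Longrightarrow> odd_letters (block_word i S) = (if odd (card S) then {1..n i} - S else S)"
  using block_indices_le[of i] by (auto simp: block_word_def odd_letters_initial_word odd_letters_sorted)

text \<open>
  Within the block, the word of \<open>S\<close> has odd set \<open>S\<close> or its complement according to the parity of \<open>S\<close>.
  The block has an even number of indices, so complements preserve parity; hence a subset and the
  complement of another one are never confused.
\<close>

lemma inj_on_block_word: "inj_on (\<lambda>S. odd_letters (block_word i S) \<inter> block_indices i) (Pow (block_indices i))"
proof (rule inj_onI, clarify)
  fix S T assume ST: "S \<subseteq> block_indices i" "T \<subseteq> block_indices i" "odd_letters (block_word i S) \<inter> block_indices i = odd_letters (block_word i T) \<inter> block_indices i"
  have *: "(if odd (card S) then block_indices i - S else S) = (if odd (card T) then block_indices i - T else T)"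
    using ST block_indices_le[of i] by (auto simp: odd_letters_block_word split: if_splits)
  have "even (card (block_indices i))" using n_even by (simp add: block_indices_def)
  then have "even (card (block_indices i - S)) = even (card S)" if "S \<subseteq> block_indices i" for S
    using that card_mono[OF finite_block_indices that] by (simp add: card_Diff_subset subset_block_indices_props)
  then have "even (card S) = even (card T)"
    using * ST by (metis (full_types))
  then show "S = T"
    using * ST by (auto split: if_splits)
qed

lemma e_block_word_words: "{word (block_word i S) | S. S \<subseteq> block_indices i} \<subseteq> carrier C"
  using subset_block_indices_props(4) by (blast intro: word_closed)

lemma sorted_words_closed: "{word (sorted_list_of_set S) | S. S \<subseteq> block_indices i \<and> P S} \<subseteq> carrier C"
proof -
  have "word (sorted_list_of_set S) \<in> carrier C" if "S \<subseteq> block_indices i" for S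
    using subset_block_indices_props[OF that] by (intro word_closed) simp
  then show ?thesis by blast
qed

lemma twisted_closed: "twisted i \<subseteq> carrier C"
  using lin_span_closed[OF e_block_word_words] unfolding twisted_def by blast

lemma initial_word_square: "\<exists>s. s \<noteq> 0 \<and> word (initial_word i) \<otimes>\<^bsub>C\<^esub> word (initial_word i) = s \<odot>\<^bsub>C\<^esub> \<one>\<^bsub>C\<^esub>"
proof -
  have "proportional C (word (initial_word i @ initial_word i)) \<one>\<^bsub>C\<^esub>"
    by (rule word_proportional_one) auto
  then show ?thesis
    by (simp add: word_append proportional_def)
qed

lemma length_filter_neq:
  assumes "distinct us"
  shows "length (filter (\<lambda>i. i \<noteq> j) us) = (if j \<in> set us then length us - 1 else length us)"
  using assms
proof (induct us)
  case (Cons u us)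
  then show ?case by (cases us) auto
qed simp

lemma e_initial_word:
  assumes "1 \<le> k" "k \<le> n i"
  shows "e k \<otimes>\<^bsub>C\<^esub> word (initial_word i) = (-1) \<odot>\<^bsub>C\<^esub> (word (initial_word i) \<otimes>\<^bsub>C\<^esub> e k)"
proof -
  have "odd (n i - 1)" using n_even[of i] assms by simp
  moreover have "length (filter (\<lambda>i. i \<noteq> k) (initial_word i)) = n i - 1"
    using length_filter_neq[of "initial_word i" k] assms by simp
  ultimately show ?thesis
    using e_word[of k "initial_word i"] assms by simp
qed

lemma lin_span_initial_word:
  assumes "x \<in> lin_span C (e ` block_indices i)"
  shows "x \<otimes>\<^bsub>C\<^esub> word (initial_word i) = (-1) \<odot>\<^bsub>C\<^esub> (word (initial_word i) \<otimes>\<^bsub>C\<^esub> x)"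
  using assms
proof induct
  case zero
  show ?case by simp
next
  case (step x y c)
  then obtain k where k: "k \<in> block_indices i" "x = e k" by blast
  have "e ` block_indices i \<subseteq> carrier C" using block_indices_pos by auto
  then have "y \<in> carrier C" using step lin_span_closed by blast
  moreover have "e k \<otimes>\<^bsub>C\<^esub> word (initial_word i) = (-1) \<odot>\<^bsub>C\<^esub> (word (initial_word i) \<otimes>\<^bsub>C\<^esub> e k)"
    using e_initial_word k block_indices_le[of i] by auto
  ultimately show ?case
    using step k block_indices_pos[of i] by (simp add: l_distr r_distr smult_add_right mult.commute)
qed

lemma block_eq: "block scale v n i = full.span (v ` block_indices i)"
  by (simp add: block_def block_indices_def)

lemma block_clifford: "clifford_space scale f (block scale v n i)"
  by unfold_locales (simp_all add: full.quadratic block_eq)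

text \<open>
  The homomorphism induced by $w\mapsto\lambda c_iw$. On a product of $k$ vectors it is, up to a scalar,
  multiplication by $c_i^k$, and $c_i^2$ is a scalar; so only the parity of $k$ counts.
\<close>

lemma twisted_embedding:
  obtains h where "algebra_hom (clifford scale (block scale v n i) f) C h"
    "inj_on h (carrier (clifford scale (block scale v n i) f))"
    "h ` carrier (clifford scale (block scale v n i) f) = twisted i"
proof -
  let ?W = "block scale v n i"
  interpret B: clifford_space scale f ?W by (rule block_clifford)
  have vJ: "v ` block_indices i \<subseteq> ?W" by (auto simp: block_eq intro: full.span_base)
  obtain s where s: "s \<noteq> 0" "word (initial_word i) \<otimes>\<^bsub>C\<^esub> word (initial_word i) = s \<odot>\<^bsub>C\<^esub> \<one>\<^bsub>C\<^esub>"
    using initial_word_square by blast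
  \<comment> \<open>The only use of algebraic closedness; it makes the square of \<open>\<phi> w\<close> equal to \<open>f w\<close>.\<close>
  obtain l :: 'k where "l ^ 2 = - inverse s"
    using nth_root_exists[of 2 "- inverse s"] by auto
  then have l: "l * l * s = - 1" "l \<noteq> 0" using s by (auto simp: power2_eq_square)
  let ?c = "word (initial_word i)"
  have c: "?c \<in> carrier C" by simp
  define \<phi> where "\<phi> w = l \<odot>\<^bsub>C\<^esub> (?c \<otimes>\<^bsub>C\<^esub> g w)" for w
  have gw: "g w \<in> carrier C" for w by simp
  have sq: "\<phi> w \<otimes>\<^bsub>C\<^esub> \<phi> w = f w \<odot>\<^bsub>C\<^esub> \<one>\<^bsub>C\<^esub>" if "w \<in> ?W" for w
  proof -
    have gc: "g w \<otimes>\<^bsub>C\<^esub> ?c = (-1) \<odot>\<^bsub>C\<^esub> (?c \<otimes>\<^bsub>C\<^esub> g w)"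
      using that by (intro lin_span_initial_word full.gen_lin_span) (auto simp: block_eq)
    have "\<phi> w \<otimes>\<^bsub>C\<^esub> \<phi> w = (l * l) \<odot>\<^bsub>C\<^esub> (?c \<otimes>\<^bsub>C\<^esub> (g w \<otimes>\<^bsub>C\<^esub> ?c) \<otimes>\<^bsub>C\<^esub> g w)"
      using c gw by (simp add: \<phi>_def m_assoc)
    also have "\<dots> = (- (l * l)) \<odot>\<^bsub>C\<^esub> ((?c \<otimes>\<^bsub>C\<^esub> ?c) \<otimes>\<^bsub>C\<^esub> (g w \<otimes>\<^bsub>C\<^esub> g w))"
      unfolding gc using c gw by (simp add: m_assoc)
    also have "\<dots> = (- (l * l * s * f w)) \<odot>\<^bsub>C\<^esub> \<one>\<^bsub>C\<^esub>"
      unfolding s(2) by (simp add: full.gen_square mult_ac)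
    finally show ?thesis using l by simp
  qed
  obtain h where h: "algebra_hom B.Cl C h" "\<And>w. w \<in> ?W \<Longrightarrow> h (B.gen w) = \<phi> w"
  proof (rule B.clifford_lift[of C \<phi>])
    show "unital_algebra C" by (rule full.algebra)
    show "\<phi> w \<in> carrier C" for w using c gw by (simp add: \<phi>_def)
    show "\<phi> (w + w') = \<phi> w \<oplus>\<^bsub>C\<^esub> \<phi> w'" for w w'
      using c gw by (simp add: \<phi>_def full.gen_add r_distr smult_add_right)
    show "\<phi> (scale a w) = a \<odot>\<^bsub>C\<^esub> \<phi> w" for a w
      using c gw by (simp add: \<phi>_def full.gen_scale mult.commute)
  qed (use sq in auto)
  interpret h: algebra_hom B.Cl C h by (rule h)
  interpret E: anticommuting B.Cl "\<lambda>j. B.gen (v j)" "block_indices i"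
    by (rule B.anticommuting_gen[OF vJ]) (use block_indices_pos[of i] in \<open>simp_all add: f_v polar_v subset_iff\<close>)
  have h_word: "proportional C (h (E.word us)) (word ((if odd (length us) then initial_word i else []) @ us))"
    if "set us \<subseteq> block_indices i" for us
    using that
  proof (induct us)
    case Nil
    show ?case by (simp add: proportional_refl)
  next
    case (Cons u us)
    let ?us = "(if odd (length us) then initial_word i else []) @ us"
    have u: "u \<in> block_indices i" "set us \<subseteq> block_indices i" "u \<ge> 1" "set us \<subseteq> {1..}" using Cons block_indices_pos[of i] by auto
    have "h (E.word (u # us)) = \<phi> (v u) \<otimes>\<^bsub>C\<^esub> h (E.word us)"
      using u h(2)[of "v u"] vJ by auto
    moreover have "proportional C (\<phi> (v u)) (word (initial_word i @ [u]))"
      using u by (simp add: \<phi>_def word_append proportional_smult l)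
    ultimately have "proportional C (h (E.word (u # us))) (word (initial_word i @ [u]) \<otimes>\<^bsub>C\<^esub> word ?us)"
      using Cons u by (auto intro!: proportional_mult word_closed)
    moreover have "word (initial_word i @ [u]) \<otimes>\<^bsub>C\<^esub> word ?us = word ((initial_word i @ [u]) @ ?us)"
      using u by (intro word_append[symmetric]) auto
    moreover have "proportional C (word ((initial_word i @ [u]) @ ?us)) (word ((if odd (length (u # us)) then initial_word i else []) @ [u] @ us))"
      using u by (intro word_proportional) auto
    ultimately show ?case
      using u proportional_trans[of "word ((if odd (length (u # us)) then initial_word i else []) @ [u] @ us)"]
      by (auto intro!: word_closed)
  qed
  define b where "b S = E.word (sorted_list_of_set S)" for S
  have b_closed: "b ` Pow (block_indices i) \<subseteq> carrier B.Cl"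
    using subset_block_indices_props by (auto simp: b_def)
  have h_b: "proportional C (h (b S)) (word (block_word i S))" if "S \<subseteq> block_indices i" for S
    using h_word[of "sorted_list_of_set S"] that subset_block_indices_props[OF that] by (simp add: b_def block_word_def)
  have span: "carrier B.Cl \<subseteq> lin_span B.Cl (b ` Pow (block_indices i))"
  proof -
    have "E.word us \<in> lin_span B.Cl (b ` Pow (block_indices i))" if "set us \<subseteq> block_indices i" for us
    proof -
      have o: "odd_letters us \<subseteq> block_indices i" by (rule order_trans[OF odd_letters_subset that])
      have "b (odd_letters us) \<in> lin_span B.Cl (b ` Pow (block_indices i))"
        using o b_closed by (intro B.lin_span_base) auto
      moreover have "proportional B.Cl (E.word us) (b (odd_letters us))"
        unfolding b_def using that o subset_block_indices_props(3)[OF o] odd_letters_sorted[OF o] by (intro E.word_proportional) auto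
      ultimately show ?thesis using B.proportional_lin_span[OF b_closed] by blast
    qed
    then have *: "lin_span B.Cl {E.word us | us. set us \<subseteq> block_indices i \<and> length us = k} \<subseteq> lin_span B.Cl (b ` Pow (block_indices i))" for k
      using b_closed by (intro B.lin_span_subset) auto
    have "alg_prod B.Cl (map B.gen ws) \<in> lin_span B.Cl (b ` Pow (block_indices i))" if "set ws \<subseteq> ?W" for ws
      using B.gen_prod_lin_span[OF vJ that[unfolded block_eq], folded E.word_def] *[of "length ws"] by blast
    then show ?thesis
      unfolding B.carrier_eq_lin_span using b_closed by (intro B.lin_span_subset) auto
  qed
  have inj: "inj_on (\<lambda>S. odd_letters (block_word i S)) (Pow (block_indices i))"
    using inj_on_block_word[of i] unfolding inj_on_def by metis
  show thesis
  proof
    show "algebra_hom B.Cl C h" by (rule h)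
    show "inj_on h (carrier B.Cl)"
      by (rule inj_on_if_basis_to_words[OF h(1) _ b_closed span _ _ inj])
        (use subset_block_indices_props(4) h_b in \<open>simp_all del: atLeast_iff\<close>)
    have "h ` carrier B.Cl = h ` lin_span B.Cl (b ` Pow (block_indices i))"
      using span B.lin_span_closed[OF b_closed] by blast
    also have "\<dots> = lin_span C (h ` b ` Pow (block_indices i))" by (rule h.image_lin_span[OF b_closed])
    also have "\<dots> = twisted i"
    proof
      have c1: "h ` b ` Pow (block_indices i) \<subseteq> carrier C" using b_closed h.closed by blast
      have "h (b S) \<in> twisted i" if "S \<subseteq> block_indices i" for S
        unfolding twisted_def by (rule proportional_lin_span[OF e_block_word_words _ h_b[OF that]])
          (use that e_block_word_words in \<open>auto intro!: lin_span_base\<close>)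
      then show "lin_span C (h ` b ` Pow (block_indices i)) \<subseteq> twisted i"
        unfolding twisted_def using e_block_word_words by (intro lin_span_subset) (auto simp: twisted_def)
      have "word (block_word i S) \<in> lin_span C (h ` b ` Pow (block_indices i))" if "S \<subseteq> block_indices i" for S
      proof (rule proportional_lin_span[OF c1])
        show "h (b S) \<in> lin_span C (h ` b ` Pow (block_indices i))" using c1 that by (intro lin_span_base) auto
        show "proportional C (word (block_word i S)) (h (b S))"
          by (rule proportional_sym[OF word_closed[OF subset_block_indices_props(4)[OF that]] h_b[OF that]])
      qed
      then show "twisted i \<subseteq> lin_span C (h ` b ` Pow (block_indices i))"
        unfolding twisted_def using c1 by (intro lin_span_subset) auto
    qed
    finally show "h ` carrier B.Cl = twisted i" .
  qed
qed


lemma twisted_subalg: "subalg (twisted i) C"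
  by (rule twisted_embedding[of i]) (metis algebra_hom.image_subalg)

lemma twisted_isomorphic:
  "alg_isomorphic (C\<lparr>carrier := twisted i\<rparr>) (clifford scale (block scale v n i) f)"
  by (rule twisted_embedding[of i]) (metis algebra_hom.alg_isomorphic_image)

lemma even_words_lin_span:
  "lin_span C {alg_prod C (map g ws) | ws. set ws \<subseteq> full.span (v ` block_indices i) \<and> even (length ws) = p}
   = lin_span C {word (sorted_list_of_set S) | S. S \<subseteq> block_indices i \<and> even (card S) = p}"
  (is "lin_span C ?X = lin_span C ?Y")
proof
  have X: "?X \<subseteq> carrier C" by (auto intro!: alg_prod_closed)
  have Y: "?Y \<subseteq> carrier C" by (rule sorted_words_closed)
  have "word us \<in> lin_span C ?Y" if us: "set us \<subseteq> block_indices i" "even (length us) = p" for us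
  proof -
    have o: "odd_letters us \<subseteq> block_indices i" by (rule order_trans[OF odd_letters_subset us(1)])
    have "word (sorted_list_of_set (odd_letters us)) \<in> lin_span C ?Y"
      using o us by (intro lin_span_base[OF Y]) (auto simp: even_card_odd_letters)
    moreover have "proportional C (word us) (word (sorted_list_of_set (odd_letters us)))"
      using us block_indices_pos[of i] subset_block_indices_props[OF o] odd_letters_sorted[OF o] by (intro word_proportional) auto
    ultimately show ?thesis by (rule proportional_lin_span[OF Y])
  qed
  then have *: "lin_span C {word us | us. set us \<subseteq> block_indices i \<and> length us = k} \<subseteq> lin_span C ?Y" if "even k = p" for k
    using that by (intro lin_span_subset[OF Y]) auto
  have "alg_prod C (map g ws) \<in> lin_span C ?Y" if "set ws \<subseteq> full.span (v ` block_indices i)" "even (length ws) = p" for ws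
    using gen_prod_lin_span[OF _ that(1), folded word_def] *[of "length ws"] that(2) by blast
  then show "lin_span C ?X \<subseteq> lin_span C ?Y"
    by (intro lin_span_subset[OF Y]) auto
  have "word (sorted_list_of_set S) \<in> ?X" if "S \<subseteq> block_indices i" "even (card S) = p" for S
    using that subset_block_indices_props[OF that(1)]
    by (intro CollectI exI[of _ "map v (sorted_list_of_set S)"])
      (auto simp: word_def comp_def intro: full.span_base)
  then show "lin_span C ?Y \<subseteq> lin_span C ?X"
    by (intro lin_span_mono[OF X]) auto
qed

lemma clifford_even_block:
  "clifford_even scale f (block scale v n i) = lin_span C {word (sorted_list_of_set S) | S. S \<subseteq> block_indices i \<and> even (card S)}"
  using even_words_lin_span[of i True] by (simp add: clifford_even_def block_eq)

lemma clifford_odd_block: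
  "clifford_odd scale f (block scale v n i) = lin_span C {word (sorted_list_of_set S) | S. S \<subseteq> block_indices i \<and> odd (card S)}"
  using even_words_lin_span[of i False] by (simp add: clifford_odd_def block_eq)

lemma block_c_eq: "block_c scale f v n i = word (initial_word i)"
  by (simp add: block_c_def word_def initial_word_def del: upt_Suc)

lemma word_block_word:
  assumes "S \<subseteq> block_indices i"
  shows "word (block_word i S) = (if odd (card S) then word (initial_word i) \<otimes>\<^bsub>C\<^esub> word (sorted_list_of_set S)
    else word (sorted_list_of_set S))"
  using subset_block_indices_props[OF assms] by (simp add: block_word_def word_append)

lemma even_plus_twisted_odd:
  "clifford_even scale f (block scale v n i) <+>\<^bsub>C\<^esub>
     (block_c scale f v n i <#\<^bsub>C\<^esub> clifford_odd scale f (block scale v n i)) = twisted i"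
  (is "?E <+>\<^bsub>C\<^esub> (_ <#\<^bsub>C\<^esub> ?O) = _")
proof
  let ?SE = "{word (sorted_list_of_set S) | S. S \<subseteq> block_indices i \<and> even (card S)}"
  let ?SO = "{word (sorted_list_of_set S) | S. S \<subseteq> block_indices i \<and> odd (card S)}"
  have c: "word (initial_word i) \<in> carrier C" by simp
  have closed: "?SE \<subseteq> carrier C" "?SO \<subseteq> carrier C"
    by (rule sorted_words_closed)+
  have E: "?E = lin_span C ?SE" and O: "?O = lin_span C ?SO"
    by (rule clifford_even_block clifford_odd_block)+
  have E_twisted: "x \<in> twisted i" if "x \<in> ?E" for x
  proof -
    have "word (sorted_list_of_set S) = word (block_word i S)" if "S \<subseteq> block_indices i" "even (card S)" for S
      using that by (simp add: word_block_word)
    then have "?SE \<subseteq> {word (block_word i S) | S. S \<subseteq> block_indices i}" by blast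
    then have "lin_span C ?SE \<subseteq> twisted i"
      unfolding twisted_def by (rule lin_span_mono[OF e_block_word_words])
    then show ?thesis using that unfolding E by (rule subsetD)
  qed
  have O_twisted: "word (initial_word i) \<otimes>\<^bsub>C\<^esub> y \<in> twisted i" if "y \<in> ?O" for y
    unfolding twisted_def
  proof (rule lin_span_mult[of "{word (initial_word i)}" ?SO])
    show "word (initial_word i) \<in> lin_span C {word (initial_word i)}" using c by (intro lin_span_base) auto
    show "y \<in> lin_span C ?SO" using that O by simp
    fix x z assume "x \<in> {word (initial_word i)}" "z \<in> ?SO"
    then obtain S where S: "S \<subseteq> block_indices i" "odd (card S)" "x = word (initial_word i)" "z = word (sorted_list_of_set S)"
      by blast
    then have "x \<otimes>\<^bsub>C\<^esub> z = word (block_word i S)" by (simp add: word_block_word)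
    then have "x \<otimes>\<^bsub>C\<^esub> z \<in> {word (block_word i S) | S. S \<subseteq> block_indices i}" using S(1) by blast
    then show "x \<otimes>\<^bsub>C\<^esub> z \<in> lin_span C {word (block_word i S) | S. S \<subseteq> block_indices i}"
      by (rule lin_span_base[OF e_block_word_words])
  qed (use c closed e_block_word_words in auto)
  show "?E <+>\<^bsub>C\<^esub> (block_c scale f v n i <#\<^bsub>C\<^esub> ?O) \<subseteq> twisted i"
  proof
    fix x assume "x \<in> ?E <+>\<^bsub>C\<^esub> (block_c scale f v n i <#\<^bsub>C\<^esub> ?O)"
    then obtain a b where ab: "a \<in> ?E" "b \<in> ?O" "x = a \<oplus>\<^bsub>C\<^esub> word (initial_word i) \<otimes>\<^bsub>C\<^esub> b"
      unfolding set_add_def' l_coset_def block_c_eq by blast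
    show "x \<in> twisted i"
      unfolding ab(3) twisted_def
      by (rule lin_span_add[OF e_block_word_words E_twisted[OF ab(1), unfolded twisted_def] O_twisted[OF ab(2), unfolded twisted_def]])
  qed
  show "twisted i \<subseteq> ?E <+>\<^bsub>C\<^esub> (block_c scale f v n i <#\<^bsub>C\<^esub> ?O)"
  proof
    fix x assume "x \<in> twisted i"
    then have "\<exists>a\<in>?E. \<exists>b\<in>?O. x = a \<oplus>\<^bsub>C\<^esub> word (initial_word i) \<otimes>\<^bsub>C\<^esub> b"
      unfolding twisted_def
    proof induct
      case zero
      show ?case
        by (intro bexI[of _ "\<zero>\<^bsub>C\<^esub>"]) (simp_all add: E O lin_span.zero)
    next
      case (step x y d)
      then obtain S a b where S: "S \<subseteq> block_indices i" "x = word (block_word i S)"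
        and ab: "a \<in> ?E" "b \<in> ?O" "y = a \<oplus>\<^bsub>C\<^esub> word (initial_word i) \<otimes>\<^bsub>C\<^esub> b" by blast
      let ?w = "word (sorted_list_of_set S)"
      have carr: "a \<in> carrier C" "b \<in> carrier C" "?w \<in> carrier C"
        using ab E O lin_span_closed[OF closed(1)] lin_span_closed[OF closed(2)] subset_block_indices_props[OF S(1)]
        by (simp_all add: word_closed)
      show ?case
      proof (cases "odd (card S)")
        case True
        then have "d \<odot>\<^bsub>C\<^esub> ?w \<oplus>\<^bsub>C\<^esub> b \<in> ?O" using ab S unfolding O by (blast intro: lin_span.step)
        moreover have "d \<odot>\<^bsub>C\<^esub> x \<oplus>\<^bsub>C\<^esub> y = a \<oplus>\<^bsub>C\<^esub> word (initial_word i) \<otimes>\<^bsub>C\<^esub> (d \<odot>\<^bsub>C\<^esub> ?w \<oplus>\<^bsub>C\<^esub> b)"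
          using True S ab carr c by (simp add: word_block_word r_distr a_lcomm)
        ultimately show ?thesis using ab by blast
      next
        case False
        then have "d \<odot>\<^bsub>C\<^esub> ?w \<oplus>\<^bsub>C\<^esub> a \<in> ?E" using ab S unfolding E by (blast intro: lin_span.step)
        moreover have "d \<odot>\<^bsub>C\<^esub> x \<oplus>\<^bsub>C\<^esub> y = (d \<odot>\<^bsub>C\<^esub> ?w \<oplus>\<^bsub>C\<^esub> a) \<oplus>\<^bsub>C\<^esub> word (initial_word i) \<otimes>\<^bsub>C\<^esub> b"
          using False S ab carr c by (simp add: word_block_word a_assoc)
        ultimately show ?thesis using ab by blast
      qed
    qed
    then show "x \<in> ?E <+>\<^bsub>C\<^esub> (block_c scale f v n i <#\<^bsub>C\<^esub> ?O)"
      unfolding set_add_def' l_coset_def block_c_eq by blast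
  qed
qed

lemma n_le: "i \<le> j \<Longrightarrow> n i \<le> n j"
  using n_mono by (simp add: strict_mono_less_eq)

lemma word_in_twisted:
  assumes "S \<subseteq> block_indices i" "set us \<subseteq> {1..}" "odd_letters us = odd_letters (block_word i S)"
  shows "word us \<in> twisted i"
  unfolding twisted_def
proof (rule proportional_lin_span[OF e_block_word_words])
  show "word (block_word i S) \<in> lin_span C {word (block_word i S) | S. S \<subseteq> block_indices i}"
    using assms(1) by (intro lin_span_base[OF e_block_word_words]) blast
  show "proportional C (word us) (word (block_word i S))"
    by (rule word_proportional[OF assms(2) subset_block_indices_props(4)[OF assms(1)] assms(3)])
qed

text \<open>
  Up to a scalar, a generator \<open>e u\<close> of the first block is $c_1$ times the product over all the other
  indices of the block, of which there is an odd number.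
\<close>

lemma first_block: "alg_gen C (g ` block scale v n 1) = twisted 1"
proof
  let ?W = "block scale v n 1"
  have J1: "block_indices 1 = {1..n 1}" by (simp add: block_indices_def n_zero)
  have e: "e u \<in> twisted 1" if u: "u \<in> block_indices 1" for u
  proof -
    have "card (block_indices 1 - {u}) = n 1 - 1" using u J1 by simp
    then have "odd (card (block_indices 1 - {u}))" using u J1 n_even[of 1] by (cases "n 1") auto
    then have "odd_letters (block_word 1 (block_indices 1 - {u})) = {1..n 1} - (block_indices 1 - {u})"
      unfolding odd_letters_block_word[OF Diff_subset] by (rule if_P)
    also have "\<dots> = {u}" using u J1 by blast
    finally have "word [u] \<in> twisted 1"
      using u block_indices_pos by (intro word_in_twisted[OF Diff_subset[of "block_indices 1" "{u}"]]) auto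
    moreover have "e u \<in> carrier C" by simp
    ultimately show ?thesis by simp
  qed
  have "lin_span C (e ` block_indices 1) \<subseteq> twisted 1"
    unfolding twisted_def by (rule lin_span_subset[OF e_block_word_words]) (use e in \<open>auto simp: twisted_def\<close>)
  then have "g ` ?W \<subseteq> twisted 1"
    using gen_lin_span[of v "block_indices 1"] by (auto simp: block_eq)
  then show "alg_gen C (g ` ?W) \<subseteq> twisted 1"
    using twisted_subalg unfolding alg_gen_def by blast
  have "twisted 1 \<subseteq> H" if H: "subalg H C" "g ` ?W \<subseteq> H" for H
  proof
    have H': "\<zero>\<^bsub>C\<^esub> \<in> H" "\<one>\<^bsub>C\<^esub> \<in> H" "\<And>x y. x \<in> H \<Longrightarrow> y \<in> H \<Longrightarrow> x \<otimes>\<^bsub>C\<^esub> y \<in> H"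
      "\<And>x y. x \<in> H \<Longrightarrow> y \<in> H \<Longrightarrow> x \<oplus>\<^bsub>C\<^esub> y \<in> H" "\<And>c x. x \<in> H \<Longrightarrow> c \<odot>\<^bsub>C\<^esub> x \<in> H"
      using H(1) subringE[of H C] by (auto simp: subalg_def)
    have "word us \<in> H" if "set us \<subseteq> block_indices 1" for us
      using that
    proof (induct us)
      case (Cons u us)
      then have "e u \<in> g ` ?W" by (auto simp: block_eq intro: full.span_base)
      then show ?case using Cons H(2) H' by auto
    qed (use H' in simp)
    moreover have "set (block_word 1 S) \<subseteq> block_indices 1" if "S \<subseteq> block_indices 1" for S
      using that J1 subset_block_indices_props[OF that] by (auto simp: block_word_def)
    ultimately have w: "word (block_word 1 S) \<in> H" if "S \<subseteq> block_indices 1" for S using that by blast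
    fix x assume "x \<in> twisted 1"
    then show "x \<in> H"
      unfolding twisted_def by induct (use w H' in auto)
  qed
  then show "twisted 1 \<subseteq> alg_gen C (g ` ?W)"
    unfolding alg_gen_def by blast
qed

lemma block_alg_eq: "block_alg scale f v n i = twisted i"
  using first_block even_plus_twisted_odd[of i] by (simp add: block_alg_def Let_def)

lemma set_block_word_le:
  assumes "S \<subseteq> block_indices i" shows "set (block_word i S) \<subseteq> {1..n i}"
proof -
  have "S \<subseteq> {1..n i}" by (rule order_trans[OF assms block_indices_le])
  then show ?thesis using subset_block_indices_props(3)[OF assms] by (auto simp: block_word_def)
qed

text \<open>
  An earlier index occurs in the block word exactly once if the factor $c_j$ is present and not at
  all otherwise; in both cases an even number of other letters remains.
\<close>

lemma e_block_word_commute: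
  assumes "1 \<le> k" "k \<le> n (j - 1)" "S \<subseteq> block_indices j"
  shows "e k \<otimes>\<^bsub>C\<^esub> word (block_word j S) = word (block_word j S) \<otimes>\<^bsub>C\<^esub> e k"
proof -
  have k: "k \<le> n j" "k \<notin> S" using assms n_le[of "j - 1" j] by (auto simp: block_indices_def)
  have "odd (n j - 1)" using n_even[of j] k assms by simp
  then have "even (length (filter (\<lambda>i. i \<noteq> k) (block_word j S)))"
    using k assms subset_block_indices_props[OF assms(3)] by (simp add: block_word_def length_filter_neq)
  then show ?thesis
    using e_word[of k "block_word j S"] assms subset_block_indices_props[OF assms(3)] by simp
qed

lemma block_word_commute:
  assumes "i < j" "S \<subseteq> block_indices i" "T \<subseteq> block_indices j"
  shows "word (block_word i S) \<otimes>\<^bsub>C\<^esub> word (block_word j T) = word (block_word j T) \<otimes>\<^bsub>C\<^esub> word (block_word i S)"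
  unfolding word_def[of "block_word i S"]
proof (rule alg_prod_commute)
  show "set (map e (block_word i S)) \<subseteq> carrier C" by auto
  show "word (block_word j T) \<in> carrier C" by (rule word_closed[OF subset_block_indices_props(4)[OF assms(3)]])
  have "n i \<le> n (j - 1)" using assms(1) by (intro n_le) simp
  then have set_block_word: "set (block_word i S) \<subseteq> {1..n (j - 1)}"
    using set_block_word_le[OF assms(2)] by auto
  fix x assume "x \<in> set (map e (block_word i S))"
  then obtain k where k: "k \<in> set (block_word i S)" "x = e k" unfolding set_map by (elim imageE)
  then have "1 \<le> k" "k \<le> n (j - 1)" using set_block_word by auto
  then show "x \<otimes>\<^bsub>C\<^esub> word (block_word j T) = word (block_word j T) \<otimes>\<^bsub>C\<^esub> x"
    unfolding k(2) using assms(3) by (rule e_block_word_commute)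
qed

lemma twisted_commute_less:
  assumes "i < j" "x \<in> twisted i" "y \<in> twisted j"
  shows "x \<otimes>\<^bsub>C\<^esub> y = y \<otimes>\<^bsub>C\<^esub> x"
proof -
  have y: "y \<in> carrier C" by (rule subsetD[OF twisted_closed assms(3)])
  have *: "word (block_word i S) \<otimes>\<^bsub>C\<^esub> y = y \<otimes>\<^bsub>C\<^esub> word (block_word i S)" if S: "S \<subseteq> block_indices i" for S
  proof (rule lin_span_commute[OF e_block_word_words word_closed[OF subset_block_indices_props(4)[OF S]] _ assms(3)[unfolded twisted_def], symmetric])
    fix z assume "z \<in> {word (block_word j T) | T. T \<subseteq> block_indices j}"
    then show "z \<otimes>\<^bsub>C\<^esub> word (block_word i S) = word (block_word i S) \<otimes>\<^bsub>C\<^esub> z"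
      by (elim CollectE exE conjE) (simp only: block_word_commute[OF assms(1) S])
  qed
  show ?thesis
  proof (rule lin_span_commute[OF e_block_word_words y _ assms(2)[unfolded twisted_def]])
    fix z assume "z \<in> {word (block_word i T) | T. T \<subseteq> block_indices i}"
    then show "z \<otimes>\<^bsub>C\<^esub> y = y \<otimes>\<^bsub>C\<^esub> z"
      by (elim CollectE exE conjE) (simp only: *)
  qed
qed

lemma twisted_commute:
  assumes "i \<noteq> j" "x \<in> twisted i" "y \<in> twisted j"
  shows "x \<otimes>\<^bsub>C\<^esub> y = y \<otimes>\<^bsub>C\<^esub> x"
  using twisted_commute_less[of i j x y] twisted_commute_less[of j i y x] assms by (cases "i < j") simp_all

end

section \<open>Tensor products and direct limits\<close>

text \<open>
  A finite index set, so that the coordinates of a tuple can be expanded one after the other.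
\<close>

locale tensor_product =
  fixes I :: "'i set" and A :: "'i \<Rightarrow> ('k :: field, 'a) module"
  assumes finite_I: "finite I" and algebras: "i \<in> I \<Longrightarrow> unital_algebra (A i)"
begin

abbreviation "P \<equiv> product_group I A"
abbreviation "R \<equiv> monoid_algebra P"
abbreviation "tuples \<equiv> (\<Pi>\<^sub>E i\<in>I. carrier (A i))"
abbreviation "T \<equiv> tensor I A"

lemma P_mult: "x \<otimes>\<^bsub>P\<^esub> y = (\<lambda>i\<in>I. x i \<otimes>\<^bsub>A i\<^esub> y i)" and P_one: "\<one>\<^bsub>P\<^esub> = (\<lambda>i\<in>I. \<one>\<^bsub>A i\<^esub>)"
  by (simp_all add: product_group_def)

lemma monoid_P: "monoid P"
proof (rule monoidI)
  have m: "monoid (A i)" if "i \<in> I" for i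
    using algebras[OF that] by (simp add: unital_algebra_def ring_def)
  show "x \<otimes>\<^bsub>P\<^esub> y \<in> carrier P" if "x \<in> carrier P" "y \<in> carrier P" for x y
    using that m monoid.m_closed by (fastforce simp: P_mult PiE_iff)
  show "\<one>\<^bsub>P\<^esub> \<in> carrier P"
    using m monoid.one_closed by (fastforce simp: P_one PiE_iff)
  fix x y z assume x: "x \<in> carrier P" and y: "y \<in> carrier P" and z: "z \<in> carrier P"
  show "x \<otimes>\<^bsub>P\<^esub> y \<otimes>\<^bsub>P\<^esub> z = x \<otimes>\<^bsub>P\<^esub> (y \<otimes>\<^bsub>P\<^esub> z)"
    using x y z monoid.m_assoc[OF m] by (simp add: P_mult PiE_iff fun_eq_iff restrict_def)
  show "\<one>\<^bsub>P\<^esub> \<otimes>\<^bsub>P\<^esub> x = x"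
    using x monoid.l_one[OF m] by (auto simp: P_mult P_one PiE_iff fun_eq_iff restrict_def extensional_def)
  show "x \<otimes>\<^bsub>P\<^esub> \<one>\<^bsub>P\<^esub> = x"
    using x monoid.r_one[OF m] by (auto simp: P_mult P_one PiE_iff fun_eq_iff restrict_def extensional_def)
qed

sublocale prod: monoid_alg P R
  by (intro monoid_alg.intro monoid_P)

lemma upd_closed [simp]:
  assumes "x \<in> tuples" "i \<in> I" "a \<in> carrier (A i)" shows "x(i := a) \<in> tuples"
  using assms by (auto simp: PiE_iff extensional_def)

lemma add_closed [simp]: "i \<in> I \<Longrightarrow> a \<in> carrier (A i) \<Longrightarrow> b \<in> carrier (A i) \<Longrightarrow> a \<oplus>\<^bsub>A i\<^esub> b \<in> carrier (A i)"
  by (rule abelian_monoid.a_closed[OF abelian_group.axioms(1)[OF ring.axioms(1)[OF unital_algebra.axioms(1)[OF algebras]]]])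

lemma smult_closed' [simp]: "i \<in> I \<Longrightarrow> a \<in> carrier (A i) \<Longrightarrow> c \<odot>\<^bsub>A i\<^esub> a \<in> carrier (A i)"
  by (rule unital_algebra.smult_closed[OF algebras])

lemma single_in_R [simp]: "x \<in> tuples \<Longrightarrow> Poly_Mapping.single x c \<in> carrier R"
  by simp

lemma diff_in_R: "p \<in> carrier R \<Longrightarrow> q \<in> carrier R \<Longrightarrow> p - q \<in> carrier R"
  by (simp add: keys_diff_subset)

lemma rels_closed: "tensor_rels I A \<subseteq> carrier R"
  unfolding tensor_rels_def
  by (intro Un_least subsetI; elim CollectE exE conjE; simp only:; intro diff_in_R single_in_R upd_closed add_closed smult_closed')

lemma ideal: "algebra_ideal R (tensor_ideal I A)"
  unfolding tensor_ideal_def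
  by (intro unital_algebra.algebra_ideal_genideal prod.unital_algebra rels_closed)

lemma algebra: "unital_algebra T"
  unfolding tensor_def by (rule algebra_ideal.unital_algebra_Q[OF ideal])

sublocale unital_algebra T by (rule algebra)

abbreviation "proj \<equiv> \<lambda>p. tensor_ideal I A +>\<^bsub>R\<^esub> p"

lemma proj_hom: "algebra_hom R T proj"
  unfolding tensor_def by (rule algebra_ideal.proj_hom[OF ideal])

lemma proj_rel:
  assumes "p - q \<in> tensor_rels I A" "p \<in> carrier R" "q \<in> carrier R"
  shows "proj p = proj q"
proof -
  have "p - q \<in> tensor_ideal I A"
    unfolding tensor_ideal_def
    using ring.genideal_self[OF unital_algebra.axioms(1)[OF prod.unital_algebra] rels_closed] assms(1)
    by (rule subsetD)
  then have "proj (p - q) = \<zero>\<^bsub>T\<^esub>"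
    unfolding tensor_def by (rule algebra_ideal.coset_eq_zero[OF ideal])
  moreover have "Poly_Mapping.keys p \<subseteq> carrier P" "Poly_Mapping.keys q \<subseteq> carrier P"
    using assms(2,3) by (simp_all only: monoid_algebra_sel mem_Collect_eq)
  ultimately show ?thesis
    using prod.hom_diff_eq_zero_iff[OF proj_hom, of p q] by blast
qed

definition pure :: "('i \<Rightarrow> 'a) \<Rightarrow> (('i \<Rightarrow> 'a) \<Rightarrow>\<^sub>0 'k) set" where
  "pure x = proj (Poly_Mapping.single x 1)"

lemma proj_single:
  assumes "x \<in> tuples" shows "proj (Poly_Mapping.single x c) = c \<odot>\<^bsub>T\<^esub> pure x"
proof -
  have "proj (c \<odot>\<^bsub>R\<^esub> Poly_Mapping.single x 1) = c \<odot>\<^bsub>T\<^esub> pure x"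
    unfolding pure_def by (rule algebra_hom.smult[OF proj_hom single_in_R[OF assms]])
  then show ?thesis by simp
qed

lemma pure_closed [simp]: "x \<in> tuples \<Longrightarrow> pure x \<in> carrier T"
  unfolding pure_def by (rule algebra_hom.closed[OF proj_hom single_in_R])

lemma pure_add:
  assumes "x \<in> tuples" "i \<in> I" "a \<in> carrier (A i)" "b \<in> carrier (A i)"
  shows "pure (x(i := a \<oplus>\<^bsub>A i\<^esub> b)) = pure (x(i := a)) \<oplus>\<^bsub>T\<^esub> pure (x(i := b))"
proof -
  let ?s = "\<lambda>a. Poly_Mapping.single (x(i := a)) (1 :: 'k)"
  have "?s (a \<oplus>\<^bsub>A i\<^esub> b) - (?s a + ?s b) \<in> tensor_rels I A"
    unfolding tensor_rels_def diff_diff_eq[symmetric] using assms by blast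
  moreover have "?s (a \<oplus>\<^bsub>A i\<^esub> b) \<in> carrier R" "?s a \<in> carrier R" "?s b \<in> carrier R"
    by (intro single_in_R upd_closed add_closed assms)+
  moreover have "?s a + ?s b \<in> carrier R"
    using assms by (simp add: keys_add_subset del: fun_upd_apply)
  ultimately have "pure (x(i := a \<oplus>\<^bsub>A i\<^esub> b)) = proj (?s a \<oplus>\<^bsub>R\<^esub> ?s b)"
    unfolding pure_def monoid_algebra_sel(4) by (intro proj_rel)
  also have "\<dots> = pure (x(i := a)) \<oplus>\<^bsub>T\<^esub> pure (x(i := b))"
    unfolding pure_def by (intro algebra_hom.add[OF proj_hom] single_in_R upd_closed assms)
  finally show ?thesis .
qed

lemma pure_smult:
  assumes "x \<in> tuples" "i \<in> I" "a \<in> carrier (A i)"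
  shows "pure (x(i := c \<odot>\<^bsub>A i\<^esub> a)) = c \<odot>\<^bsub>T\<^esub> pure (x(i := a))"
proof -
  have "proj (Poly_Mapping.single (x(i := c \<odot>\<^bsub>A i\<^esub> a)) 1) = proj (Poly_Mapping.single (x(i := a)) c)"
  proof (rule proj_rel)
    show "Poly_Mapping.single (x(i := c \<odot>\<^bsub>A i\<^esub> a)) 1 - Poly_Mapping.single (x(i := a)) c \<in> tensor_rels I A"
      unfolding tensor_rels_def using assms by blast
  qed (intro single_in_R upd_closed smult_closed' assms)+
  then show ?thesis
    using proj_single[OF upd_closed[OF assms]] by (simp only: pure_def[symmetric])
qed

lemma carrier_pure: "carrier T \<subseteq> lin_span T (pure ` tuples)"
proof -
  let ?S = "{Poly_Mapping.single a (1 :: 'k) | a. a \<in> carrier P}"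
  have "carrier T = proj ` carrier R"
    unfolding tensor_def by (rule algebra_ideal.quot_sel(1)[OF ideal])
  also have "\<dots> \<subseteq> proj ` lin_span R ?S"
    by (intro image_mono subsetI lin_span_monoid_algebra)
  also have "\<dots> = lin_span T (proj ` ?S)"
    by (rule algebra_hom.image_lin_span[OF proj_hom]) auto
  also have "proj ` ?S = pure ` tuples"
    unfolding pure_def Setcompr_eq_image image_image carrier_product_group Collect_mem_eq by (rule refl)
  finally show ?thesis .
qed

text \<open>
  Expand the coordinates of a pure tensor one by one, using linearity in each of them.
\<close>

lemma pure_lin_span:
  assumes B: "\<And>i. i \<in> I \<Longrightarrow> B i \<subseteq> carrier (A i)"
    and span: "\<And>i. i \<in> I \<Longrightarrow> carrier (A i) \<subseteq> lin_span (A i) (B i)"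
  shows "carrier T \<subseteq> lin_span T (pure ` (\<Pi>\<^sub>E i\<in>I. B i))"
proof -
  let ?S = "pure ` (\<Pi>\<^sub>E i\<in>I. B i)"
  have BX: "(\<Pi>\<^sub>E i\<in>I. B i) \<subseteq> tuples" using B by (intro PiE_mono) auto
  have S: "?S \<subseteq> carrier T" using BX pure_closed by blast
  have "pure x \<in> lin_span T ?S" if "finite K" "K \<subseteq> I" "x \<in> tuples" "\<And>i. i \<in> I - K \<Longrightarrow> x i \<in> B i" for K x
    using that
  proof (induct K arbitrary: x)
    case empty
    then have "x \<in> (\<Pi>\<^sub>E i\<in>I. B i)" by (auto simp: PiE_iff)
    then show ?case by (intro lin_span_base[OF S] imageI)
  next
    case (insert k K)
    then have k: "k \<in> I" by simp
    interpret Ak: unital_algebra "A k" by (rule algebras[OF k])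
    have "pure (x(k := z)) \<in> lin_span T ?S" if "z \<in> lin_span (A k) (B k)" for z
      using that
    proof induct
      case zero
      have "pure (x(k := 0 \<odot>\<^bsub>A k\<^esub> \<zero>\<^bsub>A k\<^esub>)) = 0 \<odot>\<^bsub>T\<^esub> pure (x(k := \<zero>\<^bsub>A k\<^esub>))"
        by (rule pure_smult[OF insert(5) k Ak.zero_closed])
      also have "\<dots> = \<zero>\<^bsub>T\<^esub>"
        by (rule smult_zero_left[OF pure_closed[OF upd_closed[OF insert(5) k Ak.zero_closed]]])
      finally show ?case
        using lin_span.zero[of T ?S] by (simp only: Ak.smult_zero_right)
    next
      case (step b z c)
      have b: "b \<in> carrier (A k)" by (rule subsetD[OF B[OF k] step(1)])
      have z: "z \<in> carrier (A k)" by (rule Ak.lin_span_closed[OF B[OF k] step(2)])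
      have "pure (x(k := c \<odot>\<^bsub>A k\<^esub> b \<oplus>\<^bsub>A k\<^esub> z)) = c \<odot>\<^bsub>T\<^esub> pure (x(k := b)) \<oplus>\<^bsub>T\<^esub> pure (x(k := z))"
        using pure_add[OF insert(5) k Ak.smult_closed[OF b] z, of c] pure_smult[OF insert(5) k b, of c]
        by (simp only:)
      moreover have "pure (x(k := b)) \<in> lin_span T ?S"
        by (rule insert(3)) (use insert(4,6) step(1) upd_closed[OF insert(5) k b] in auto)
      ultimately show ?case
        using step(3) by (simp only: lin_span_add[OF S] lin_span_smult[OF S])
    qed
    moreover have "x k \<in> lin_span (A k) (B k)"
      using PiE_mem[OF insert(5) k] span[OF k] by (rule subsetD[rotated])
    ultimately have "pure (x(k := x k)) \<in> lin_span T ?S" by blast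
    then show ?case by simp
  qed
  then have "pure x \<in> lin_span T ?S" if "x \<in> tuples" for x
    using finite_I that by blast
  then have "lin_span T (pure ` tuples) \<subseteq> lin_span T ?S"
    by (intro lin_span_subset[OF S]) blast
  then show ?thesis using carrier_pure by (rule order_trans[rotated])
qed

text \<open>
  The universal property in the form needed here: a multiplicative and multilinear map on tuples
  induces an algebra homomorphism.
\<close>

lemma tensor_lift:
  assumes B: "unital_algebra B" and closed: "\<And>x. x \<in> tuples \<Longrightarrow> \<psi> x \<in> carrier B"
    and one: "\<psi> \<one>\<^bsub>P\<^esub> = \<one>\<^bsub>B\<^esub>"
    and mult: "\<And>x y. x \<in> tuples \<Longrightarrow> y \<in> tuples \<Longrightarrow> \<psi> (x \<otimes>\<^bsub>P\<^esub> y) = \<psi> x \<otimes>\<^bsub>B\<^esub> \<psi> y"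
    and add: "\<And>x i a b. x \<in> tuples \<Longrightarrow> i \<in> I \<Longrightarrow> a \<in> carrier (A i) \<Longrightarrow> b \<in> carrier (A i) \<Longrightarrow>
      \<psi> (x(i := a \<oplus>\<^bsub>A i\<^esub> b)) = \<psi> (x(i := a)) \<oplus>\<^bsub>B\<^esub> \<psi> (x(i := b))"
    and smult: "\<And>x i a c. x \<in> tuples \<Longrightarrow> i \<in> I \<Longrightarrow> a \<in> carrier (A i) \<Longrightarrow>
      \<psi> (x(i := c \<odot>\<^bsub>A i\<^esub> a)) = c \<odot>\<^bsub>B\<^esub> \<psi> (x(i := a))"
  obtains h where "algebra_hom T B h" "\<And>x. x \<in> tuples \<Longrightarrow> h (pure x) = \<psi> x"
proof -
  interpret B: unital_algebra B by (rule B)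
  interpret L: monoid_alg_lift P R B \<psi>
    by unfold_locales (use closed one mult in simp_all)
  have L: "algebra_hom R B L.lift"
    by (intro algebra_hom.intro algebra_hom_axioms.intro prod.unital_algebra B L.lift_hom)
  have s: "L.lift (Poly_Mapping.single x c) = c \<odot>\<^bsub>B\<^esub> \<psi> x" if "x \<in> tuples" for x c
    using that by (intro L.lift_single) simp
  have k: "Poly_Mapping.keys (Poly_Mapping.single x c) \<subseteq> carrier P" if "x \<in> tuples" for x and c :: 'k
    using that by simp
  have rel: "L.lift r = \<zero>\<^bsub>B\<^esub>" if "r \<in> tensor_rels I A" for r
  proof -
    from that consider
      (1) x i a b where "x \<in> tuples" "i \<in> I" "a \<in> carrier (A i)" "b \<in> carrier (A i)"
        "r = Poly_Mapping.single (x(i := a \<oplus>\<^bsub>A i\<^esub> b)) 1 - (Poly_Mapping.single (x(i := a)) 1 + Poly_Mapping.single (x(i := b)) 1)"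
      | (2) x i c a where "x \<in> tuples" "i \<in> I" "a \<in> carrier (A i)"
        "r = Poly_Mapping.single (x(i := c \<odot>\<^bsub>A i\<^esub> a)) 1 - Poly_Mapping.single (x(i := a)) c"
      unfolding tensor_rels_def diff_diff_eq by blast
    then show ?thesis
    proof cases
      case 1
      have tuples: "x(i := a \<oplus>\<^bsub>A i\<^esub> b) \<in> tuples" "x(i := a) \<in> tuples" "x(i := b) \<in> tuples"
        by (intro upd_closed add_closed 1(1-4))+
      have "L.lift (Poly_Mapping.single (x(i := a)) 1 + Poly_Mapping.single (x(i := b)) 1)
          = \<psi> (x(i := a)) \<oplus>\<^bsub>B\<^esub> \<psi> (x(i := b))"
        using L.lift_add[OF k[OF tuples(2), of 1] k[OF tuples(3), of 1]] closed[OF tuples(2)] closed[OF tuples(3)] by (simp only: s[OF tuples(2)] s[OF tuples(3)] B.smult_one)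
      moreover have "L.lift (Poly_Mapping.single (x(i := a \<oplus>\<^bsub>A i\<^esub> b)) 1) = \<psi> (x(i := a)) \<oplus>\<^bsub>B\<^esub> \<psi> (x(i := b))"
        using add[OF 1(1-4)] closed[OF tuples(1)] by (simp only: s[OF tuples(1)] B.smult_one)
      ultimately show ?thesis
        unfolding 1(5) using prod.hom_diff_eq_zero_iff[OF L k[OF tuples(1)] keys_add_subset[OF k[OF tuples(2)] k[OF tuples(3)]]]
        by (simp only:)
    next
      case 2
      have tuples: "x(i := c \<odot>\<^bsub>A i\<^esub> a) \<in> tuples" "x(i := a) \<in> tuples"
        by (intro upd_closed smult_closed' 2(1-3))+
      have "L.lift (Poly_Mapping.single (x(i := c \<odot>\<^bsub>A i\<^esub> a)) 1) = L.lift (Poly_Mapping.single (x(i := a)) c)"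
        using smult[OF 2(1-3), of c] closed[OF tuples(1)] by (simp only: s[OF tuples(1)] s[OF tuples(2)] B.smult_one)
      then show ?thesis
        unfolding 2(4) using prod.hom_diff_eq_zero_iff[OF L k[OF tuples(1)] k[OF tuples(2)]] by (simp only:)
    qed
  qed
  have kills: "L.lift x = \<zero>\<^bsub>B\<^esub>" if "x \<in> tensor_ideal I A" for x
    using algebra_hom.hom_kills_genideal[OF L rels_closed rel] that
    by (simp add: tensor_ideal_def)
  show thesis
  proof
    show "algebra_hom T B (quot_lift L.lift)"
      unfolding tensor_def by (rule algebra_ideal.quot_lift_hom[OF ideal L kills])
    show "quot_lift L.lift (pure x) = \<psi> x" if "x \<in> tuples" for x
      unfolding pure_def
      using algebra_ideal.quot_lift_proj[OF ideal L kills single_in_R[OF that], of 1] closed[OF that]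
      by (simp only: s[OF that] B.smult_one)
  qed
qed

end

lemma lin_span_carrier_update: "lin_span (A\<lparr>carrier := H\<rparr>) S = lin_span A S"
proof (intro equalityI subsetI)
  fix x assume "x \<in> lin_span (A\<lparr>carrier := H\<rparr>) S"
  then show "x \<in> lin_span A S" by induct (auto intro: lin_span.intros)
next
  fix x assume "x \<in> lin_span A S"
  then show "x \<in> lin_span (A\<lparr>carrier := H\<rparr>) S"
  proof induct
    case zero
    then show ?case using lin_span.zero[of "A\<lparr>carrier := H\<rparr>" S] by simp
  next
    case (step x y c)
    then show ?case using lin_span.step[of x S y "A\<lparr>carrier := H\<rparr>" c] by simp
  qed
qed

text \<open>
  As the maps \<open>h m\<close> are injective and compatible, two elements are identified in the limit exactly
  if they have the same image in \<open>B\<close>. So the classes are the fibres \<open>G b\<close> of the combined map, and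
  $b\mapsto G\,b$ is the isomorphism.
\<close>

lemma alg_isomorphic_dirlim:
  fixes T :: "nat \<Rightarrow> ('k :: field, 'a) module" and B :: "('k, 'b) module"
  assumes hom: "\<And>m. algebra_hom (T m) B (h m)"
    and inj: "\<And>m. inj_on (h m) (carrier (T m))"
    and emb: "\<And>m k x. m \<le> k \<Longrightarrow> x \<in> carrier (T m) \<Longrightarrow> \<phi> m k x \<in> carrier (T k) \<and> h k (\<phi> m k x) = h m x"
    and onto: "\<And>b. b \<in> carrier B \<Longrightarrow> \<exists>m. \<exists>x\<in>carrier (T m). h m x = b"
  shows "alg_isomorphic B (dirlim T \<phi>)"
proof -
  let ?D = "dirlim T \<phi>" and ?r = "dirlim_rel T \<phi>"
  define G where "G b = {(m, x). x \<in> carrier (T m) \<and> h m x = b}" for b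
  have r: "((m, x), (k, y)) \<in> ?r \<longleftrightarrow> x \<in> carrier (T m) \<and> y \<in> carrier (T k) \<and> h m x = h k y" for m k x y
  proof (cases "x \<in> carrier (T m) \<and> y \<in> carrier (T k)")
    case True
    have "\<phi> m l x = \<phi> k l y \<longleftrightarrow> h m x = h k y" if "l \<ge> max m k" for l
      using emb[of m l x] emb[of k l y] that True inj_on_eq_iff[OF inj[of l], of "\<phi> m l x" "\<phi> k l y"] by simp
    then have "(\<exists>l\<ge>max m k. \<phi> m l x = \<phi> k l y) \<longleftrightarrow> h m x = h k y"
      by (meson order_refl)
    then show ?thesis unfolding dirlim_rel_def using True by simp
  qed (auto simp: dirlim_rel_def)
  have cls: "?r `` {(m, x)} = G (h m x)" if "x \<in> carrier (T m)" for m x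
    using that by (auto simp: G_def r)
  have carrier: "carrier ?D = G ` carrier B"
  proof -
    have D: "carrier ?D = (\<Union>p\<in>(SIGMA m:UNIV. carrier (T m)). {?r `` {p}})"
      by (simp add: dirlim_def Let_def quotient_def)
    show ?thesis
    proof (intro equalityI subsetI)
      fix Z assume "Z \<in> carrier ?D"
      then obtain m x where x: "x \<in> carrier (T m)" "Z = ?r `` {(m, x)}"
        unfolding D by blast
      then show "Z \<in> G ` carrier B"
        unfolding x(2) cls[OF x(1)] by (intro imageI algebra_hom.closed[OF hom])
    next
      fix Z assume "Z \<in> G ` carrier B"
      then obtain b where b: "b \<in> carrier B" "Z = G b" by blast
      obtain m x where x: "x \<in> carrier (T m)" "h m x = b" using onto[OF b(1)] by blast
      have "Z = ?r `` {(m, x)}" unfolding b(2) x(2)[symmetric] by (rule cls[OF x(1), symmetric])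
      then show "Z \<in> carrier ?D" unfolding D using x(1) by blast
    qed
  qed
  interpret B: unital_algebra B using hom[of 0] by (simp add: algebra_hom_def)
  have ne: "\<exists>m x. (m, x) \<in> G b \<and> x \<in> carrier (T m) \<and> h m x = b" if "b \<in> carrier B" for b
    using onto[OF that] by (auto simp: G_def)
  have UN2: "(\<Union>(m, x)\<in>G a. \<Union>(k, y)\<in>G b. F m x k y) = Z"
    if ab: "a \<in> carrier B" "b \<in> carrier B"
      and F: "\<And>m x k y. x \<in> carrier (T m) \<Longrightarrow> h m x = a \<Longrightarrow> y \<in> carrier (T k) \<Longrightarrow> h k y = b \<Longrightarrow> F m x k y = Z"
    for a b Z and F :: "nat \<Rightarrow> 'a \<Rightarrow> nat \<Rightarrow> 'a \<Rightarrow> (nat \<times> 'a) set"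
  proof -
    obtain m x where mx: "(m, x) \<in> G a" using ne[OF ab(1)] by blast
    obtain k y where ky: "(k, y) \<in> G b" using ne[OF ab(2)] by blast
    have all: "F m x k y = Z" if "(m, x) \<in> G a" "(k, y) \<in> G b" for m x k y
      using that F by (simp add: G_def)
    have "(\<Union>(m, x)\<in>G a. \<Union>(k, y)\<in>G b. F m x k y) = (\<Union>p\<in>G a. \<Union>q\<in>G b. Z)"
      by (intro SUP_cong refl) (use all in \<open>auto split: prod.splits\<close>)
    then show ?thesis using mx ky by auto
  qed
  have mult: "G (a \<otimes>\<^bsub>B\<^esub> b) = G a \<otimes>\<^bsub>?D\<^esub> G b" if "a \<in> carrier B" "b \<in> carrier B" for a b
  proof -
    have "G a \<otimes>\<^bsub>?D\<^esub> G b = (\<Union>(m, x)\<in>G a. \<Union>(k, y)\<in>G b.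
        ?r `` {(max m k, \<phi> m (max m k) x \<otimes>\<^bsub>T (max m k)\<^esub> \<phi> k (max m k) y)})"
      by (simp add: dirlim_def Let_def)
    also have "\<dots> = G (a \<otimes>\<^bsub>B\<^esub> b)"
    proof (rule UN2[OF that])
      fix m x k y assume xy: "x \<in> carrier (T m)" "h m x = a" "y \<in> carrier (T k)" "h k y = b"
      let ?l = "max m k"
      interpret h: algebra_hom "T ?l" B "h ?l" by (rule hom)
      have "\<phi> m ?l x \<in> carrier (T ?l)" "\<phi> k ?l y \<in> carrier (T ?l)" "h ?l (\<phi> m ?l x) = a" "h ?l (\<phi> k ?l y) = b"
        using emb[of m ?l x] emb[of k ?l y] xy by simp_all
      then show "?r `` {(?l, \<phi> m ?l x \<otimes>\<^bsub>T ?l\<^esub> \<phi> k ?l y)} = G (a \<otimes>\<^bsub>B\<^esub> b)"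
        by (subst cls) simp_all
    qed
    finally show ?thesis by simp
  qed
  have add: "G (a \<oplus>\<^bsub>B\<^esub> b) = G a \<oplus>\<^bsub>?D\<^esub> G b" if "a \<in> carrier B" "b \<in> carrier B" for a b
  proof -
    have "G a \<oplus>\<^bsub>?D\<^esub> G b = (\<Union>(m, x)\<in>G a. \<Union>(k, y)\<in>G b.
        ?r `` {(max m k, \<phi> m (max m k) x \<oplus>\<^bsub>T (max m k)\<^esub> \<phi> k (max m k) y)})"
      by (simp add: dirlim_def Let_def)
    also have "\<dots> = G (a \<oplus>\<^bsub>B\<^esub> b)"
    proof (rule UN2[OF that])
      fix m x k y assume xy: "x \<in> carrier (T m)" "h m x = a" "y \<in> carrier (T k)" "h k y = b"
      let ?l = "max m k"
      interpret h: algebra_hom "T ?l" B "h ?l" by (rule hom)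
      have "\<phi> m ?l x \<in> carrier (T ?l)" "\<phi> k ?l y \<in> carrier (T ?l)" "h ?l (\<phi> m ?l x) = a" "h ?l (\<phi> k ?l y) = b"
        using emb[of m ?l x] emb[of k ?l y] xy by simp_all
      then show "?r `` {(?l, \<phi> m ?l x \<oplus>\<^bsub>T ?l\<^esub> \<phi> k ?l y)} = G (a \<oplus>\<^bsub>B\<^esub> b)"
        by (subst cls) simp_all
    qed
    finally show ?thesis by simp
  qed
  have smult: "G (c \<odot>\<^bsub>B\<^esub> a) = c \<odot>\<^bsub>?D\<^esub> G a" if a: "a \<in> carrier B" for c a
  proof -
    obtain m x where mx: "(m, x) \<in> G a" using ne[OF a] by blast
    have eq: "?r `` {(m, c \<odot>\<^bsub>T m\<^esub> x)} = G (c \<odot>\<^bsub>B\<^esub> a)" if "(m, x) \<in> G a" for m x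
    proof -
      interpret h: algebra_hom "T m" B "h m" by (rule hom)
      have "x \<in> carrier (T m)" "h m x = a" using that by (simp_all add: G_def)
      then show ?thesis by (subst cls) simp_all
    qed
    have "c \<odot>\<^bsub>?D\<^esub> G a = (\<Union>(m, x)\<in>G a. ?r `` {(m, c \<odot>\<^bsub>T m\<^esub> x)})"
      by (simp add: dirlim_def Let_def)
    also have "\<dots> = (\<Union>p\<in>G a. G (c \<odot>\<^bsub>B\<^esub> a))"
      by (intro SUP_cong refl) (use eq in \<open>auto split: prod.splits\<close>)
    also have "\<dots> = G (c \<odot>\<^bsub>B\<^esub> a)" using mx by blast
    finally show ?thesis by simp
  qed
  have one: "G \<one>\<^bsub>B\<^esub> = \<one>\<^bsub>?D\<^esub>"
  proof -
    interpret h: algebra_hom "T 0" B "h 0" by (rule hom)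
    show ?thesis using cls[of "\<one>\<^bsub>T 0\<^esub>" 0] by (simp add: dirlim_def Let_def)
  qed
  have "G \<in> ring_hom B ?D"
    by (rule ring_hom_memI) (simp_all only: carrier imageI mult add one)
  moreover have "inj_on G (carrier B)"
  proof (rule inj_onI)
    fix a b assume ab: "a \<in> carrier B" "b \<in> carrier B" "G a = G b"
    obtain m x where "(m, x) \<in> G a" "h m x = a" using ne[OF ab(1)] by blast
    moreover from this have "(m, x) \<in> G b" using ab(3) by simp
    ultimately show "a = b" by (simp add: G_def)
  qed
  ultimately have "G \<in> ring_iso B ?D"
    unfolding ring_iso_def bij_betw_def by (simp add: carrier)
  then show ?thesis
    unfolding alg_isomorphic_def using smult by (intro bexI[of _ G]) simp_all
qed

section \<open>The Clifford algebra as an infinite tensor product\<close>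

context orthonormal_clifford
begin

abbreviation "factor \<equiv> \<lambda>i. C\<lparr>carrier := twisted i\<rparr>"
abbreviation "tuples m \<equiv> \<Pi>\<^sub>E i\<in>{1..m}. carrier (factor i)"

lemma tensor_product_blocks: "tensor_product {1..m} factor"
  by (intro tensor_product.intro unital_algebra_subalg twisted_subalg) simp

lemma twisted_ops:
  "\<one>\<^bsub>C\<^esub> \<in> twisted i" "x \<in> twisted i \<Longrightarrow> y \<in> twisted i \<Longrightarrow> x \<otimes>\<^bsub>C\<^esub> y \<in> twisted i"
  "x \<in> twisted i \<Longrightarrow> y \<in> twisted i \<Longrightarrow> x \<oplus>\<^bsub>C\<^esub> y \<in> twisted i" "x \<in> twisted i \<Longrightarrow> c \<odot>\<^bsub>C\<^esub> x \<in> twisted i"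
  using twisted_subalg[of i] subringE[of "twisted i" C] unfolding subalg_def by simp_all

lemma twisted_carrier: "x \<in> twisted i \<Longrightarrow> x \<in> carrier C"
  by (rule subsetD[OF twisted_closed])

definition prod_map :: "nat \<Rightarrow> (nat \<Rightarrow> ('v list \<Rightarrow>\<^sub>0 'k) set) \<Rightarrow> ('v list \<Rightarrow>\<^sub>0 'k) set" where
  "prod_map m x = alg_prod C (map x [1..<m + 1])"

lemma prod_map_0 [simp]: "prod_map 0 x = \<one>\<^bsub>C\<^esub>"
  by (simp add: prod_map_def)

lemma prod_map_closed:
  assumes "\<And>i. i \<in> {1..m} \<Longrightarrow> x i \<in> twisted i" shows "prod_map m x \<in> carrier C"
  unfolding prod_map_def
proof (rule alg_prod_closed)
  show "set (map x [1..<m + 1]) \<subseteq> carrier C"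
    using twisted_carrier[OF assms] by auto
qed

lemma prod_map_Suc:
  assumes "\<And>i. i \<in> {1..Suc m} \<Longrightarrow> x i \<in> twisted i"
  shows "prod_map (Suc m) x = prod_map m x \<otimes>\<^bsub>C\<^esub> x (Suc m)"
proof -
  have c: "set (map x [1..<m + 1]) \<subseteq> carrier C" "set [x (Suc m)] \<subseteq> carrier C"
    using twisted_carrier[OF assms] by auto
  have "map x [1..<Suc m + 1] = map x [1..<m + 1] @ [x (Suc m)]" by simp
  then have "prod_map (Suc m) x = alg_prod C (map x [1..<m + 1] @ [x (Suc m)])"
    unfolding prod_map_def by (simp only:)
  also have "\<dots> = prod_map m x \<otimes>\<^bsub>C\<^esub> alg_prod C [x (Suc m)]"
    unfolding prod_map_def by (rule alg_prod_append[OF c])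
  finally show ?thesis using c(2) by simp
qed

lemma prod_map_cong: "(\<And>i. i \<in> {1..m} \<Longrightarrow> x i = y i) \<Longrightarrow> prod_map m x = prod_map m y"
  unfolding prod_map_def by (intro arg_cong[where f = "alg_prod C"] map_cong refl) auto

lemma prod_map_commute:
  assumes "\<And>i. i \<in> {1..m} \<Longrightarrow> x i \<in> twisted i" "m < j" "y \<in> twisted j"
  shows "prod_map m x \<otimes>\<^bsub>C\<^esub> y = y \<otimes>\<^bsub>C\<^esub> prod_map m x"
  unfolding prod_map_def
proof (rule alg_prod_commute)
  show "set (map x [1..<m + 1]) \<subseteq> carrier C" using twisted_carrier[OF assms(1)] by auto
  show "y \<in> carrier C" by (rule twisted_carrier[OF assms(3)])
  fix z assume "z \<in> set (map x [1..<m + 1])"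
  then obtain i where "i \<in> set [1..<m + 1]" "z = x i" unfolding set_map by (elim imageE)
  then have "i \<in> {1..m}" "z = x i" by auto
  then show "z \<otimes>\<^bsub>C\<^esub> y = y \<otimes>\<^bsub>C\<^esub> z"
    using assms by (intro twisted_commute_less[of i j]) auto
qed

text \<open>
  The last factor of the first tuple commutes with all earlier factors of the second.
\<close>

lemma prod_map_mult:
  assumes "\<And>i. i \<in> {1..m} \<Longrightarrow> x i \<in> twisted i" "\<And>i. i \<in> {1..m} \<Longrightarrow> y i \<in> twisted i"
  shows "prod_map m (\<lambda>i. x i \<otimes>\<^bsub>C\<^esub> y i) = prod_map m x \<otimes>\<^bsub>C\<^esub> prod_map m y"
  using assms
proof (induct m)
  case (Suc m)
  let ?z = "\<lambda>i. x i \<otimes>\<^bsub>C\<^esub> y i"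
  have x: "\<And>i. i \<in> {1..m} \<Longrightarrow> x i \<in> twisted i" and y: "\<And>i. i \<in> {1..m} \<Longrightarrow> y i \<in> twisted i" using Suc by auto
  have p: "prod_map m x \<in> carrier C" "prod_map m y \<in> carrier C"
    using prod_map_closed[of m x, OF x] prod_map_closed[of m y, OF y] by blast+
  have xS: "x (Suc m) \<in> twisted (Suc m)" and yS: "y (Suc m) \<in> twisted (Suc m)" using Suc by auto
  note c = twisted_carrier[OF xS] twisted_carrier[OF yS]
  have "prod_map (Suc m) ?z = prod_map m ?z \<otimes>\<^bsub>C\<^esub> (x (Suc m) \<otimes>\<^bsub>C\<^esub> y (Suc m))"
    by (rule prod_map_Suc) (intro twisted_ops(2) Suc(2,3))
  also have "\<dots> = prod_map m x \<otimes>\<^bsub>C\<^esub> ((prod_map m y \<otimes>\<^bsub>C\<^esub> x (Suc m)) \<otimes>\<^bsub>C\<^esub> y (Suc m))"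
    using Suc(1)[OF x y] p c by (simp add: m_assoc)
  also have "\<dots> = prod_map m x \<otimes>\<^bsub>C\<^esub> ((x (Suc m) \<otimes>\<^bsub>C\<^esub> prod_map m y) \<otimes>\<^bsub>C\<^esub> y (Suc m))"
    by (simp only: prod_map_commute[OF y lessI xS])
  also have "\<dots> = (prod_map m x \<otimes>\<^bsub>C\<^esub> x (Suc m)) \<otimes>\<^bsub>C\<^esub> (prod_map m y \<otimes>\<^bsub>C\<^esub> y (Suc m))"
    using p c by (simp add: m_assoc)
  finally show ?case
    by (simp only: prod_map_Suc[OF Suc(2)] prod_map_Suc[OF Suc(3)])
qed simp

lemma prod_map_one: "(\<And>i. i \<in> {1..m} \<Longrightarrow> x i = \<one>\<^bsub>C\<^esub>) \<Longrightarrow> prod_map m x = \<one>\<^bsub>C\<^esub>"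
proof (induct m)
  case (Suc m)
  have "prod_map (Suc m) x = prod_map m x \<otimes>\<^bsub>C\<^esub> x (Suc m)"
    by (rule prod_map_Suc) (simp only: Suc(2) twisted_ops(1))
  then show ?case using Suc by simp
qed simp

text \<open>
  As a function of one coordinate the product is a two-sided multiplication, hence linear.
\<close>

lemma prod_map_upd:
  assumes "\<And>i. i \<in> {1..m} \<Longrightarrow> x i \<in> twisted i" "k \<in> {1..m}"
  shows "\<exists>p\<in>carrier C. \<exists>q\<in>carrier C. \<forall>z\<in>twisted k. prod_map m (x(k := z)) = p \<otimes>\<^bsub>C\<^esub> z \<otimes>\<^bsub>C\<^esub> q"
  using assms
proof (induct m)
  case (Suc m)
  have S: "prod_map (Suc m) (x(k := z)) = prod_map m (x(k := z)) \<otimes>\<^bsub>C\<^esub> (x(k := z)) (Suc m)" if "z \<in> twisted k" for z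
    by (rule prod_map_Suc) (use Suc(2) that in simp)
  show ?case
  proof (cases "k = Suc m")
    case True
    have p: "prod_map m x \<in> carrier C" by (rule prod_map_closed) (use Suc(2) in simp)
    have eq: "prod_map (Suc m) (x(k := z)) = prod_map m x \<otimes>\<^bsub>C\<^esub> z \<otimes>\<^bsub>C\<^esub> \<one>\<^bsub>C\<^esub>" if "z \<in> twisted k" for z
    proof -
      have "prod_map m (x(k := z)) = prod_map m x" using True by (intro prod_map_cong) simp
      then show ?thesis using S[OF that] p twisted_carrier[OF that] True by simp
    qed
    show ?thesis
      by (rule bexI[OF _ p], rule bexI[OF _ one_closed], rule ballI, rule eq)
  next
    case False
    then have k: "k \<in> {1..m}" using Suc(3) by simp
    have "\<exists>p\<in>carrier C. \<exists>q\<in>carrier C. \<forall>z\<in>twisted k. prod_map m (x(k := z)) = p \<otimes>\<^bsub>C\<^esub> z \<otimes>\<^bsub>C\<^esub> q"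
      using k by (intro Suc(1) Suc(2)) simp_all
    then obtain p q where pq: "p \<in> carrier C" "q \<in> carrier C"
      and all: "\<forall>z\<in>twisted k. prod_map m (x(k := z)) = p \<otimes>\<^bsub>C\<^esub> z \<otimes>\<^bsub>C\<^esub> q"
      by (elim bexE)
    have xS: "x (Suc m) \<in> carrier C" by (rule twisted_carrier[OF Suc(2)]) simp
    have eq: "prod_map (Suc m) (x(k := z)) = p \<otimes>\<^bsub>C\<^esub> z \<otimes>\<^bsub>C\<^esub> (q \<otimes>\<^bsub>C\<^esub> x (Suc m))" if "z \<in> twisted k" for z
      using S[OF that] pq bspec[OF all that] twisted_carrier[OF that] xS False by (simp add: m_assoc)
    show ?thesis
      by (rule bexI[OF _ pq(1)], rule bexI[OF _ m_closed[OF pq(2) xS]], rule ballI, rule eq)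
  qed
qed simp

lemma tuples_twisted: "x \<in> tuples m \<Longrightarrow> i \<in> {1..m} \<Longrightarrow> x i \<in> twisted i"
  using PiE_mem[of x "{1..m}" "\<lambda>i. carrier (factor i)" i] by simp

lemma multiplication_hom:
  "\<exists>h. algebra_hom (tensor {1..m} factor) C h \<and>
       (\<forall>x\<in>tuples m. h (tensor_product.pure {1..m} factor x) = prod_map m x)"
proof -
  interpret t: tensor_product "{1..m}" factor by (rule tensor_product_blocks)
  obtain h where "algebra_hom t.T C h" "\<And>x. x \<in> tuples m \<Longrightarrow> h (t.pure x) = prod_map m x"
  proof (rule t.tensor_lift[of C "prod_map m"])
    show "unital_algebra C" by (rule full.algebra)
    show "prod_map m x \<in> carrier C" if "x \<in> tuples m" for x
      by (rule prod_map_closed[OF tuples_twisted[OF that]])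
    show "prod_map m \<one>\<^bsub>t.P\<^esub> = \<one>\<^bsub>C\<^esub>"
      by (rule prod_map_one) (simp add: t.P_one)
    show "prod_map m (x \<otimes>\<^bsub>t.P\<^esub> y) = prod_map m x \<otimes>\<^bsub>C\<^esub> prod_map m y" if "x \<in> tuples m" "y \<in> tuples m" for x y
    proof -
      have "prod_map m (x \<otimes>\<^bsub>t.P\<^esub> y) = prod_map m (\<lambda>i. x i \<otimes>\<^bsub>C\<^esub> y i)"
        by (rule prod_map_cong) (simp add: t.P_mult)
      then show ?thesis using prod_map_mult[OF tuples_twisted[OF that(1)] tuples_twisted[OF that(2)]] by simp
    qed
  next
    fix x i a b assume x: "x \<in> tuples m" "i \<in> {1..m}" "a \<in> carrier (factor i)" "b \<in> carrier (factor i)"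
    then have ab: "a \<in> twisted i" "b \<in> twisted i" by simp_all
    have "\<exists>p\<in>carrier C. \<exists>q\<in>carrier C. \<forall>z\<in>twisted i. prod_map m (x(i := z)) = p \<otimes>\<^bsub>C\<^esub> z \<otimes>\<^bsub>C\<^esub> q"
      by (rule prod_map_upd[OF tuples_twisted[OF x(1)] x(2)])
    then obtain p q where pq: "p \<in> carrier C" "q \<in> carrier C"
      and all: "\<forall>z\<in>twisted i. prod_map m (x(i := z)) = p \<otimes>\<^bsub>C\<^esub> z \<otimes>\<^bsub>C\<^esub> q"
      by (elim bexE)
    show "prod_map m (x(i := a \<oplus>\<^bsub>factor i\<^esub> b)) = prod_map m (x(i := a)) \<oplus>\<^bsub>C\<^esub> prod_map m (x(i := b))"
      using pq twisted_carrier[OF ab(1)] twisted_carrier[OF ab(2)] bspec[OF all ab(1)] bspec[OF all ab(2)]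
        bspec[OF all twisted_ops(3)[OF ab]]
      by (simp add: l_distr r_distr del: fun_upd_apply)
  next
    fix x i a c assume x: "x \<in> tuples m" "i \<in> {1..m}" "a \<in> carrier (factor i)"
    then have a: "a \<in> twisted i" by simp
    have "\<exists>p\<in>carrier C. \<exists>q\<in>carrier C. \<forall>z\<in>twisted i. prod_map m (x(i := z)) = p \<otimes>\<^bsub>C\<^esub> z \<otimes>\<^bsub>C\<^esub> q"
      by (rule prod_map_upd[OF tuples_twisted[OF x(1)] x(2)])
    then obtain p q where pq: "p \<in> carrier C" "q \<in> carrier C"
      and all: "\<forall>z\<in>twisted i. prod_map m (x(i := z)) = p \<otimes>\<^bsub>C\<^esub> z \<otimes>\<^bsub>C\<^esub> q"
      by (elim bexE)
    show "prod_map m (x(i := c \<odot>\<^bsub>factor i\<^esub> a)) = c \<odot>\<^bsub>C\<^esub> prod_map m (x(i := a))"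
      using pq twisted_carrier[OF a] bspec[OF all a] bspec[OF all twisted_ops(4)[OF a, of c]]
      by (simp del: fun_upd_apply)
  qed auto
  then show ?thesis by blast
qed

text \<open>
  A choice of the homomorphism that multiplies the factors. Its values on the tensor product are
  determined, as pure tensors span it.
\<close>

definition mult_hom :: "nat \<Rightarrow> ((nat \<Rightarrow> ('v list \<Rightarrow>\<^sub>0 'k) set) \<Rightarrow>\<^sub>0 'k) set \<Rightarrow> ('v list \<Rightarrow>\<^sub>0 'k) set" where
  "mult_hom m = (SOME h. algebra_hom (tensor {1..m} factor) C h \<and>
     (\<forall>x\<in>tuples m. h (tensor_product.pure {1..m} factor x) = prod_map m x))"

lemma mult_hom: "algebra_hom (tensor {1..m} factor) C (mult_hom m)"
  and mult_hom_pure: "x \<in> tuples m \<Longrightarrow> mult_hom m (tensor_product.pure {1..m} factor x) = prod_map m x"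
  using someI_ex[OF multiplication_hom[of m]] unfolding mult_hom_def by auto

text \<open>
  The letters of the product of the basis elements attached to a tuple of subsets.
\<close>

definition tuple_word :: "nat \<Rightarrow> (nat \<Rightarrow> nat set) \<Rightarrow> nat list" where
  "tuple_word m S = concat (map (\<lambda>i. block_word i (S i)) [1..<m + 1])"

lemma tuple_word_simps [simp]:
  "tuple_word 0 S = []" "tuple_word (Suc m) S = tuple_word m S @ block_word (Suc m) (S (Suc m))"
  by (simp_all add: tuple_word_def)

lemma set_tuple_word:
  assumes "\<And>i. i \<in> {1..m} \<Longrightarrow> S i \<subseteq> block_indices i" shows "set (tuple_word m S) \<subseteq> {1..n m}"
  using assms
proof (induct m)
  case (Suc m)
  have "n m \<le> n (Suc m)" by (rule n_le) simp
  then show ?case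
    using Suc(1)[OF Suc(2)] set_block_word_le[OF Suc(2)[of "Suc m"]] by fastforce
qed simp

text \<open>
  The words of the earlier blocks have no letter in the last one. So the last subset can be read
  off inside the last block, and the remaining ones follow by induction.
\<close>

lemma odd_letters_tuple_word_inj:
  assumes "\<And>i. i \<in> {1..m} \<Longrightarrow> S i \<subseteq> block_indices i" "\<And>i. i \<in> {1..m} \<Longrightarrow> T i \<subseteq> block_indices i"
    and "odd_letters (tuple_word m S) = odd_letters (tuple_word m T)" "i \<in> {1..m}"
  shows "S i = T i"
  using assms
proof (induct m)
  case (Suc m)
  have ST: "S (Suc m) \<subseteq> block_indices (Suc m)" "T (Suc m) \<subseteq> block_indices (Suc m)" using Suc by simp_all
  have small: "odd_letters (tuple_word m U) \<inter> block_indices (Suc m) = {}" if "\<And>i. i \<in> {1..m} \<Longrightarrow> U i \<subseteq> block_indices i" for U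
    using set_tuple_word[of m U, OF that] odd_letters_subset[of "tuple_word m U"] by (fastforce simp: block_indices_def)
  have s: "odd_letters (tuple_word m S) \<inter> block_indices (Suc m) = {}" "odd_letters (tuple_word m T) \<inter> block_indices (Suc m) = {}"
    using Suc(2,3) by (intro small; simp)+
  have eq: "sym_diff (odd_letters (tuple_word m S)) (odd_letters (block_word (Suc m) (S (Suc m))))
      = sym_diff (odd_letters (tuple_word m T)) (odd_letters (block_word (Suc m) (T (Suc m))))"
    using Suc(4) by simp
  then have "odd_letters (block_word (Suc m) (S (Suc m))) \<inter> block_indices (Suc m) = odd_letters (block_word (Suc m) (T (Suc m))) \<inter> block_indices (Suc m)"
    using s by blast
  then have top: "S (Suc m) = T (Suc m)"
    using inj_onD[OF inj_on_block_word[of "Suc m"], of "S (Suc m)" "T (Suc m)"] ST by simp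
  then have "odd_letters (tuple_word m S) = odd_letters (tuple_word m T)"
    using eq by auto
  then show ?case using Suc top by (cases "i = Suc m") simp_all
qed simp

lemma prod_map_block_word:
  assumes "\<And>i. i \<in> {1..m} \<Longrightarrow> S i \<subseteq> block_indices i"
  shows "prod_map m (\<lambda>i. word (block_word i (S i))) = word (tuple_word m S)"
  using assms
proof (induct m)
  case (Suc m)
  have "word (block_word i (S i)) \<in> twisted i" if "i \<in> {1..Suc m}" for i
    using Suc(2)[OF that] subset_block_indices_props(4)[OF Suc(2)[OF that]] by (intro word_in_twisted) simp_all
  then have "prod_map (Suc m) (\<lambda>i. word (block_word i (S i))) = word (tuple_word m S) \<otimes>\<^bsub>C\<^esub> word (block_word (Suc m) (S (Suc m)))"
    using Suc by (subst prod_map_Suc) simp_all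
  also have "\<dots> = word (tuple_word (Suc m) S)"
  proof -
    have "set (tuple_word m S) \<subseteq> {1..n m}" using Suc(2) by (intro set_tuple_word) simp
    then have "set (tuple_word m S) \<subseteq> {1..}" by auto
    then show ?thesis
      using subset_block_indices_props(4)[OF Suc(2)[of "Suc m"]] by (subst tuple_word_simps) (simp add: word_append)
  qed
  finally show ?case .
qed simp

lemma mult_hom_inj: "inj_on (mult_hom m) (carrier (tensor {1..m} factor))"
proof -
  interpret t: tensor_product "{1..m}" factor by (rule tensor_product_blocks)
  let ?B = "\<lambda>i. {word (block_word i S) | S. S \<subseteq> block_indices i}"
  let ?S = "\<Pi>\<^sub>E i\<in>{1..m}. Pow (block_indices i)"
  define b where "b S = t.pure (\<lambda>i\<in>{1..m}. word (block_word i (S i)))" for S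
  have wL: "word (block_word i S) \<in> twisted i" if "S \<subseteq> block_indices i" for i S
    using that subset_block_indices_props(4)[OF that] by (intro word_in_twisted) simp_all
  have bX: "(\<lambda>i\<in>{1..m}. word (block_word i (S i))) \<in> tuples m" if "S \<in> ?S" for S
    using wL PiE_mem[OF that] by simp
  have BL: "?B i \<subseteq> carrier (factor i)" for i
    using wL by auto
  have span1: "carrier t.T \<subseteq> lin_span t.T (t.pure ` (\<Pi>\<^sub>E i\<in>{1..m}. ?B i))"
    by (rule t.pure_lin_span[OF BL]) (simp add: lin_span_carrier_update twisted_def)
  have "t.pure ` (\<Pi>\<^sub>E i\<in>{1..m}. ?B i) \<subseteq> b ` ?S"
  proof
    fix z assume "z \<in> t.pure ` (\<Pi>\<^sub>E i\<in>{1..m}. ?B i)"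
    then obtain x where x: "x \<in> (\<Pi>\<^sub>E i\<in>{1..m}. ?B i)" "z = t.pure x" by (elim imageE)
    have "\<forall>i\<in>{1..m}. \<exists>S. S \<subseteq> block_indices i \<and> x i = word (block_word i S)"
      using PiE_mem[OF x(1)] by blast
    then have "\<exists>S. \<forall>i\<in>{1..m}. S i \<subseteq> block_indices i \<and> x i = word (block_word i (S i))"
      by (rule bchoice)
    then obtain S where S: "\<forall>i\<in>{1..m}. S i \<subseteq> block_indices i \<and> x i = word (block_word i (S i))"
      by (elim exE)
    have "(\<lambda>i\<in>{1..m}. word (block_word i (restrict S {1..m} i))) = x"
    proof (rule extensionalityI[of _ "{1..m}"])
      show "x \<in> extensional {1..m}" using x(1) by (simp add: PiE_iff)
    qed (use S in simp_all)
    then have "z = b (restrict S {1..m})" unfolding b_def x(2) by simp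
    moreover have "restrict S {1..m} \<in> ?S" using S by simp
    ultimately show "z \<in> b ` ?S" by (rule image_eqI)
  qed
  then have "lin_span t.T (t.pure ` (\<Pi>\<^sub>E i\<in>{1..m}. ?B i)) \<subseteq> lin_span t.T (b ` ?S)"
    by (intro t.lin_span_mono) (use bX t.pure_closed in \<open>simp_all add: b_def image_subset_iff\<close>)
  then have span: "carrier t.T \<subseteq> lin_span t.T (b ` ?S)" by (rule order_trans[OF span1])
  show ?thesis
  proof (rule inj_on_if_basis_to_words[OF mult_hom _ _ span])
    show "finite ?S" by (intro finite_PiE) auto
    show "b ` ?S \<subseteq> carrier t.T" unfolding b_def using bX t.pure_closed by (simp add: image_subset_iff)
    fix S assume S: "S \<in> ?S"
    then have SJ: "\<And>i. i \<in> {1..m} \<Longrightarrow> S i \<subseteq> block_indices i" using PiE_mem[OF S] by simp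
    show "set (tuple_word m S) \<subseteq> {1..}"
      using set_tuple_word[of m S, OF SJ] by auto
    then have "word (tuple_word m S) \<in> carrier C" by (rule word_closed)
    moreover have "mult_hom m (b S) = prod_map m (\<lambda>i\<in>{1..m}. word (block_word i (S i)))"
      unfolding b_def by (rule mult_hom_pure[OF bX[OF S]])
    moreover have "\<dots> = prod_map m (\<lambda>i. word (block_word i (S i)))"
      by (rule prod_map_cong) simp
    moreover have "\<dots> = word (tuple_word m S)"
      by (rule prod_map_block_word[OF SJ])
    ultimately show "proportional C (mult_hom m (b S)) (word (tuple_word m S))"
      by (simp add: proportional_refl)
  next
    show "inj_on (\<lambda>S. odd_letters (tuple_word m S)) ?S"
    proof (rule inj_onI)
      fix S T assume ST: "S \<in> ?S" "T \<in> ?S" "odd_letters (tuple_word m S) = odd_letters (tuple_word m T)"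
      show "S = T"
      proof (rule PiE_ext[OF ST(1,2)])
        fix i assume "i \<in> {1..m}"
        then show "S i = T i"
          using PiE_mem[OF ST(1)] PiE_mem[OF ST(2)] ST(3) by (intro odd_letters_tuple_word_inj[of m S T]) simp_all
      qed
    qed
  qed
qed

end

text \<open>
  The linear extension of a map on the monomials, which need not be injective, is additive.
\<close>

lemma sum_keys_single_add:
  fixes p q :: "'a \<Rightarrow>\<^sub>0 'k :: comm_monoid_add"
  shows "(\<Sum>x\<in>Poly_Mapping.keys (p + q). Poly_Mapping.single (F x) (Poly_Mapping.lookup (p + q) x))
    = (\<Sum>x\<in>Poly_Mapping.keys p. Poly_Mapping.single (F x) (Poly_Mapping.lookup p x))
      + (\<Sum>x\<in>Poly_Mapping.keys q. Poly_Mapping.single (F x) (Poly_Mapping.lookup q x))"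
proof -
  let ?K = "Poly_Mapping.keys p \<union> Poly_Mapping.keys q"
  have *: "(\<Sum>x\<in>Poly_Mapping.keys r. Poly_Mapping.single (F x) (Poly_Mapping.lookup r x))
      = (\<Sum>x\<in>?K. Poly_Mapping.single (F x) (Poly_Mapping.lookup r x))"
    if "Poly_Mapping.keys r \<subseteq> ?K" for r
    by (rule sum.mono_neutral_left) (use that in \<open>auto simp: in_keys_iff\<close>)
  show ?thesis
    using *[OF keys_add] *[of p] *[of q] by (simp add: lookup_add single_add sum.distrib)
qed

context orthonormal_clifford
begin

lemma mult_hom_proj_single:
  assumes "x \<in> tuples m"
  shows "mult_hom m (tensor_ideal {1..m} factor +>\<^bsub>monoid_algebra (product_group {1..m} factor)\<^esub> Poly_Mapping.single x c)
    = c \<odot>\<^bsub>C\<^esub> prod_map m x"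
proof -
  interpret t: tensor_product "{1..m}" factor by (rule tensor_product_blocks)
  have "mult_hom m (t.proj (Poly_Mapping.single x c)) = mult_hom m (c \<odot>\<^bsub>t.T\<^esub> t.pure x)"
    unfolding t.proj_single[OF assms] by (rule refl)
  also have "\<dots> = c \<odot>\<^bsub>C\<^esub> mult_hom m (t.pure x)"
    by (rule algebra_hom.smult[OF mult_hom t.pure_closed[OF assms]])
  finally show ?thesis unfolding mult_hom_pure[OF assms] .
qed

lemma prod_map_trailing_ones:
  assumes "m \<le> k" "\<And>i. i \<in> {1..k} \<Longrightarrow> y i \<in> twisted i" "\<And>i. m < i \<Longrightarrow> i \<le> k \<Longrightarrow> y i = \<one>\<^bsub>C\<^esub>"
  shows "prod_map k y = prod_map m y"
  using assms
proof (induct k rule: dec_induct)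
  case (step l)
  have "prod_map (Suc l) y = prod_map l y \<otimes>\<^bsub>C\<^esub> y (Suc l)"
    by (rule prod_map_Suc[OF step(4)])
  also have "\<dots> = prod_map l y"
    using step prod_map_closed[of l y] by simp
  also have "\<dots> = prod_map m y"
    using step by simp
  finally show ?case .
qed simp

text \<open>
  Appending factors \<open>1\<close> does not change a product. As \<open>mult_hom k\<close> is injective, this also shows that the
  union over representatives in the definition of the embedding is a single coset.
\<close>

lemma mult_hom_tensor_emb:
  assumes mk: "m \<le> k" and Z: "Z \<in> carrier (tensor {1..m} factor)"
  shows "tensor_emb factor m k Z \<in> carrier (tensor {1..k} factor) \<and> mult_hom k (tensor_emb factor m k Z) = mult_hom m Z"
proof -
  interpret t: tensor_product "{1..m}" factor by (rule tensor_product_blocks)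
  interpret u: tensor_product "{1..k}" factor by (rule tensor_product_blocks)
  interpret ht: algebra_hom t.T C "mult_hom m" by (rule mult_hom)
  interpret hu: algebra_hom u.T C "mult_hom k" by (rule mult_hom)
  interpret pt: algebra_hom t.R t.T t.proj by (rule t.proj_hom)
  interpret pu: algebra_hom u.R u.T u.proj by (rule u.proj_hom)
  define ext where "ext x = (\<lambda>i\<in>{1..k}. if i \<le> m then x i else \<one>\<^bsub>factor i\<^esub>)" for x
  define emb where "emb p = (\<Sum>x\<in>Poly_Mapping.keys p. Poly_Mapping.single (ext x) (Poly_Mapping.lookup p x))"
    for p :: "(nat \<Rightarrow> ('v list \<Rightarrow>\<^sub>0 'k) set) \<Rightarrow>\<^sub>0 'k"
  have ext: "ext x \<in> tuples k" if "x \<in> tuples m" for x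
    using tuples_twisted[OF that] twisted_ops(1) by (simp add: ext_def)
  have prod_ext: "prod_map k (ext x) = prod_map m x" if x: "x \<in> tuples m" for x
  proof -
    have "prod_map k (ext x) = prod_map m (ext x)"
      by (rule prod_map_trailing_ones[OF mk tuples_twisted[OF ext[OF x]]]) (simp_all add: ext_def)
    also have "\<dots> = prod_map m x"
      by (rule prod_map_cong) (use mk in \<open>simp add: ext_def\<close>)
    finally show ?thesis .
  qed
  have emb: "emb p \<in> carrier u.R \<and> mult_hom k (u.proj (emb p)) = mult_hom m (t.proj p)"
    if "Poly_Mapping.keys p \<subseteq> tuples m" for p
    using that
  proof (induct rule: poly_mapping_carrier_induct)
    case zero
    have "emb 0 = 0" by (simp add: emb_def)
    moreover have "t.proj 0 = \<zero>\<^bsub>t.T\<^esub>" "u.proj 0 = \<zero>\<^bsub>u.T\<^esub>"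
      using pt.hom_zero pu.hom_zero by simp_all
    moreover have "0 \<in> carrier u.R" by simp
    ultimately show ?case by (simp only: ht.hom_zero hu.hom_zero)
  next
    case (add a c p)
    have a: "emb (Poly_Mapping.single a c) = Poly_Mapping.single (ext a) c"
      by (cases "c = 0") (simp_all add: emb_def)
    have e: "emb (Poly_Mapping.single a c + p) = Poly_Mapping.single (ext a) c \<oplus>\<^bsub>u.R\<^esub> emb p"
      unfolding a[symmetric] unfolding emb_def monoid_algebra_sel(4) by (rule sum_keys_single_add)
    have su: "Poly_Mapping.single (ext a) c \<in> carrier u.R" by (rule u.single_in_R[OF ext[OF add(1)]])
    have st: "Poly_Mapping.single a c \<in> carrier t.R" by (rule t.single_in_R[OF add(1)])
    have p: "p \<in> carrier t.R" using add(2) by simp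
    have "mult_hom k (u.proj (Poly_Mapping.single (ext a) c \<oplus>\<^bsub>u.R\<^esub> emb p))
        = mult_hom k (u.proj (Poly_Mapping.single (ext a) c)) \<oplus>\<^bsub>C\<^esub> mult_hom k (u.proj (emb p))"
      unfolding pu.add[OF su conjunct1[OF add(3)]]
      by (rule hu.add[OF pu.closed[OF su] pu.closed[OF conjunct1[OF add(3)]]])
    also have "\<dots> = mult_hom m (t.proj (Poly_Mapping.single a c)) \<oplus>\<^bsub>C\<^esub> mult_hom m (t.proj p)"
      unfolding mult_hom_proj_single[OF ext[OF add(1)]] mult_hom_proj_single[OF add(1)] prod_ext[OF add(1)]
      using add(3) by simp
    also have "\<dots> = mult_hom m (t.proj (Poly_Mapping.single a c \<oplus>\<^bsub>t.R\<^esub> p))"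
      unfolding pt.add[OF st p] by (rule ht.add[OF pt.closed[OF st] pt.closed[OF p], symmetric])
    finally show ?case
      unfolding e using pu.A.a_closed[OF su conjunct1[OF add(3)]] by simp
  qed
  obtain p0 where p0: "p0 \<in> carrier t.R" "Z = t.proj p0"
    using Z algebra_ideal.quot_sel(1)[OF t.ideal] unfolding tensor_def by blast
  interpret I: algebra_ideal t.R "tensor_ideal {1..m} factor" by (rule t.ideal)
  have const: "u.proj (emb p) = u.proj (emb p0)" if p: "p \<in> Z" for p
  proof -
    obtain i where i: "i \<in> tensor_ideal {1..m} factor" "p = i \<oplus>\<^bsub>t.R\<^esub> p0"
      using p unfolding p0(2) a_r_coset_def' by blast
    have pR: "p \<in> carrier t.R"
      unfolding i(2) by (rule pt.A.a_closed[OF I.a_Hcarr[OF i(1)] p0(1)])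
    have "t.proj p0 = t.proj p"
      by (rule I.a_repr_independence'[OF p[unfolded p0(2)] p0(1)])
    moreover have "Poly_Mapping.keys p \<subseteq> tuples m" "Poly_Mapping.keys p0 \<subseteq> tuples m"
      using pR p0(1) by simp_all
    note emb[OF this(1)] emb[OF this(2)]
    ultimately show ?thesis
      using inj_on_eq_iff[OF mult_hom_inj[of k] pu.closed pu.closed] by metis
  qed
  have "p0 \<in> Z"
    unfolding p0(2) by (rule I.a_rcos_self[OF p0(1)])
  then have "tensor_emb factor m k Z = u.proj (emb p0)"
    unfolding tensor_emb_def emb_def[symmetric] ext_def[symmetric] using const by blast
  moreover have "Poly_Mapping.keys p0 \<subseteq> tuples m" using p0(1) by simp
  ultimately show ?thesis
    using emb[of p0] pu.closed[of "emb p0"] p0(2) by (simp only:)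
qed

definition mult_image :: "nat \<Rightarrow> ('v list \<Rightarrow>\<^sub>0 'k) set set" where
  "mult_image m = mult_hom m ` carrier (tensor {1..m} factor)"

lemma mult_image_ops:
  "\<one>\<^bsub>C\<^esub> \<in> mult_image m" "\<zero>\<^bsub>C\<^esub> \<in> mult_image m" "x \<in> mult_image m \<Longrightarrow> y \<in> mult_image m \<Longrightarrow> x \<otimes>\<^bsub>C\<^esub> y \<in> mult_image m"
  "x \<in> mult_image m \<Longrightarrow> y \<in> mult_image m \<Longrightarrow> x \<oplus>\<^bsub>C\<^esub> y \<in> mult_image m" "x \<in> mult_image m \<Longrightarrow> c \<odot>\<^bsub>C\<^esub> x \<in> mult_image m"
  using algebra_hom.image_subalg[OF mult_hom[of m]] subringE[of "mult_image m" C]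
  unfolding subalg_def mult_image_def[symmetric] by simp_all

lemma twisted_subset_mult_image:
  assumes "i \<in> {1..m}" "a \<in> twisted i" shows "a \<in> mult_image m"
proof -
  interpret t: tensor_product "{1..m}" factor by (rule tensor_product_blocks)
  let ?x = "\<lambda>j. if j = i then a else \<one>\<^bsub>C\<^esub>"
  have aC: "a \<in> carrier C" by (rule twisted_carrier[OF assms(2)])
  have x: "?x j \<in> twisted j" for j using assms(2) twisted_ops(1) by simp
  have "prod_map m ?x = (if i \<le> m then a else \<one>\<^bsub>C\<^esub>)" if "1 \<le> i"
  proof (induct m)
    case 0
    show ?case using that by simp
  next
    case (Suc m)
    have "prod_map (Suc m) ?x = prod_map m ?x \<otimes>\<^bsub>C\<^esub> ?x (Suc m)" by (rule prod_map_Suc[OF x])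
    then show ?case using Suc aC by simp
  qed
  then have "prod_map m ?x = a" using assms(1) by simp
  moreover have "prod_map m (\<lambda>j\<in>{1..m}. ?x j) = prod_map m ?x" by (rule prod_map_cong) simp
  moreover have tuples: "(\<lambda>j\<in>{1..m}. ?x j) \<in> tuples m" using x by simp
  ultimately have "mult_hom m (t.pure (\<lambda>j\<in>{1..m}. ?x j)) = a"
    using mult_hom_pure[OF tuples] by simp
  then show ?thesis
    unfolding mult_image_def using t.pure_closed[OF tuples] by (rule image_eqI[OF sym])
qed

text \<open>
  $c_i$ is the product of $c_{i-1}$ and the product of all the basis vectors of $V_i$, which is an even
  element of the Clifford algebra of $V_i$ and so lies in $A_i$.
\<close>

lemma initial_word_mult_image: "i \<le> m \<Longrightarrow> word (initial_word i) \<in> mult_image m"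
proof (induct i)
  case 0
  then show ?case using mult_image_ops(1) by (simp add: initial_word_def n_zero)
next
  case (Suc i)
  let ?ds = "[n i + 1..<n (Suc i) + 1]"
  have le: "n i \<le> n (Suc i)" by (rule n_le) simp
  have ds: "set ?ds = block_indices (Suc i)" by (auto simp: block_indices_def)
  have "even (card (block_indices (Suc i)))" using n_even by (simp add: block_indices_def)
  then have "odd_letters ?ds = odd_letters (block_word (Suc i) (block_indices (Suc i)))"
    using ds by (simp add: odd_letters_block_word odd_letters_distinct del: upt_Suc)
  then have "word ?ds \<in> twisted (Suc i)"
    by (intro word_in_twisted[OF order_refl]) (simp_all only: ds block_indices_pos)
  then have "word ?ds \<in> mult_image m" using Suc(2) by (intro twisted_subset_mult_image[of "Suc i"]) simp_all
  moreover have "initial_word (Suc i) = initial_word i @ ?ds"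
    unfolding initial_word_def using le upt_add_eq_append[of 1 "n i + 1" "n (Suc i) - n i"] by simp
  moreover have "set (initial_word i) \<subseteq> {1..}" by auto
  moreover have "set ?ds \<subseteq> {1..}" unfolding ds by (rule block_indices_pos)
  ultimately show ?case
    using Suc mult_image_ops(3) by (simp only: word_append)
qed

lemma block_indices_cover: "j \<in> {1..n m} \<Longrightarrow> \<exists>i\<in>{1..m}. j \<in> block_indices i"
proof (induct m)
  case (Suc m)
  show ?case
  proof (cases "j \<le> n m")
    case True
    then obtain i where "i \<in> {1..m}" "j \<in> block_indices i" using Suc by auto
    then show ?thesis by (intro bexI[of _ i]) simp_all
  next
    case False
    then show ?thesis using Suc(2) by (intro bexI[of _ "Suc m"]) (simp_all add: block_indices_def)
  qed
qed (simp add: n_zero)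

text \<open>
  If $v_j\in V_i$, both $c_i$ and $c_ie_j$ are in the image, and $c_i(c_ie_j)$ is a nonzero multiple of
  $e_j$.
\<close>

lemma e_mult_image:
  assumes "j \<in> {1..n m}" shows "e j \<in> mult_image m"
proof -
  obtain i where i: "i \<in> {1..m}" "j \<in> block_indices i" using block_indices_cover[OF assms] by blast
  have ij: "j \<in> {1..n i}" by (rule subsetD[OF block_indices_le i(2)])
  have c: "word (initial_word i) \<in> carrier C" "e j \<in> carrier C" by simp_all
  have "odd_letters (initial_word i @ [j]) = odd_letters (block_word i {j})"
    using i(2) ij by (subst odd_letters_block_word) (auto simp: odd_letters_initial_word)
  then have "word (initial_word i @ [j]) \<in> twisted i"
    using i(2) ij by (intro word_in_twisted[of "{j}"]) auto
  moreover have "word (initial_word i @ [j]) = word (initial_word i) \<otimes>\<^bsub>C\<^esub> e j"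
    using ij c(2) by (subst word_append) auto
  ultimately have ce: "word (initial_word i) \<otimes>\<^bsub>C\<^esub> e j \<in> mult_image m" using twisted_subset_mult_image[OF i(1)] by simp
  have cH: "word (initial_word i) \<in> mult_image m" using i(1) by (intro initial_word_mult_image) simp
  have twice: "word (initial_word i) \<otimes>\<^bsub>C\<^esub> (word (initial_word i) \<otimes>\<^bsub>C\<^esub> e j) \<in> mult_image m"
    by (rule mult_image_ops(3)[OF cH ce])
  obtain s where s: "s \<noteq> 0" "word (initial_word i) \<otimes>\<^bsub>C\<^esub> word (initial_word i) = s \<odot>\<^bsub>C\<^esub> \<one>\<^bsub>C\<^esub>"
    using initial_word_square by blast
  have "word (initial_word i) \<otimes>\<^bsub>C\<^esub> (word (initial_word i) \<otimes>\<^bsub>C\<^esub> e j) = s \<odot>\<^bsub>C\<^esub> e j"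
    unfolding m_assoc[OF c(1) c(1) c(2), symmetric] s(2) using c by simp
  with twice have "s \<odot>\<^bsub>C\<^esub> e j \<in> mult_image m" by simp
  then have "inverse s \<odot>\<^bsub>C\<^esub> (s \<odot>\<^bsub>C\<^esub> e j) \<in> mult_image m" by (rule mult_image_ops(5))
  then show ?thesis using s(1) c(2) by simp
qed

lemma word_mult_image: "set us \<subseteq> {1..n m} \<Longrightarrow> word us \<in> mult_image m"
proof (induct us)
  case (Cons u us)
  then show ?case using e_mult_image[of u m] mult_image_ops(3) by simp
qed (simp add: mult_image_ops)

lemma onto_mult_image:
  assumes "b \<in> carrier C" shows "\<exists>m. b \<in> mult_image m"
proof -
  let ?G = "\<lambda>m. lin_span C {word us | us. set us \<subseteq> {1..n m}}"
  let ?W = "{word us | us. set us \<subseteq> {1..}}"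
  have W: "?W \<subseteq> carrier C" using word_closed by blast
  have Gc: "{word us | us. set us \<subseteq> {1..n m}} \<subseteq> carrier C" for m
  proof -
    have "word us \<in> carrier C" if "set us \<subseteq> {1..n m}" for us
      using that by (intro word_closed) auto
    then show ?thesis by blast
  qed
  have "alg_prod C (map g ws) \<in> lin_span C ?W" for ws
  proof -
    have "alg_prod C (map g ws) \<in> lin_span C {word us | us. set us \<subseteq> {1..} \<and> length us = length ws}"
      unfolding word_def by (rule gen_prod_lin_span) (simp, simp only: basis subset_UNIV)
    moreover have "lin_span C {word us | us. set us \<subseteq> {1..} \<and> length us = length ws} \<subseteq> lin_span C ?W"
      by (rule lin_span_mono[OF W]) blast
    ultimately show ?thesis by (rule subsetD[rotated])
  qed
  then have "lin_span C {alg_prod C (map g ws) | ws. set ws \<subseteq> UNIV} \<subseteq> lin_span C ?W"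
    by (intro lin_span_subset[OF W]) blast
  then have "b \<in> lin_span C ?W" using assms unfolding carrier_eq_lin_span by (rule subsetD)
  then have "\<exists>m. b \<in> ?G m"
  proof induct
    case zero
    show ?case using lin_span.zero by blast
  next
    case (step x y c)
    then obtain m us where m: "y \<in> ?G m" and us: "x = word us" "set us \<subseteq> {1..}" by blast
    \<comment> \<open>Large enough for all letters of the new word, as \<open>k \<le> n k\<close>.\<close>
    define k where "k = Max (insert m (set us))"
    have k: "m \<le> k" "\<And>u. u \<in> set us \<Longrightarrow> u \<le> k" by (simp_all add: k_def)
    have "k \<le> n k" using n_mono by (rule seq_suble)
    then have "set us \<subseteq> {1..n k}" using us(2) k(2) by fastforce
    then have "x \<in> {word us | us. set us \<subseteq> {1..n k}}" unfolding us(1) by blast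
    moreover have "{1..n m} \<subseteq> {1..n k}" using n_le[OF k(1)] by simp
    then have "{word us | us. set us \<subseteq> {1..n m}} \<subseteq> {word us | us. set us \<subseteq> {1..n k}}"
      by blast
    then have "y \<in> ?G k" by (rule subsetD[OF lin_span_mono[OF Gc] m])
    ultimately have "c \<odot>\<^bsub>C\<^esub> x \<oplus>\<^bsub>C\<^esub> y \<in> ?G k" by (rule lin_span.step)
    then show ?case by (rule exI)
  qed
  then obtain m where "b \<in> ?G m" by (elim exE)
  then have "b \<in> mult_image m"
  proof induct
    case (step x y c)
    then obtain us where "x = word us" "set us \<subseteq> {1..n m}" by blast
    then show ?case using step word_mult_image[of us m] by (simp only: mult_image_ops)
  qed (rule mult_image_ops(2))
  then show ?thesis by (rule exI)
qed

lemma clifford_isomorphic_inf_tensor: "alg_isomorphic C (inf_tensor factor)"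
  unfolding inf_tensor_def
proof (rule alg_isomorphic_dirlim[where h = mult_hom])
  show "algebra_hom (tensor {1..m} factor) C (mult_hom m)" for m by (rule mult_hom)
  show "inj_on (mult_hom m) (carrier (tensor {1..m} factor))" for m by (rule mult_hom_inj)
  show "tensor_emb factor m k x \<in> carrier (tensor {1..k} factor) \<and> mult_hom k (tensor_emb factor m k x) = mult_hom m x"
    if "m \<le> k" "x \<in> carrier (tensor {1..m} factor)" for m k x
    by (rule mult_hom_tensor_emb[OF that])
  show "\<exists>m. \<exists>x\<in>carrier (tensor {1..m} factor). mult_hom m x = b" if "b \<in> carrier C" for b
    using onto_mult_image[OF that] unfolding mult_image_def by blast
qed

end

theorem theorem1:
  fixes scale :: "'k :: alg_closed_field \<Rightarrow> 'v :: ab_group_add \<Rightarrow> 'v"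
    and f :: "'v \<Rightarrow> 'k" and v :: "nat \<Rightarrow> 'v" and n :: "nat \<Rightarrow> nat"
  assumes "CHAR('k) \<noteq> 2"
    and "vector_space scale"
    and "\<exists>B. countable B \<and> infinite B \<and>
           \<not> module.dependent scale B \<and> module.span scale B = UNIV"
    and "quadratic_form scale f" and "nondegenerate_form f"
    and "is_basis scale v" and "orthonormal scale f v"
    and "n 0 = 0" and "strict_mono n" and "\<forall>i. even (n i)"
  shows "(\<forall>i\<ge>1.
            subalg (block_alg scale f v n i) (clifford scale UNIV f) \<and>
            alg_isomorphic
              ((clifford scale UNIV f)\<lparr>carrier := block_alg scale f v n i\<rparr>)
              (clifford scale (block scale v n i) f)) \<and>
         (\<forall>i\<ge>1. \<forall>j\<ge>1. i \<noteq> j \<longrightarrow>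
            (\<forall>a\<in>block_alg scale f v n i. \<forall>b\<in>block_alg scale f v n j.
               a \<otimes>\<^bsub>clifford scale UNIV f\<^esub> b \<ominus>\<^bsub>clifford scale UNIV f\<^esub>
                 b \<otimes>\<^bsub>clifford scale UNIV f\<^esub> a = \<zero>\<^bsub>clifford scale UNIV f\<^esub>)) \<and>
         alg_isomorphic (clifford scale UNIV f)
           (inf_tensor (\<lambda>i. (clifford scale UNIV f)\<lparr>carrier := block_alg scale f v n i\<rparr>))"
proof -
  interpret V: vector_space scale by (rule assms)
  interpret full: clifford_space scale f UNIV
    by unfold_locales (simp_all add: assms)
  have two: "(2 :: 'k) \<noteq> 0"
  proof
    assume "(2 :: 'k) = 0"
    then have "CHAR('k) dvd 2" using of_nat_eq_0_iff_char_dvd[where 'a = 'k, of 2] by simp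
    then have "CHAR('k) = 1 \<or> CHAR('k) = 2" using two_is_prime_nat unfolding prime_nat_iff by blast
    then show False using assms(1) by simp
  qed
  have polar: "polar f (v i) (v j) = (if i = j then 2 else 0)" if "i \<ge> 1" "j \<ge> 1" for i j
  proof -
    have "polar f (v i) (v j) \<odot>\<^bsub>full.Cl\<^esub> \<one>\<^bsub>full.Cl\<^esub> = (if i = j then 2 else 0) \<odot>\<^bsub>full.Cl\<^esub> \<one>\<^bsub>full.Cl\<^esub>"
      using full.gen_anticommutator[of "v i" "v j"] assms(7) that unfolding orthonormal_def Let_def by simp
    \<comment> \<open>The trace exists for every quadratic form, and its value \<open>1\<close> at \<open>1\<close> allows the scalars to be compared.\<close>
    then have "full.trace (polar f (v i) (v j) \<odot>\<^bsub>full.Cl\<^esub> \<one>\<^bsub>full.Cl\<^esub>)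
        = full.trace ((if i = j then 2 else 0) \<odot>\<^bsub>full.Cl\<^esub> \<one>\<^bsub>full.Cl\<^esub>)" by (rule arg_cong)
    then show ?thesis
      by (simp only: full.trace_smult[OF two full.one_closed] full.trace_one[OF two] mult_1_right)
  qed
  have "f (v i) = 1" if "i \<ge> 1" for i
  proof -
    have "2 * f (v i) = 2 * 1" using polar[OF that that] full.polar_self[of "v i"] by simp
    then show ?thesis by (rule mult_left_cancel[OF two, THEN iffD1])
  qed
  then interpret orthonormal_clifford scale f v n
    by unfold_locales (use two assms polar in \<open>simp_all add: is_basis_def\<close>)
  have "a \<otimes>\<^bsub>C\<^esub> b \<ominus>\<^bsub>C\<^esub> b \<otimes>\<^bsub>C\<^esub> a = \<zero>\<^bsub>C\<^esub>" if "i \<noteq> j" "a \<in> twisted i" "b \<in> twisted j" for a b i j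
    unfolding twisted_commute[OF that] using twisted_carrier[OF that(2)] twisted_carrier[OF that(3)]
    by (simp add: a_minus_def full.r_neg)
  then show ?thesis
    unfolding block_alg_eq using twisted_subalg twisted_isomorphic clifford_isomorphic_inf_tensor by simp
qed

end
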